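(* Let $(X,Y,Z)=\{(X(t),Y(t),Z(t))\}_{t\ge 0}$ be an orthogonal random motion in $\mathbb{R}^3$ with speed $c>0$ and rate function $\lambda\in C^2((0,\infty),(0,\infty))$ such that $\Lambda(t)=\int_0^t\lambda(s)\,ds<\infty$ for all $t>0$. For $t>0$ and $x,y>0$ with $x+y<ct$, let $p(t,x,y)$ be the density defined by $$p(t,x,y)\,dx\,dy=P\{X(t)\in dx,\ Y(t)\in dy,\ X(t)+Y(t)+Z(t)=ct\}.$$ Then $$p(t,x,y)=\frac{3\sqrt3}{4}\,e^{-\Lambda(t)/2}\,q\Bigl(t,\ \frac{3x-ct}{2},\ \sqrt3\,y+\frac{\sqrt3\,(x-ct)}{2}\Bigr),$$ where (i) if $(X,Y,Z)$ is an orthogonal standard motion (OSM), $q$ is the transition density of a symmetrically deviating planar random motion with directions $v_0,v_1,v_2$ and rate function $\lambda/2$; (ii) if $(X,Y,Z)$ is an orthogonal uniform motion (OUM), $q$ is the transition density of a uniform planar random motion with directions $v_0,v_1,v_2$ and rate function $\lambda/2$. Here $v_0=(c,0)$, $v_1=(-c/2,\sqrt3c/2)$, $v_2=(-c/2,-\sqrt3c/2)$.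
   Context: Motions in $\mathbb{R}^3$. Let $d_0=(1,0,0)$, $d_1=(0,1,0)$, $d_2=(0,0,1)$, $d_3=(-1,0,0)$, $d_4=(0,-1,0)$, $d_5=(0,0,-1)$. An orthogonal random motion with speed $c>0$ and rate function $\lambda:(0,\infty)\to(0,\infty)$ is the process $(X(t),Y(t),Z(t))=c\int_0^t D(s)\,ds$, where $D(s)\in\{d_0,\dots,d_5\}$ is the current direction. The initial direction $D(0)$ is uniform on the six directions, and $D$ can change only at the events of a (possibly non-homogeneous) Poisson process with rate function $\lambda$, independent of the choices of direction. At each event the new direction is chosen, given the current one and independently of the rest of the past, as follows. - Orthogonal standard motion (OSM): uniformly among the four directions orthogonal to the current one. - Orthogonal uniform motion (OUM): uniformly among all six directions (including the current one and its opposite). Planar motions with three directions. A planar random motion with directions $v_0=(c,0)$, $v_1=(-c/2,\sqrt3c/2)$, $v_2=(-c/2,-\sqrt3c/2)$ and rate function $\mu$ starts at the origin of $\mathbb{R}^2$ with velocity uniform on $\{v_0,v_1,v_2\}$. It moves with constant velocity between the events of a Poisson process with rate function $\mu$, and at each event chooses a new velocity. It is called uniform if the new velocity is chosen uniformly among all three (including the current one), and symmetrically deviating if it is chosen uniformly between the two velocities different from the current one. At time $t$ its position lies in the closed triangle with vertices $tv_0,tv_1,tv_2$. Its transition density $q(t,u,v)$ is the density of the (absolutely continuous part of the) law of its position at time $t$ in the interior of this triangle. *)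

theory Defs
  imports "HOL-Probability.Probability"
begin

definition C2_on_pos :: "(real \<Rightarrow> real) \<Rightarrow> bool" where
  "C2_on_pos f \<longleftrightarrow> (\<exists>f' f''.
     (\<forall>t>0. (f has_real_derivative f' t) (at t) \<and> (f' has_real_derivative f'' t) (at t)) \<and>
     continuous_on {0<..} f'')"

definition cumulative_rate :: "(real \<Rightarrow> real) \<Rightarrow> real \<Rightarrow> real" where
  "cumulative_rate lam t = (LINT s:{0<..t}|lborel. lam s)"

text \<open>Counting process of a (non-homogeneous) Poisson process. Only the values of the rate
  on the positive half-line matter. Independence of the increments is required along every
  increasing sequence of times.\<close>

definition poisson_process ::
    "'a measure \<Rightarrow> (real \<Rightarrow> real) \<Rightarrow> (real \<Rightarrow> 'a \<Rightarrow> nat) \<Rightarrow> bool" where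
  "poisson_process M lam N \<longleftrightarrow>
     (\<forall>t\<ge>0. N t \<in> measurable M (count_space UNIV)) \<and>
     (\<forall>\<omega>\<in>space M. N 0 \<omega> = 0 \<and> mono_on {0..} (\<lambda>t. N t \<omega>) \<and>
        (\<forall>t\<ge>0. continuous (at_right t) (\<lambda>s. N s \<omega>))) \<and>
     (\<forall>s t. 0 \<le> s \<longrightarrow> s < t \<longrightarrow>
        distr M (count_space UNIV) (\<lambda>\<omega>. N t \<omega> - N s \<omega>)
          = measure_pmf (poisson_pmf (cumulative_rate lam t - cumulative_rate lam s))) \<and>
     (\<forall>\<tau>::nat \<Rightarrow> real. 0 \<le> \<tau> 0 \<longrightarrow> strict_mono \<tau> \<longrightarrow>
        prob_space.indep_vars M (\<lambda>_. count_space UNIV)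
          (\<lambda>i \<omega>. N (\<tau> (Suc i)) \<omega> - N (\<tau> i) \<omega>) UNIV)"

text \<open>A sequence of random vectors in \<open>S\<close>, the first one uniform on \<open>S\<close>, and each later one,
  given its predecessors, uniform on the set \<open>K d\<close> of admissible successors of the current
  one \<open>d\<close>.\<close>

definition uniform_chain ::
    "'a measure \<Rightarrow> 'v::euclidean_space set \<Rightarrow> ('v \<Rightarrow> 'v set) \<Rightarrow> (nat \<Rightarrow> 'a \<Rightarrow> 'v) \<Rightarrow> bool" where
  "uniform_chain M S K V \<longleftrightarrow>
     (\<forall>n. V n \<in> borel_measurable M) \<and>
     (\<forall>n. \<forall>\<omega>\<in>space M. V n \<omega> \<in> S) \<and>
     (\<forall>d. measure M {\<omega>\<in>space M. V 0 \<omega> = d} = pmf (pmf_of_set S) d) \<and>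
     (\<forall>n v. measure M {\<omega>\<in>space M. \<forall>i\<le>Suc n. V i \<omega> = v i}
          = measure M {\<omega>\<in>space M. \<forall>i\<le>n. V i \<omega> = v i} * pmf (pmf_of_set (K (v n))) (v (Suc n)))"

text \<open>\<open>D t\<close> is the direction at time \<open>t\<close>: the element of the chain \<open>V\<close> reached after the
  \<open>N t\<close> events up to time \<open>t\<close>. The chain and the Poisson process are independent, i.e.
  the \<open>\<sigma>\<close>-algebras they generate are.\<close>

definition direction_process ::
    "'a measure \<Rightarrow> (real \<Rightarrow> real) \<Rightarrow> 'v::euclidean_space set \<Rightarrow> ('v \<Rightarrow> 'v set)
      \<Rightarrow> (real \<Rightarrow> 'a \<Rightarrow> 'v) \<Rightarrow> bool" where
  "direction_process M lam S K D \<longleftrightarrow> (\<exists>N V.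
     poisson_process M lam N \<and> uniform_chain M S K V \<and>
     prob_space.indep_set M
       (sets (vimage_algebra (space M) (\<lambda>\<omega>. \<lambda>n\<in>UNIV. V n \<omega>) (\<Pi>\<^sub>M n\<in>UNIV. borel)))
       (sets (vimage_algebra (space M) (\<lambda>\<omega>. \<lambda>t\<in>{0..}. N t \<omega>)
          (\<Pi>\<^sub>M t\<in>{0..}. count_space UNIV))) \<and>
     (\<forall>t\<ge>0. \<forall>\<omega>\<in>space M. D t \<omega> = V (N t \<omega>) \<omega>))"

definition axis_directions :: "(real \<times> real \<times> real) set" where
  "axis_directions = {(1,0,0), (0,1,0), (0,0,1), (-1,0,0), (0,-1,0), (0,0,-1)}"

definition orthogonal_motion ::
    "'a measure \<Rightarrow> real \<Rightarrow> (real \<Rightarrow> real)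
      \<Rightarrow> (real \<times> real \<times> real \<Rightarrow> (real \<times> real \<times> real) set)
      \<Rightarrow> (real \<Rightarrow> 'a \<Rightarrow> real \<times> real \<times> real) \<Rightarrow> bool" where
  "orthogonal_motion M c lam K W \<longleftrightarrow> (\<exists>D. direction_process M lam axis_directions K D \<and>
     (\<forall>t\<ge>0. \<forall>\<omega>\<in>space M. W t \<omega> = c *\<^sub>R (LINT s:{0..t}|lborel. D s \<omega>)))"

definition orthogonal_standard_motion where
  "orthogonal_standard_motion M c lam W \<longleftrightarrow>
     orthogonal_motion M c lam (\<lambda>d. {e \<in> axis_directions. e \<bullet> d = 0}) W"

definition orthogonal_uniform_motion where
  "orthogonal_uniform_motion M c lam W \<longleftrightarrow>
     orthogonal_motion M c lam (\<lambda>d. axis_directions) W"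

definition planar_velocities :: "real \<Rightarrow> (real \<times> real) set" where
  "planar_velocities c = {(c, 0), (-c/2, sqrt 3 * c/2), (-c/2, - sqrt 3 * c/2)}"

definition planar_motion ::
    "'a measure \<Rightarrow> real \<Rightarrow> (real \<Rightarrow> real) \<Rightarrow> (real \<times> real \<Rightarrow> (real \<times> real) set)
      \<Rightarrow> (real \<Rightarrow> 'a \<Rightarrow> real \<times> real) \<Rightarrow> bool" where
  "planar_motion M c \<mu> K W \<longleftrightarrow> (\<exists>D. direction_process M \<mu> (planar_velocities c) K D \<and>
     (\<forall>t\<ge>0. \<forall>\<omega>\<in>space M. W t \<omega> = (LINT s:{0..t}|lborel. D s \<omega>)))"

definition planar_uniform_motion where
  "planar_uniform_motion M c \<mu> W \<longleftrightarrow>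
     planar_motion M c \<mu> (\<lambda>d. planar_velocities c) W"

definition planar_symmetrically_deviating_motion where
  "planar_symmetrically_deviating_motion M c \<mu> W \<longleftrightarrow>
     planar_motion M c \<mu> (\<lambda>d. planar_velocities c - {d}) W"

definition face_region :: "real \<Rightarrow> real \<Rightarrow> (real \<times> real) set" where
  "face_region c t = {(x, y). 0 < x \<and> 0 < y \<and> x + y < c * t}"

text \<open>\<open>p\<close> is a version of the density of
  \<open>P {X t \<in> dx, Y t \<in> dy, X t + Y t + Z t = c t}\<close> on \<^const>\<open>face_region\<close>.\<close>

definition is_face_density ::
    "'a measure \<Rightarrow> real \<Rightarrow> (real \<Rightarrow> 'a \<Rightarrow> real \<times> real \<times> real) \<Rightarrow> real
      \<Rightarrow> (real \<Rightarrow> real \<Rightarrow> real) \<Rightarrow> bool" where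
  "is_face_density M c W t p \<longleftrightarrow>
     set_integrable lborel (face_region c t) (\<lambda>(x, y). p x y) \<and>
     (\<forall>B\<in>sets borel. B \<subseteq> face_region c t \<longrightarrow>
        measure M {\<omega>\<in>space M. case W t \<omega> of (x, y, z) \<Rightarrow> (x, y) \<in> B \<and> x + y + z = c * t}
          = (LINT (x, y):B|lborel. p x y))"

definition planar_region :: "real \<Rightarrow> real \<Rightarrow> (real \<times> real) set" where
  "planar_region c t = interior (convex hull ((\<lambda>v. t *\<^sub>R v) ` planar_velocities c))"

text \<open>\<open>q\<close> is a version of the density of the absolutely continuous part of the law of \<open>W t\<close>
  on the open triangle: by Lebesgue decomposition, what remains of the law there
  is carried by a Lebesgue null set \<open>E\<close>.\<close>

definition is_planar_density ::
    "'a measure \<Rightarrow> real \<Rightarrow> (real \<Rightarrow> 'a \<Rightarrow> real \<times> real) \<Rightarrow> real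
      \<Rightarrow> (real \<Rightarrow> real \<Rightarrow> real) \<Rightarrow> bool" where
  "is_planar_density M c W t q \<longleftrightarrow>
     set_integrable lborel (planar_region c t) (\<lambda>(u, v). q u v) \<and>
     (\<exists>E\<in>null_sets lborel. \<forall>B\<in>sets borel. B \<subseteq> planar_region c t \<longrightarrow>
        measure M {\<omega>\<in>space M. W t \<omega> \<in> B}
          = (LINT (u, v):B|lborel. q u v) + measure M {\<omega>\<in>space M. W t \<omega> \<in> B \<inter> E})"

end

theory Submission
  imports Defs
begin

text \<open>Up to null events, \<open>X + Y + Z = c t\<close> says that every direction used up to time \<open>t\<close> is one of
  \<open>d\<^sub>0, d\<^sub>1, d\<^sub>2\<close>. A chain of \<open>n + 1\<close> such directions has \<open>2 ^ (n + 1)\<close> times smaller probability than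
  the corresponding chain of the three planar velocities, while \<open>n\<close> events in given cells are
  \<open>2 ^ n exp (- \<Lambda>(t) / 2)\<close> times more likely at rate \<open>\<lambda>\<close> than at rate \<open>\<lambda> / 2\<close>. So the law on the face is
  \<open>exp (- \<Lambda>(t) / 2) / 2\<close> times the planar law, transported by an affine map of determinant
  \<open>3 sqrt 3 / 2\<close>. The laws of the two time integrals given \<open>n\<close> and the directions are compared through
  Riemann sums, which depend on finitely many Poisson increments only. Absolute continuity on the open
  face holds because there all three directions occur, so that the position is an affine
  function of independent waiting times in which two waiting times have linearly independent
  coefficients.\<close>

section \<open>Counting paths\<close>

text \<open>The hypotheses describe increments along increasing sequences of times and say nothing
  about arrival times, whose joint law for a general rate would have to be built first. Hence
  waiting times are measured from the points of a regular mesh and truncated at the cell width.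
  Those of different cells are determined by increments over disjoint intervals, so they are
  independent, and on a mesh with at most one jump per cell the position is affine in them.
  Truncation leaves an atom at the cell width; it is harmless because a cell with a jump almost
  surely has a smaller waiting time. The rate may be unbounded near 0, so the cumulative rate is
  only continuous there and densities are obtained on open intervals. The definition of
  \<open>q\<close> leaves room for a singular part of the planar law in the open triangle. It is
  excluded from the other side: the face law gives no mass to null sets, and the equality of laws
  carries this over to the triangle. Each step of the chain costs a factor 1/2 and each event gains
  a factor 2; what remains is the initial choice, 1/6 against 1/3.\<close>

definition counting_path :: "(real \<Rightarrow> nat) \<Rightarrow> bool" where
  "counting_path n \<longleftrightarrow> n 0 = 0 \<and> mono_on {0..} n \<and> (\<forall>t\<ge>0. continuous (at_right t) n)"

lemma counting_path_le: "counting_path n \<Longrightarrow> 0 \<le> s \<Longrightarrow> s \<le> t \<Longrightarrow> n s \<le> n t"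
  unfolding counting_path_def by (elim conjE mono_onD) auto

text \<open>In a discrete space a right limit is attained, so the path is constant just after
  \<open>s\<close>; halving the radius makes the interval closed.\<close>

lemma counting_path_right_constant:
  assumes "counting_path n" "0 \<le> s"
  obtains e where "e > 0" "\<And>u. s \<le> u \<Longrightarrow> u \<le> s + e \<Longrightarrow> n u = n s"
proof -
  have "(n \<longlongrightarrow> n s) (at_right s)"
    using assms by (auto simp: counting_path_def continuous_within)
  then have "eventually (\<lambda>u. n u = n s) (at_right s)"
    by (simp add: tendsto_discrete)
  then obtain b where b: "b > s" "\<And>u. s < u \<Longrightarrow> u < b \<Longrightarrow> n u = n s"
    by (auto simp: eventually_at_right_field)
  show thesis
  proof (rule that[of "(b - s) / 2"])
    show "n u = n s" if "s \<le> u" "u \<le> s + (b - s) / 2" for u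
      using b(2)[of u] that b(1) by (cases "u = s") (auto simp: field_simps)
  qed (use b in auto)
qed

lemma counting_path_measurable:
  fixes v :: "nat \<Rightarrow> 'b::{second_countable_topology,real_normed_vector}"
  assumes "counting_path n"
  shows "(\<lambda>s. v (n s)) \<in> borel_measurable (restrict_space borel {0..})"
proof -
  have "mono_on {0..} (\<lambda>s. real (n s))"
    using assms by (auto simp: counting_path_def mono_on_def)
  then have m: "(\<lambda>s. real (n s)) \<in> borel_measurable (restrict_space borel {0..})"
    by (rule borel_measurable_mono_on_fnc)
  \<comment> \<open>\<open>nat\<close> of the floor undoes \<open>real\<close>, so measurability of
    the monotone real path passes through the discrete index to an arbitrary
    \<open>v\<close>.\<close>
  have "(\<lambda>s. v (nat \<lfloor>real (n s)\<rfloor>)) \<in> borel_measurable (restrict_space borel {0..})"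
    by (rule measurable_compose[OF _ borel_measurable_count_space])
       (use m in measurable)
  then show ?thesis by simp
qed

lemma set_integrable_counting_path:
  fixes v :: "nat \<Rightarrow> 'b::euclidean_space"
  assumes n: "counting_path n" and ab: "0 \<le> a"
  shows "set_integrable lborel {a..b} (\<lambda>s. v (n s))"
proof -
  have "(\<lambda>s. v (n s)) \<in> borel_measurable (restrict_space borel {a..b})"
    using measurable_restrict_mono[OF counting_path_measurable[OF n, of v], of "{a..b}"] ab
    by auto
  then have m: "set_borel_measurable borel {a..b} (\<lambda>s. v (n s))"
    unfolding set_borel_measurable_def by (subst borel_measurable_restrict_space_iff[symmetric]) auto
  \<comment> \<open>On \<open>{a..b}\<close> only indices up to \<open>n b\<close> occur; the sum of
    their norms is a bound even for unbounded \<open>v\<close>.\<close>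
  have "norm (v (n s)) \<le> (\<Sum>k\<le>n b. norm (v k))" if "s \<in> {a..b}" for s
    using counting_path_le[OF n, of s b] that ab
    by (intro member_le_sum) auto
  then have "norm (indicator {a..b} s *\<^sub>R v (n s)) \<le> norm (indicator {a..b} s *\<^sub>R (\<Sum>k\<le>n b. norm (v k)))" for s
    by (auto simp: indicator_def sum_nonneg)
  then have le: "AE s in lborel. norm (indicator {a..b} s *\<^sub>R v (n s))
      \<le> norm (indicator {a..b} s *\<^sub>R (\<Sum>k\<le>n b. norm (v k)))"
    by simp
  have "integrable lborel (\<lambda>s. indicator {a..b} s *\<^sub>R (\<Sum>k\<le>n b. norm (v k)))"
    by (intro integrable_scaleR_left integrable_real_indicator) (auto simp: emeasure_lborel_Icc_eq)
  then show ?thesis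
    unfolding set_integrable_def
    by (rule Bochner_Integration.integrable_bound[OF _ _ le])
       (use m in \<open>simp add: set_borel_measurable_def\<close>)
qed

lemma counting_path_integrable_on:
  fixes v :: "nat \<Rightarrow> 'b::euclidean_space"
  assumes "counting_path n" "0 \<le> a"
  shows "(\<lambda>s. v (n s)) integrable_on {a..b}"
  by (rule set_borel_integral_eq_integral(1)[OF set_integrable_counting_path[OF assms]])

lemma integral_uniform_mesh:
  fixes f :: "real \<Rightarrow> 'b::euclidean_space"
  assumes "f integrable_on {0..real m * h}" "h \<ge> 0"
  shows "integral {0..real m * h} f = (\<Sum>i<m. integral {real i * h..real i * h + h} f)"
  using assms(1)
proof (induction m)
  case (Suc m)
  have le: "real m * h \<le> real (Suc m) * h" using assms(2) by (simp add: mult_right_mono)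
  have "f integrable_on {0..real m * h}"
    by (rule integrable_on_subinterval[OF Suc.prems]) (use le in auto)
  then have "(\<Sum>i<Suc m. integral {real i * h..real i * h + h} f)
      = integral {0..real m * h} f + integral {real m * h..real (Suc m) * h} f"
    using Suc.IH by (simp add: algebra_simps)
  also have "\<dots> = integral {0..real (Suc m) * h} f"
    using Suc.prems assms(2) le by (intro Henstock_Kurzweil_Integration.integral_combine) auto
  finally show ?case by simp
qed simp

text \<open>Time from \<open>s\<close> to the next jump, truncated at \<open>h\<close>.\<close>

definition waiting_time :: "(real \<Rightarrow> nat) \<Rightarrow> real \<Rightarrow> real \<Rightarrow> real" where
  "waiting_time n s h = integral {s..s + h} (\<lambda>u. if n u = n s then 1 else 0)"

text \<open>The third part is the link to the Poisson process: below the truncation level the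
  distribution function of a waiting time is a statement about one increment. The time
  \<open>s + x\<close> itself counts, because right-continuity prolongs constancy up to
  \<open>s + x\<close> a little further, so that the waiting time then exceeds \<open>x\<close>
  strictly.\<close>

lemma waiting_time_bounds:
  assumes n: "counting_path n" and s: "0 \<le> s" "0 < h"
  shows "0 < waiting_time n s h" "waiting_time n s h \<le> h"
    and "0 \<le> x \<Longrightarrow> x < h \<Longrightarrow> waiting_time n s h \<le> x \<longleftrightarrow> n s < n (s + x)"
proof -
  let ?g = "\<lambda>u. if n u = n s then 1 else 0 :: real"
  have I: "?g integrable_on {a..b}" if "0 \<le> a" for a b
    using counting_path_integrable_on[OF n that, of "\<lambda>k. if k = n s then 1 else 0"] .
  have low: "waiting_time n s h > x" if "0 \<le> x" "x < h" "n (s + x) = n s" for x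
  proof -
    obtain e where e: "e > 0" "\<And>u. s + x \<le> u \<Longrightarrow> u \<le> s + x + e \<Longrightarrow> n u = n (s + x)"
      using counting_path_right_constant[OF n add_nonneg_nonneg[OF s(1) \<open>0 \<le> x\<close>]] by metis
    define y where "y = min h (x + e)"
    have y: "x < y" "y \<le> h" "y \<le> x + e" using e that by (auto simp: y_def)
    have eq: "n u = n s" if u: "s \<le> u" "u \<le> s + y" for u
    proof (cases "u \<le> s + x")
      case True
      then have "n s \<le> n u" "n u \<le> n (s + x)" using n u s \<open>0 \<le> x\<close> by (auto intro: counting_path_le)
      then show ?thesis using \<open>n (s + x) = n s\<close> by simp
    next
      case False
      then show ?thesis using e(2)[of u] u y \<open>n (s + x) = n s\<close> by auto
    qed
    have "y = integral {s..s + y} (\<lambda>u. 1 :: real)" using y that by simp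
    also have "\<dots> = integral {s..s + y} ?g"
      by (rule Henstock_Kurzweil_Integration.integral_cong) (subst eq, auto)
    also have "\<dots> \<le> waiting_time n s h"
      unfolding waiting_time_def by (rule integral_subset_le) (use y I s in auto)
    finally show ?thesis using y by simp
  qed
  show "0 < waiting_time n s h" using low[of 0] s by simp
  have "waiting_time n s h \<le> integral {s..s + h} (\<lambda>u. 1 :: real)"
    unfolding waiting_time_def by (rule integral_le) (use I s in auto)
  then show "waiting_time n s h \<le> h" using s by simp
  have up: "waiting_time n s h \<le> x" if "0 \<le> x" "x < h" "n s < n (s + x)" for x
  proof -
    have "?g u = 0" if "u \<in> {s + x..s + h}" for u
      using counting_path_le[OF n, of "s + x" u] that s \<open>0 \<le> x\<close> \<open>n s < n (s + x)\<close> by auto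
    then have z: "integral {s + x..s + h} ?g = 0"
      using Henstock_Kurzweil_Integration.integral_cong[of "{s + x..s + h}" ?g "\<lambda>_. 0"] by simp
    have "waiting_time n s h = integral {s..s + x} ?g + integral {s + x..s + h} ?g"
      unfolding waiting_time_def using that s I[of s "s + h"]
      by (intro Henstock_Kurzweil_Integration.integral_combine[symmetric]) auto
    also have "\<dots> \<le> integral {s..s + x} (\<lambda>u. 1 :: real) + 0"
      unfolding z by (intro add_mono integral_le) (use I s in auto)
    finally show ?thesis using that by simp
  qed
  show "waiting_time n s h \<le> x \<longleftrightarrow> n s < n (s + x)" if "0 \<le> x" "x < h"
    using low[OF that] up[OF that] counting_path_le[OF n, of s "s + x"] s that
    by (smt (verit) le_neq_implies_less)
qed

text \<open>Every value in the cell is the first or the last one, so the integrand is an affine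
  function of the indicator of the first. A cell without a jump has coefficient 0; a cell with the
  jump from \<open>k\<close> to \<open>k + 1\<close> has coefficient
  \<open>v k - v (k + 1)\<close>.\<close>

lemma integral_at_most_one_jump:
  fixes v :: "nat \<Rightarrow> 'b::euclidean_space"
  assumes n: "counting_path n" and s: "0 \<le> s" "0 < h" and le: "n (s + h) \<le> n s + 1"
  shows "integral {s..s + h} (\<lambda>u. v (n u))
    = waiting_time n s h *\<^sub>R (v (n s) - v (n (s + h))) + h *\<^sub>R v (n (s + h))"
proof -
  let ?g = "\<lambda>u. if n u = n s then 1 else 0 :: real"
  have I: "?g integrable_on {s..s + h}"
    using counting_path_integrable_on[OF n, of s "\<lambda>k. if k = n s then 1 else 0"] s by simp
  have "v (n u) = ?g u *\<^sub>R (v (n s) - v (n (s + h))) + v (n (s + h))" if "u \<in> {s..s + h}" for u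
  proof -
    have "n u = n s \<or> n u = n (s + h)"
      using counting_path_le[OF n, of s u] counting_path_le[OF n, of u "s + h"] that s le by force
    then show ?thesis by auto
  qed
  then have "integral {s..s + h} (\<lambda>u. v (n u))
     = integral {s..s + h} (\<lambda>u. ?g u *\<^sub>R (v (n s) - v (n (s + h))) + v (n (s + h)))"
    by (rule Henstock_Kurzweil_Integration.integral_cong)
  also have "\<dots> = waiting_time n s h *\<^sub>R (v (n s) - v (n (s + h))) + h *\<^sub>R v (n (s + h))"
    unfolding waiting_time_def using s I
    by (subst Henstock_Kurzweil_Integration.integral_add)
       (auto intro!: integrable_on_scaleR_left
          integral_unique[OF has_integral_scaleR_left[OF integrable_integral]])
  finally show ?thesis .
qed

text \<open>A cell without a jump contributes no error, any other at most \<open>2 * K\<close> times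
  its width, hence at most that multiple of its increment; the increments telescope to
  \<open>n t\<close>.\<close>

lemma norm_Riemann_sum_counting_path:
  fixes v :: "nat \<Rightarrow> 'b::euclidean_space"
  assumes n: "counting_path n" and t: "0 < t" and m: "0 < m" and K: "\<And>k. norm (v k) \<le> K"
  shows "norm (integral {0..t} (\<lambda>s. v (n s)) - (\<Sum>i<m. (t / m) *\<^sub>R v (n (real i * (t / m)))))
    \<le> 2 * K * (t / m) * real (n t)"
proof -
  define h where "h = t / m"
  have h: "h > 0" "real m * h = t" using t m by (auto simp: h_def)
  have b: "norm (integral {a..a + h} (\<lambda>s. v (n s)) - h *\<^sub>R v (n a))
      \<le> 2 * K * h * (real (n (a + h)) - real (n a))" if a: "0 \<le> a" for a
  proof -
    have I: "(\<lambda>s. v (n s)) integrable_on {a..a + h}"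
      using counting_path_integrable_on[OF n a] .
    have K0: "K \<ge> 0" using order_trans[OF norm_ge_zero K[of 0]] .
    have "norm (v (n s) - v (n a)) \<le> 2 * K * (real (n (a + h)) - real (n a))"
      if s: "s \<in> {a..a + h}" for s
    proof (cases "n (a + h) = n a")
      case True
      then have "n s = n a"
        using counting_path_le[OF n, of a s] counting_path_le[OF n, of s "a + h"] s a by auto
      then show ?thesis using True by simp
    next
      case False
      then have "n a + 1 \<le> n (a + h)"
        using counting_path_le[OF n, of a "a + h"] a h by simp
      then have "1 \<le> real (n (a + h)) - real (n a)" by linarith
      then have "2 * K * 1 \<le> 2 * K * (real (n (a + h)) - real (n a))"
        using K0 by (intro mult_left_mono) auto
      then show ?thesis
        using norm_triangle_ineq4[of "v (n s)" "v (n a)"] K[of "n s"] K[of "n a"] by linarith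
    qed
    then have "norm (integral {a..a + h} (\<lambda>s. v (n s) - v (n a)))
        \<le> integral {a..a + h} (\<lambda>s. 2 * K * (real (n (a + h)) - real (n a)))"
      by (intro integral_norm_bound_integral) (use I in \<open>auto intro!: integrable_diff\<close>)
    moreover have "integral {a..a + h} (\<lambda>s. v (n s) - v (n a))
        = integral {a..a + h} (\<lambda>s. v (n s)) - h *\<^sub>R v (n a)"
      using h I by (subst Henstock_Kurzweil_Integration.integral_diff) auto
    ultimately show ?thesis using h by (simp add: algebra_simps)
  qed
  have "integral {0..t} (\<lambda>s. v (n s)) - (\<Sum>i<m. h *\<^sub>R v (n (real i * h)))
      = (\<Sum>i<m. integral {real i * h..real i * h + h} (\<lambda>s. v (n s)) - h *\<^sub>R v (n (real i * h)))"
    using integral_uniform_mesh[of "\<lambda>s. v (n s)" m h] h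
      counting_path_integrable_on[OF n, of 0 v t] by (simp add: sum_subtractf)
  also have "norm \<dots> \<le> (\<Sum>i<m. 2 * K * h * (real (n (real i * h + h)) - real (n (real i * h))))"
    by (rule order_trans[OF norm_sum sum_mono]) (use b h in auto)
  also have "\<dots> = 2 * K * h * (\<Sum>i<m. real (n (real (Suc i) * h)) - real (n (real i * h)))"
    by (simp add: sum_distrib_left algebra_simps)
  also have "\<dots> = 2 * K * h * real (n t)"
    using n h sum_lessThan_telescope[of "\<lambda>i. real (n (real i * h))" m]
    by (simp add: counting_path_def)
  finally show ?thesis unfolding h_def .
qed

lemma Riemann_sum_counting_path_tendsto:
  fixes v :: "nat \<Rightarrow> 'b::euclidean_space"
  assumes n: "counting_path n" and t: "0 < t" and v: "bounded (range v)"
  shows "(\<lambda>m. \<Sum>i<Suc m. (t / Suc m) *\<^sub>R v (n (real i * (t / Suc m))))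
    \<longlonglongrightarrow> integral {0..t} (\<lambda>s. v (n s))"
proof -
  obtain K where K: "\<And>k. norm (v k) \<le> K" using v by (auto simp: bounded_iff)
  have "(\<lambda>m. (2 * K * t * real (n t)) * inverse (real (Suc m))) \<longlonglongrightarrow> (2 * K * t * real (n t)) * 0"
    by (intro tendsto_intros LIMSEQ_inverse_real_of_nat)
  then have l: "(\<lambda>m. 2 * K * (t / Suc m) * real (n t)) \<longlonglongrightarrow> 0" by (simp add: field_simps)
  show ?thesis
  proof (subst LIM_zero_iff[symmetric], rule Lim_null_comparison[OF _ l], rule always_eventually, rule allI)
    fix m
    show "norm ((\<Sum>i<Suc m. (t / Suc m) *\<^sub>R v (n (real i * (t / Suc m)))) - integral {0..t} (\<lambda>s. v (n s)))
       \<le> 2 * K * (t / Suc m) * real (n t)"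
      using norm_Riemann_sum_counting_path[OF n t _ K, of "Suc m"] by (subst norm_minus_commute) simp
  qed
qed

section \<open>Poisson processes\<close>

lemma cumulative_rate_0: "cumulative_rate lam 0 = 0"
  by (simp add: cumulative_rate_def set_lebesgue_integral_def)

lemma cumulative_rate_half: "cumulative_rate (\<lambda>s. lam s / 2) t = cumulative_rate lam t / 2"
  by (simp add: cumulative_rate_def)

lemma cumulative_rate_mono:
  assumes "\<And>s. 0 < s \<Longrightarrow> 0 \<le> lam s" "\<And>s. 0 < s \<Longrightarrow> set_integrable lborel {0<..s} lam"
    and "0 \<le> s" "s \<le> t"
  shows "cumulative_rate lam s \<le> cumulative_rate lam t"
proof (cases "t = 0")
  case False
  then have i: "set_integrable lborel {0<..t} lam" using assms by auto
  have "set_integrable lborel {0<..s} lam"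
    by (rule set_integrable_subset[OF i]) (use assms in auto)
  then show ?thesis using i unfolding cumulative_rate_def set_lebesgue_integral_def set_integrable_def
    by (intro integral_mono) (use assms in \<open>auto simp: indicator_def\<close>)
qed (use assms in auto)

lemma cumulative_rate_eq_integral:
  assumes "\<And>s. 0 < s \<Longrightarrow> set_integrable lborel {0<..s} lam" "0 < T"
  shows "lam integrable_on {0..T}" "cumulative_rate lam T = integral {0..T} lam"
proof -
  note E = set_borel_integral_eq_integral[OF assms(1)[OF \<open>0 < T\<close>]]
  have n: "negligible (({0<..T} - {0..T}) \<union> ({0..T} - {0<..T}))"
    by (rule negligible_subset[of "{0}"]) auto
  show "lam integrable_on {0..T}"
    by (rule integrable_spike_set[OF E(1)]) (rule negligible_subset[OF n]; auto)+
  show "cumulative_rate lam T = integral {0..T} lam"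
    unfolding cumulative_rate_def E(2)
    by (rule integral_spike_set) (rule negligible_subset[OF n]; auto)+
qed

text \<open>Continuity is needed up to 0, where \<open>lam\<close> is only integrable and may be
  unbounded; it holds for every indefinite integral.\<close>

lemma continuous_on_cumulative_rate:
  assumes "\<And>s. 0 < s \<Longrightarrow> set_integrable lborel {0<..s} lam" "0 < T"
  shows "continuous_on {0..T} (cumulative_rate lam)"
proof -
  have "continuous_on {0..T} (\<lambda>x. integral {0..x} lam)"
    by (rule indefinite_integral_continuous_1[OF cumulative_rate_eq_integral(1)[OF assms]])
  moreover have "integral {0..x} lam = cumulative_rate lam x" if "x \<in> {0..T}" for x
  proof (cases "x = 0")
    case False
    then show ?thesis using cumulative_rate_eq_integral(2)[OF assms(1), of x] that by auto
  qed (simp add: cumulative_rate_0)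
  ultimately show ?thesis using continuous_on_cong[OF refl] by (metis (no_types, lifting))
qed

lemma DERIV_cumulative_rate:
  assumes i: "\<And>s. 0 < s \<Longrightarrow> set_integrable lborel {0<..s} lam"
    and c: "continuous_on {0<..} lam" and t: "0 < t"
  shows "(cumulative_rate lam has_real_derivative lam t) (at t)"
proof -
  \<comment> \<open>The base point \<open>t/2\<close> keeps the interval inside the region where
    \<open>lam\<close> is continuous; the integral from 0 to \<open>t/2\<close> is an additive
    constant.\<close>
  have "((\<lambda>x. integral {t/2..x} lam) has_real_derivative lam t) (at t within {t/2..2*t})"
    by (rule integral_has_real_derivative) (use t in \<open>auto intro: continuous_on_subset[OF c]\<close>)
  then have "((\<lambda>x. integral {t/2..x} lam) has_real_derivative lam t) (at t)"
    using at_within_interior[of t "{t/2..2*t}"] t by (simp add: interior_atLeastAtMost_real)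
  then have D: "((\<lambda>x. integral {0..t/2} lam + integral {t/2..x} lam) has_real_derivative lam t) (at t)"
    by (auto intro!: derivative_eq_intros)
  have "eventually (\<lambda>x. x \<in> {t/2<..}) (nhds t)"
    by (rule eventually_nhds_in_open) (use t in auto)
  then have ev: "eventually (\<lambda>x. integral {0..t/2} lam + integral {t/2..x} lam = cumulative_rate lam x) (nhds t)"
  proof eventually_elim
    case (elim x)
    then show ?case
      using cumulative_rate_eq_integral[OF i, of x] t
      by (subst Henstock_Kurzweil_Integration.integral_combine) auto
  qed
  show ?thesis
    using D DERIV_cong_ev[OF refl ev refl] by simp
qed

text \<open>Instantiated with rate \<open>lam\<close> for the spatial motion and with rate
  \<open>lam / 2\<close> for the planar one.\<close>

locale poisson_counting = prob_space M for M :: "'a measure" +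
  fixes lam :: "real \<Rightarrow> real" and N :: "real \<Rightarrow> 'a \<Rightarrow> nat"
  assumes poisson: "poisson_process M lam N"
    and rate_pos: "\<And>s. 0 < s \<Longrightarrow> 0 < lam s"
    and rate_integrable: "\<And>s. 0 < s \<Longrightarrow> set_integrable lborel {0<..s} lam"
    and rate_continuous: "continuous_on {0<..} lam"
begin

abbreviation Lam :: "real \<Rightarrow> real" where "Lam \<equiv> cumulative_rate lam"

lemma Lam_mono: "0 \<le> s \<Longrightarrow> s \<le> t \<Longrightarrow> Lam s \<le> Lam t"
  by (rule cumulative_rate_mono) (auto intro: rate_integrable less_imp_le[OF rate_pos])

text \<open>The derivative \<open>lam\<close> is positive inside the interval, and continuity takes
  care of the left end, which may be 0.\<close>

lemma Lam_strict_mono: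
  assumes "0 \<le> s" "s < t"
  shows "Lam s < Lam t"
proof (rule DERIV_pos_imp_increasing_open[OF \<open>s < t\<close>])
  show "\<exists>y. (Lam has_real_derivative y) (at x) \<and> 0 < y" if "s < x" "x < t" for x
    using DERIV_cumulative_rate[OF rate_integrable rate_continuous, of x] rate_pos[of x] that assms
    by auto
  show "continuous_on {s..t} Lam"
    by (rule continuous_on_subset[OF continuous_on_cumulative_rate[of lam t]])
       (use assms rate_integrable in auto)
qed

lemma Lam_nonneg: "0 \<le> t \<Longrightarrow> 0 \<le> Lam t"
  using Lam_mono[of 0 t] by (simp add: cumulative_rate_0)

lemma Lam_tendsto:
  assumes "0 \<le> s" "s < t"
  shows "(Lam \<longlongrightarrow> Lam t) (at_left t)" "(Lam \<longlongrightarrow> Lam s) (at_right s)"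
proof -
  have c: "continuous_on {0..t+1} Lam"
    by (rule continuous_on_cumulative_rate) (use assms rate_integrable in auto)
  then have "continuous_on {s..t} Lam" by (rule continuous_on_subset) (use assms in auto)
  then show "(Lam \<longlongrightarrow> Lam t) (at_left t)" "(Lam \<longlongrightarrow> Lam s) (at_right s)"
    using assms by (auto simp: continuous_on_Icc_at_leftD continuous_on_Icc_at_rightD)
qed

lemma N_measurable [measurable]: "0 \<le> t \<Longrightarrow> N t \<in> measurable M (count_space UNIV)"
  using poisson by (auto simp: poisson_process_def)

lemma counting_path_N: "\<omega> \<in> space M \<Longrightarrow> counting_path (\<lambda>t. N t \<omega>)"
  using poisson by (auto simp: poisson_process_def counting_path_def)

lemma N_mono: "\<omega> \<in> space M \<Longrightarrow> 0 \<le> s \<Longrightarrow> s \<le> t \<Longrightarrow> N s \<omega> \<le> N t \<omega>"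
  using counting_path_le[OF counting_path_N] .

lemma N_0: "\<omega> \<in> space M \<Longrightarrow> N 0 \<omega> = 0"
  using counting_path_N by (auto simp: counting_path_def)

lemma prob_increment:
  assumes "0 \<le> s" "s < t"
  shows "prob {\<omega>\<in>space M. N t \<omega> - N s \<omega> \<in> A} = measure (poisson_pmf (Lam t - Lam s)) A"
proof -
  have [measurable]: "N s \<in> measurable M (count_space UNIV)" "N t \<in> measurable M (count_space UNIV)"
    using assms by auto
  have "measure (poisson_pmf (Lam t - Lam s)) A
      = measure (distr M (count_space UNIV) (\<lambda>\<omega>. N t \<omega> - N s \<omega>)) A"
    using poisson assms by (simp add: poisson_process_def)
  also have "\<dots> = prob {\<omega>\<in>space M. N t \<omega> - N s \<omega> \<in> A}"
    by (subst measure_distr) (auto intro!: arg_cong[where f=prob])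
  finally show ?thesis by simp
qed

text \<open>The set \<open>J\<close> may have gaps: \<open>indep_vars_wait\<close> prescribes only
  every other increment of its sequence.\<close>

lemma prob_increments:
  assumes s: "0 \<le> s 0" "strict_mono s" and J: "finite J"
  shows "prob {\<omega>\<in>space M. \<forall>i\<in>J. N (s (Suc i)) \<omega> - N (s i) \<omega> \<in> A i}
    = (\<Prod>i\<in>J. measure (poisson_pmf (Lam (s (Suc i)) - Lam (s i))) (A i))"
proof (cases "J = {}")
  case False
  have s0: "0 \<le> s i" "s i < s (Suc i)" for i
    using s strict_monoD[OF s(2), of 0 i] strict_monoD[OF s(2), of i "Suc i"]
    by (cases "i = 0"; auto)+
  have "indep_vars (\<lambda>_. count_space UNIV) (\<lambda>i \<omega>. N (s (Suc i)) \<omega> - N (s i) \<omega>) UNIV"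
    using poisson s by (simp add: poisson_process_def)
  from indep_varsD[OF this, of J A] False J
  have "prob (\<Inter>i\<in>J. (\<lambda>\<omega>. N (s (Suc i)) \<omega> - N (s i) \<omega>) -` A i \<inter> space M)
      = (\<Prod>i\<in>J. prob ((\<lambda>\<omega>. N (s (Suc i)) \<omega> - N (s i) \<omega>) -` A i \<inter> space M))" by simp
  also have "(\<Inter>i\<in>J. (\<lambda>\<omega>. N (s (Suc i)) \<omega> - N (s i) \<omega>) -` A i \<inter> space M)
      = {\<omega>\<in>space M. \<forall>i\<in>J. N (s (Suc i)) \<omega> - N (s i) \<omega> \<in> A i}" using False by auto
  also have "(\<Prod>i\<in>J. prob ((\<lambda>\<omega>. N (s (Suc i)) \<omega> - N (s i) \<omega>) -` A i \<inter> space M))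
     = (\<Prod>i\<in>J. measure (poisson_pmf (Lam (s (Suc i)) - Lam (s i))) (A i))"
    using prob_increment[OF s0] by (intro prod.cong) (simp_all add: vimage_def Int_def conj_commute)
  finally show ?thesis .
qed (simp add: prob_space)

section \<open>Almost sure regularity of the jumps\<close>

lemma poisson_pmf_ge_1: "0 < r \<Longrightarrow> measure (poisson_pmf r) {1..} \<le> r"
proof -
  assume r: "0 < r"
  have "measure (poisson_pmf r) (UNIV - {0}) = 1 - measure (poisson_pmf r) {0}"
    using measure_pmf.prob_compl[of "{0}" "poisson_pmf r"] by simp
  also have "UNIV - {0} = {1::nat..}" by auto
  finally show ?thesis
    using r exp_ge_add_one_self[of "-r"] by (simp add: measure_pmf_single)
qed

lemma poisson_pmf_ge_2: "0 < r \<Longrightarrow> measure (poisson_pmf r) {2..} \<le> r\<^sup>2"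
proof -
  assume r: "0 < r"
  have "measure (poisson_pmf r) (UNIV - {0, 1}) = 1 - measure (poisson_pmf r) {0, 1}"
    using measure_pmf.prob_compl[of "{0,1}" "poisson_pmf r"] by simp
  also have "measure (poisson_pmf r) {0, 1} = (1 + r) * exp (- r)"
    using r by (subst measure_measure_pmf_finite) (auto simp: algebra_simps)
  also have "UNIV - {0, 1} = {2::nat..}" by auto
  finally have "measure (poisson_pmf r) {2..} = 1 - (1 + r) * exp (- r)" .
  moreover have "(1 + r) * (1 + - r) \<le> (1 + r) * exp (- r)"
    by (rule mult_left_mono[OF exp_ge_add_one_self]) (use r in auto)
  ultimately show ?thesis by (simp add: algebra_simps power2_eq_square)
qed

text \<open>A jump at \<open>t\<close> gives a nonzero increment over every interval from
  \<open>s < t\<close> to \<open>t\<close>, an event of probability at most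
  \<open>Lam t - Lam s\<close>, which tends to 0 by continuity of \<open>Lam\<close>.\<close>

lemma AE_no_jump_at:
  assumes t: "0 < t"
  shows "AE \<omega> in M. \<exists>s. 0 \<le> s \<and> s < t \<and> N s \<omega> = N t \<omega>"
proof -
  define s where "s = (\<lambda>i. t - t / Suc i)"
  have s: "0 \<le> s i" "s i < t" for i using t by (auto simp: s_def field_simps)
  have [measurable]: "N (s i) \<in> measurable M (count_space UNIV)" "N t \<in> measurable M (count_space UNIV)" for i
    using s t by auto
  let ?B = "{\<omega>\<in>space M. \<forall>i. N t \<omega> - N (s i) \<omega> \<in> {1..}}"
  have le: "prob ?B \<le> Lam t - Lam (s i)" for i
  proof -
    have "prob ?B \<le> prob {\<omega>\<in>space M. N t \<omega> - N (s i) \<omega> \<in> {1..}}"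
      by (intro finite_measure_mono) (auto, measurable)
    also have "\<dots> \<le> Lam t - Lam (s i)"
      unfolding prob_increment[OF s] by (rule poisson_pmf_ge_1) (use Lam_strict_mono s in auto)
    finally show ?thesis .
  qed
  have "(\<lambda>i. t - t * inverse (real (Suc i))) \<longlonglongrightarrow> t - t * 0"
    by (intro tendsto_intros LIMSEQ_inverse_real_of_nat)
  then have "filterlim s (at_left t) sequentially"
    unfolding filterlim_at using s by (auto simp: s_def field_simps intro!: always_eventually)
  from filterlim_compose[OF Lam_tendsto(1)[of 0 t] this] t
  have "(\<lambda>i. Lam t - Lam (s i)) \<longlonglongrightarrow> Lam t - Lam t" by (intro tendsto_intros) auto
  then have "prob ?B \<le> 0"
    by (intro LIMSEQ_le_const[of "\<lambda>i. Lam t - Lam (s i)"]) (use le in auto)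
  then have "prob ?B = 0" using measure_nonneg[of M ?B] by linarith
  moreover have "?B \<in> sets M" by measurable
  ultimately have "?B \<in> null_sets M" by (intro null_setsI) (simp_all add: emeasure_eq_measure)
  then have "AE \<omega> in M. \<omega> \<notin> ?B" by (rule AE_not_in)
  then show ?thesis using AE_space
  proof eventually_elim
    case (elim \<omega>)
    then obtain i where "\<not> 1 \<le> N t \<omega> - N (s i) \<omega>" by auto
    then show ?case using N_mono[of \<omega> "s i" t] elim s[of i] by (intro exI[of _ "s i"]) auto
  qed
qed

text \<open>The definition of a Poisson process allows larger jumps on a null event.\<close>

lemma AE_simple_jumps:
  assumes t: "0 < t"
  shows "AE \<omega> in M. \<exists>m>(0::nat). \<forall>i<m. N (real (Suc i) * (t / m)) \<omega> \<le> N (real i * (t / m)) \<omega> + 1"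
proof -
  define B where "B = (\<lambda>m. {\<omega>\<in>space M. \<exists>i<m. 2 \<le> N (real (Suc i) * (t / m)) \<omega> - N (real i * (t / m)) \<omega>})"
  have [measurable]: "N (real i * (t / real m)) \<in> measurable M (count_space UNIV)" for i m
    using t by (intro N_measurable) auto
  have B [measurable]: "B m \<in> sets M" for m unfolding B_def by measurable
  have "uniformly_continuous_on {0..t} Lam"
    by (intro compact_uniformly_continuous continuous_on_cumulative_rate) (use t rate_integrable in auto)
  note uc = this[unfolded uniformly_continuous_on_def, rule_format]
  \<comment> \<open>Uniform continuity of \<open>Lam\<close> bounds every cell parameter by
    \<open>e\<close>. Two or more events in a cell have probability at most the square of its
    parameter, hence at most \<open>e\<close> times it, and the parameters add up to
    \<open>Lam t\<close>.\<close>
  have small: "\<exists>m>0. prob (B m) \<le> e * Lam t" if e: "e > 0" for e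
  proof -
    obtain d where d: "d > 0" "\<And>x y. x \<in> {0..t} \<Longrightarrow> y \<in> {0..t} \<Longrightarrow> dist y x < d \<Longrightarrow> dist (Lam y) (Lam x) < e"
      using uc[OF e] by metis
    obtain m :: nat where m: "real m > t / d" using reals_Archimedean2 by blast
    moreover have "t / d > 0" using t d by simp
    ultimately have m0: "0 < m" by (intro Nat.gr0I) auto
    define h where "h = t / m"
    have h: "0 < h" "h < d" "real m * h = t" using m m0 t d by (auto simp: h_def field_simps)
    let ?r = "\<lambda>i. Lam (real (Suc i) * h) - Lam (real i * h)"
    have r: "0 < ?r i" "i < m \<Longrightarrow> ?r i \<le> e" for i
    proof -
      show "0 < ?r i" using Lam_strict_mono[of "real i * h" "real (Suc i) * h"] h by (simp add: algebra_simps)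
      assume "i < m"
      then have "real (Suc i) * h \<le> real m * h" using h by (intro mult_right_mono) auto
      then have "dist (Lam (real (Suc i) * h)) (Lam (real i * h)) < e"
        using h by (intro d(2)) (auto simp: dist_real_def algebra_simps)
      then show "?r i \<le> e" by (simp add: dist_real_def)
    qed
    have [measurable]: "N (real i * h) \<in> measurable M (count_space UNIV)" for i
      using h by (intro N_measurable) auto
    have hm: "{\<omega>\<in>space M. N (real (Suc i) * h) \<omega> - N (real i * h) \<omega> \<in> {2..}} \<in> sets M" for i
      by measurable
    have "B m = (\<Union>i\<in>{..<m}. {\<omega>\<in>space M. N (real (Suc i) * h) \<omega> - N (real i * h) \<omega> \<in> {2..}})"
      by (auto simp: B_def h_def)
    also have "prob \<dots> \<le> (\<Sum>i<m. prob {\<omega>\<in>space M. N (real (Suc i) * h) \<omega> - N (real i * h) \<omega> \<in> {2..}})"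
      using hm by (intro finite_measure_subadditive_finite) auto
    also have "\<dots> = (\<Sum>i<m. measure (poisson_pmf (?r i)) {2..})"
      using h by (intro sum.cong refl prob_increment) (auto simp: algebra_simps)
    also have "\<dots> \<le> (\<Sum>i<m. e * ?r i)"
    proof (rule sum_mono)
      fix i assume "i \<in> {..<m}"
      then have "?r i * ?r i \<le> e * ?r i" using r[of i] by (intro mult_right_mono) auto
      then show "measure (poisson_pmf (?r i)) {2..} \<le> e * ?r i"
        using poisson_pmf_ge_2[OF r(1)[of i]] by (simp add: power2_eq_square)
    qed
    also have "\<dots> = e * Lam t"
      using sum_lessThan_telescope[of "\<lambda>i. Lam (real i * h)" m] h
      by (simp add: sum_distrib_left[symmetric] cumulative_rate_0)
    finally show ?thesis using m0 by auto
  qed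
  let ?C = "\<Inter>m\<in>{0<..}. B m"
  have C: "?C \<in> sets M" by (rule sets.countable_INT') (auto intro: B)
  have "prob ?C \<le> 0"
  proof (rule field_le_epsilon)
    fix e :: real assume e: "0 < e"
    have "Lam t \<ge> 0" using t Lam_nonneg by simp
    obtain m where m: "0 < m" "prob (B m) \<le> (e / (Lam t + 1)) * Lam t"
      using small[of "e / (Lam t + 1)"] e \<open>Lam t \<ge> 0\<close> by auto
    have "prob ?C \<le> prob (B m)" using m by (intro finite_measure_mono) auto
    also note m(2)
    also have "(e / (Lam t + 1)) * Lam t \<le> e" using e \<open>Lam t \<ge> 0\<close> by (simp add: field_simps)
    finally show "prob ?C \<le> 0 + e" by simp
  qed
  then have "prob ?C = 0" using measure_nonneg[of M ?C] by linarith
  then have "?C \<in> null_sets M" using C by (intro null_setsI) (auto simp: emeasure_eq_measure)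
  then have "AE \<omega> in M. \<omega> \<notin> ?C" by (rule AE_not_in)
  then show ?thesis using AE_space
  proof eventually_elim
    case (elim \<omega>)
    then obtain m where "m > 0" "\<omega> \<notin> B m" by auto
    then show ?case using elim by (intro exI[of _ m]) (auto simp: B_def not_le Suc_le_eq)
  qed
qed

end

section \<open>Waiting times and absolute continuity\<close>

text \<open>The preimage lies in the image of \<open>B\<close> under an affine left inverse, and a
  differentiable map of a space into itself preserves negligible sets. Measurability of the preimage
  then turns negligible into null for \<open>lborel\<close>, which is not complete.\<close>

lemma null_sets_affine_vimage:
  fixes f :: "'a::euclidean_space \<Rightarrow> 'a"
  assumes f: "linear f" "inj f" and B: "B \<in> null_sets lborel"
  shows "{p. c + f p \<in> B} \<in> null_sets lborel"
proof -
  obtain g where g: "linear g" "g \<circ> f = id"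
    using linear_injective_left_inverse[OF f] by auto
  have "negligible B"
    using B by (simp add: negligible_iff_null_sets null_sets_completionI)
  then have "negligible ((\<lambda>x. g x - g c) ` B)"
    by (rule negligible_differentiable_image_negligible[OF order_refl])
       (rule differentiable_on_diff[OF linear_imp_differentiable_on[OF g(1)] differentiable_on_const])
  moreover have "{p. c + f p \<in> B} \<subseteq> (\<lambda>x. g x - g c) ` B"
  proof
    fix p assume "p \<in> {p. c + f p \<in> B}"
    moreover have "g (c + f p) - g c = p"
      using g(2) by (simp add: linear_add[OF g(1)] fun_eq_iff)
    ultimately show "p \<in> (\<lambda>x. g x - g c) ` B" by force
  qed
  ultimately have "negligible {p. c + f p \<in> B}"
    by (rule negligible_subset)
  moreover have "{p. c + f p \<in> B} \<in> sets lborel"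
  proof -
    have [measurable]: "f \<in> borel_measurable borel"
      by (intro borel_measurable_continuous_onI linear_continuous_on linear_conv_bounded_linear[THEN iffD1] f)
    have [measurable]: "B \<in> sets borel" using B by auto
    show ?thesis by measurable
  qed
  ultimately show ?thesis
    by (simp add: negligible_iff_null_sets null_sets_completion_iff)
qed

context poisson_counting
begin

abbreviation wait :: "real \<Rightarrow> real \<Rightarrow> 'a \<Rightarrow> real" where
  "wait h s \<omega> \<equiv> waiting_time (\<lambda>u. N u \<omega>) s h"

text \<open>\<open>F\<close> is kept general so that a waiting time is also measurable for the
  sigma-algebra generated by the increment events of its own cell; this is where independence comes
  from. Thresholds outside \<open>(0, h)\<close> are trivial because waiting times lie in
  \<open>(0, h]\<close>.\<close>

lemma wait_measurable_gen:
  assumes sp: "space F = space M" and s: "0 \<le> s" "0 < h"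
    and F: "\<And>x. 0 < x \<Longrightarrow> x < h \<Longrightarrow> {\<omega>\<in>space M. 1 \<le> N (s + x) \<omega> - N s \<omega>} \<in> sets F"
  shows "wait h s \<in> borel_measurable F"
  unfolding borel_measurable_iff_le
proof
  fix a
  note b = waiting_time_bounds[OF counting_path_N s]
  consider "a \<le> 0" | "0 < a" "a < h" | "h \<le> a" by linarith
  then show "{\<omega> \<in> space F. wait h s \<omega> \<le> a} \<in> sets F"
  proof cases
    case 1
    then have "{\<omega> \<in> space F. wait h s \<omega> \<le> a} = {}"
      using b(1) by (force simp: sp)
    then show ?thesis by (simp only: sets.empty_sets)
  next
    case 2
    then have "{\<omega> \<in> space F. wait h s \<omega> \<le> a} = {\<omega>\<in>space M. 1 \<le> N (s + a) \<omega> - N s \<omega>}"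
      using b(3)[of _ a] by (auto simp: sp Suc_le_eq)
    then show ?thesis using F[OF 2] by simp
  next
    case 3
    then have "{\<omega> \<in> space F. wait h s \<omega> \<le> a} = space F"
      using b(2) by (force simp: sp)
    then show ?thesis by (simp only: sets.top)
  qed
qed

lemma wait_measurable [measurable]:
  assumes "0 \<le> s" "0 < h"
  shows "wait h s \<in> borel_measurable M"
proof (rule wait_measurable_gen[OF refl assms])
  fix x :: real assume "0 < x"
  then have [measurable]: "N s \<in> measurable M (count_space UNIV)" "N (s + x) \<in> measurable M (count_space UNIV)"
    using assms by auto
  show "{\<omega>\<in>space M. 1 \<le> N (s + x) \<omega> - N s \<omega>} \<in> sets M" by measurable
qed

text \<open>The events that cell \<open>i\<close> has a jump by time \<open>x\<close> after its
  start determine the waiting time and are closed under intersection. So it suffices to multiply the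
  probabilities of such events, which concern increments over disjoint intervals.\<close>

lemma indep_vars_wait:
  assumes h: "0 < h"
  shows "indep_vars (\<lambda>_. borel) (\<lambda>i. wait h (real i * h)) UNIV"
proof -
  let ?E = "\<lambda>i x. {\<omega>\<in>space M. 1 \<le> N (real i * h + x) \<omega> - N (real i * h) \<omega>}"
  define G where "G = (\<lambda>i. ?E i ` {0<..<h})"
  have G: "G i \<subseteq> events" for i
  proof -
    have "?E i x \<in> events" if "x \<in> {0<..<h}" for x
    proof -
      have [measurable]: "N (real i * h) \<in> measurable M (count_space UNIV)"
        "N (real i * h + x) \<in> measurable M (count_space UNIV)" using h that by auto
      show ?thesis by measurable
    qed
    then show ?thesis by (auto simp: G_def)
  qed
  have "indep_sets G UNIV"
  proof (rule indep_setsI)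
    fix A J assume J: "J \<noteq> {}" "J \<subseteq> UNIV" "finite J" and A: "\<forall>j\<in>J. A j \<in> G j"
    \<comment> \<open>Cells outside \<open>J\<close> also get an inner point, since
      \<open>prob_increments\<close> requires one strictly increasing sequence through all
      cells.\<close>
    have "\<exists>x. 0 < x \<and> x < h \<and> (j \<in> J \<longrightarrow> A j = ?E j x)" for j
    proof (cases "j \<in> J")
      case True
      then have "A j \<in> G j" using A by blast
      then show ?thesis unfolding G_def by (elim imageE) auto
    next
      case False
      then show ?thesis using h by (intro exI[of _ "h / 2"]) auto
    qed
    then obtain x where x: "\<And>j. 0 < x j" "\<And>j. x j < h" "\<And>j. j \<in> J \<Longrightarrow> A j = ?E j (x j)"
      by metis
    \<comment> \<open>Even indices are mesh points, odd indices the points \<open>x i\<close> beyond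
      them. The increments starting at even indices are the prescribed ones; the others fill the
      gaps and stay free.\<close>
    define s where "s = (\<lambda>k. real (k div 2) * h + (if odd k then x (k div 2) else 0))"
    have s: "s (2 * i) = real i * h" "s (Suc (2 * i)) = real i * h + x i" for i
      by (auto simp: s_def)
    have "s k < s (Suc k)" for k
    proof (cases "even k")
      case True
      then show ?thesis using x(1) by (auto simp: s_def elim!: evenE)
    next
      case False
      then show ?thesis using x(2)[of "k div 2"] by (auto simp: s_def algebra_simps elim!: oddE)
    qed
    then have "strict_mono s" by (simp add: strict_mono_Suc_iff)
    moreover have "0 \<le> s 0" by (simp add: s_def)
    ultimately have "prob {\<omega>\<in>space M. \<forall>i\<in>(*) 2 ` J. N (s (Suc i)) \<omega> - N (s i) \<omega> \<in> {1..}}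
      = (\<Prod>i\<in>(*) 2 ` J. measure (poisson_pmf (Lam (s (Suc i)) - Lam (s i))) {1..})"
      using J by (intro prob_increments) auto
    also have "{\<omega>\<in>space M. \<forall>i\<in>(*) 2 ` J. N (s (Suc i)) \<omega> - N (s i) \<omega> \<in> {1..}} = (\<Inter>j\<in>J. A j)"
      using J x(3) by (auto simp: s)
    also have "(\<Prod>i\<in>(*) 2 ` J. measure (poisson_pmf (Lam (s (Suc i)) - Lam (s i))) {1..})
        = (\<Prod>j\<in>J. measure (poisson_pmf (Lam (real j * h + x j) - Lam (real j * h))) {1..})"
      by (subst prod.reindex) (auto simp: s inj_on_def)
    also have "\<dots> = (\<Prod>j\<in>J. prob (A j))"
      using prob_increment[of "real _ * h" "real _ * h + x _" "{1..}"] h x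
      by (intro prod.cong refl) auto
    finally show "prob (\<Inter>j\<in>J. A j) = (\<Prod>j\<in>J. prob (A j))" .
  qed (use G in auto)
  moreover have "Int_stable (G i)" for i
  proof (rule Int_stableI)
    fix A B assume "A \<in> G i" "B \<in> G i"
    then obtain x y where xy: "x \<in> {0<..<h}" "y \<in> {0<..<h}" "A = ?E i x" "B = ?E i y"
      by (auto simp: G_def)
    \<comment> \<open>Counts are monotone, so a jump by the earlier time is also one by the later
      time.\<close>
    have eq: "?E i x \<inter> ?E i y = ?E i (min x y)"
    proof -
      have "N (real i * h + min x y) \<omega> \<le> N (real i * h + x) \<omega>"
        "N (real i * h + min x y) \<omega> \<le> N (real i * h + y) \<omega>" if "\<omega> \<in> space M" for \<omega>
        using that h xy by (auto intro!: N_mono)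
      then show ?thesis by (auto simp: min_def) (meson diff_le_mono le_trans)+
    qed
    show "A \<inter> B \<in> G i"
      unfolding G_def xy(3,4) eq by (rule imageI) (use xy in auto)
  qed
  ultimately have ind: "indep_sets (\<lambda>i. sigma_sets (space M) (G i)) UNIV"
    by (rule indep_sets_sigma)
  have wm: "wait h (real i * h) \<in> borel_measurable (sigma (space M) (G i))" for i
  proof (rule wait_measurable_gen)
    fix x assume "0 < x" "x < h"
    then show "?E i x \<in> sets (sigma (space M) (G i))"
      using G[of i] sets.sets_into_space by (subst sets_measure_of) (auto simp: G_def)
  qed (use h in \<open>auto simp: space_measure_of_conv\<close>)
  then have sub: "{wait h (real i * h) -` A \<inter> space M | A. A \<in> sets borel} \<subseteq> sigma_sets (space M) (G i)" for i
  proof clarify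
    fix A :: "real set" assume "A \<in> sets borel"
    from measurable_sets[OF wm this, of i] show "wait h (real i * h) -` A \<inter> space M \<in> sigma_sets (space M) (G i)"
      using G[of i] sets.space_closed[of M] by (auto simp: space_measure_of_conv sets_measure_of)
  qed
  show ?thesis
    unfolding indep_vars_def2 using h by (auto intro!: indep_sets_mono_sets[OF ind] sub[THEN subsetD])
qed

lemma prob_wait_le:
  assumes "0 \<le> s" "0 < x" "x < h"
  shows "prob {\<omega>\<in>space M. wait h s \<omega> \<le> x} = 1 - exp (- (Lam (s + x) - Lam s))"
proof -
  have "{\<omega>\<in>space M. wait h s \<omega> \<le> x} = {\<omega>\<in>space M. N (s + x) \<omega> - N s \<omega> \<in> {1..}}"
    using waiting_time_bounds(3)[OF counting_path_N, of _ s h x] assms by (auto simp: Suc_le_eq)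
  also have "prob \<dots> = measure (poisson_pmf (Lam (s + x) - Lam s)) (UNIV - {0})"
    using assms by (subst prob_increment) (auto intro!: arg_cong2[where f=measure])
  also have "\<dots> = 1 - measure (poisson_pmf (Lam (s + x) - Lam s)) {0}"
    using measure_pmf.prob_compl[of "{0}"] by simp
  also have "\<dots> = 1 - exp (- (Lam (s + x) - Lam s))"
    using Lam_strict_mono[of s "s + x"] assms by (simp add: measure_pmf_single)
  finally show ?thesis .
qed

text \<open>The integrand is the derivative of the distribution function in
  \<open>prob_wait_le\<close>. For \<open>s = 0\<close> it may blow up at the left end, so the
  fundamental theorem is used in its form for nonnegative integrands on an open interval with limits
  at the ends.\<close>

lemma nn_integral_wait_density:
  assumes s: "0 \<le> s" and y: "0 < y"
  shows "(\<integral>\<^sup>+x. ennreal (lam (s + x) * exp (- (Lam (s + x) - Lam s))) * indicator {0<..<y} x \<partial>lborel)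
    = ennreal (1 - exp (- (Lam (s + y) - Lam s)))"
proof -
  let ?g = "\<lambda>x. lam (s + x) * exp (- (Lam (s + x) - Lam s))"
  let ?F = "\<lambda>x. 1 - exp (- (Lam (s + x) - Lam s))"
  have D: "(?F has_real_derivative ?g x) (at x)" if "0 < x" for x
  proof -
    have "((\<lambda>x. Lam (s + x)) has_real_derivative lam (s + x) * 1) (at x)"
      by (rule DERIV_chain2[OF DERIV_cumulative_rate[OF rate_integrable rate_continuous]])
         (use s that in \<open>auto intro!: derivative_eq_intros\<close>)
    then show ?thesis by (auto intro!: derivative_eq_intros)
  qed
  have c: "isCont ?g x" if "0 < x" for x
  proof -
    have "isCont lam (s + x)"
      using rate_continuous that s by (auto simp: continuous_on_eq_continuous_at)
    then have 1: "isCont (\<lambda>x. lam (s + x)) x" by (intro isCont_o2[where f="\<lambda>x. s + x" and g=lam]) auto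
    have "isCont Lam (s + x)"
      by (rule DERIV_isCont[OF DERIV_cumulative_rate[OF rate_integrable rate_continuous]]) (use that s in auto)
    then have "isCont (\<lambda>x. Lam (s + x)) x" by (intro isCont_o2[where f="\<lambda>x. s + x" and g=Lam]) auto
    with 1 show ?thesis by (intro continuous_intros)
  qed
  have pos: "0 \<le> ?g x" if "0 < x" for x using rate_pos[of "s + x"] that s by simp
  have L: "((\<lambda>x. Lam (s + x)) \<longlongrightarrow> Lam (s + 0)) (at_right 0)"
    using Lam_tendsto(2)[of s "s + 1"] s by (simp add: filterlim_at_right_to_0[of _ _ s] add.commute)
  have A: "((?F \<circ> real_of_ereal) \<longlongrightarrow> 0) (at_right (ereal 0))"
    unfolding ereal_tendsto_simps
    by (rule tendsto_eq_intros refl L)+ simp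
  have B: "((?F \<circ> real_of_ereal) \<longlongrightarrow> ?F y) (at_left (ereal y))"
    unfolding ereal_tendsto_simps
    using DERIV_isCont[OF D[OF y]] by (simp add: isCont_def filterlim_at_split)
  have I: "set_integrable lborel (einterval (ereal 0) (ereal y)) ?g"
    "(LBINT x=ereal 0..ereal y. ?g x) = ?F y - 0"
    by (rule interval_integral_FTC_nonneg[OF _ D c _ A B]; use y pos in auto)+
  then have I': "set_integrable lborel {0<..<y} ?g" "(LINT x:{0<..<y}|lborel. ?g x) = ?F y"
    using y by (auto simp: interval_lebesgue_integral_def einterval_eq)
  have "(\<integral>\<^sup>+x. ennreal (?g x) * indicator {0<..<y} x \<partial>lborel)
      = (\<integral>\<^sup>+x. ennreal (indicator {0<..<y} x *\<^sub>R ?g x) \<partial>lborel)"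
    by (intro nn_integral_cong) (auto simp: indicator_def)
  also have "\<dots> = ennreal (?F y)"
    using I' pos unfolding set_integrable_def set_lebesgue_integral_def
    by (subst nn_integral_eq_integral) (auto simp: indicator_def)
  finally show ?thesis .
qed

text \<open>Truncation places the mass of having no jump before the end of the cell at the point
  \<open>h\<close>; strictly below \<open>h\<close> the law has the density of
  \<open>nn_integral_wait_density\<close>.\<close>

lemma AE_distr_wait:
  assumes s: "0 \<le> s" "0 < h" and P: "AE x in lborel. P x"
  shows "AE x in distr M borel (wait h s). x < h \<longrightarrow> P x"
proof -
  define D where "D = distr M borel (wait h s)"
  interpret D: prob_space D unfolding D_def using s by (intro prob_space_distr) measurable
  have [measurable_cong, simp]: "sets D = sets borel" "space D = UNIV" by (auto simp: D_def)
  let ?g = "\<lambda>x. lam (s + x) * exp (- (Lam (s + x) - Lam s))"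
  obtain Z where Z: "{x. \<not> P x} \<subseteq> Z" "Z \<in> null_sets lborel"
    using P by (elim AE_E) (auto simp: null_sets_def)
  \<comment> \<open>For \<open>y < h\<close> the part of the law on \<open>{..y}\<close> and the
    measure with the density on \<open>(0, y)\<close> have the same distribution function, hence
    agree, and the latter vanishes on \<open>Z\<close>.\<close>
  have null: "emeasure D (Z \<inter> {..y}) = 0" if y: "0 < y" "y < h" for y
  proof -
    define \<mu> where "\<mu> = density D (indicator {..y})"
    define \<nu> where "\<nu> = density lborel (\<lambda>x. ennreal (?g x) * indicator {0<..<y} x)"
    have g: "(\<lambda>x. ennreal (?g x) * indicator {0<..<z} x) \<in> borel_measurable borel" for z
    proof -
      have "continuous_on {0<..<z} ?g"
      proof (intro continuous_intros)
        show "continuous_on {0<..<z} (\<lambda>x. lam (s + x))"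
          by (rule continuous_on_compose2[OF rate_continuous]) (use s in \<open>auto intro!: continuous_intros\<close>)
        show "continuous_on {0<..<z} (\<lambda>x. Lam (s + x))"
          by (rule continuous_on_compose2[OF continuous_on_cumulative_rate[of lam "s + \<bar>z\<bar> + 1"]])
             (use s rate_integrable in \<open>auto intro!: continuous_intros\<close>)
      qed
      then have "(\<lambda>x. indicator {0<..<z} x *\<^sub>R ?g x) \<in> borel_measurable borel"
        by (intro borel_measurable_continuous_on_indicator) auto
      then have "(\<lambda>x. ennreal (indicator {0<..<z} x *\<^sub>R ?g x)) \<in> borel_measurable borel"
        by measurable
      also have "(\<lambda>x. ennreal (indicator {0<..<z} x *\<^sub>R ?g x)) = (\<lambda>x. ennreal (?g x) * indicator {0<..<z} x)"
        by (auto simp: indicator_def)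
      finally show ?thesis .
    qed
    have e\<mu>: "emeasure \<mu> {..x} = ennreal (if 0 < x then 1 - exp (- (Lam (s + min x y) - Lam s)) else 0)" for x
    proof -
      have "emeasure \<mu> {..x} = emeasure D {..min x y}"
        unfolding \<mu>_def by (subst emeasure_density) (auto simp: indicator_inter_arith[symmetric]
            intro!: arg_cong[where f="emeasure D"])
      also have "\<dots> = ennreal (prob {\<omega>\<in>space M. wait h s \<omega> \<le> min x y})"
        unfolding D_def using s by (subst emeasure_distr)
          (auto simp: emeasure_eq_measure vimage_def Int_def conj_commute)
      also have "prob {\<omega>\<in>space M. wait h s \<omega> \<le> min x y}
          = (if 0 < x then 1 - exp (- (Lam (s + min x y) - Lam s)) else 0)"
      proof (cases "0 < x")
        case True
        then show ?thesis using y s by (subst prob_wait_le) auto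
      next
        case False
        then have "{\<omega>\<in>space M. wait h s \<omega> \<le> min x y} = {}"
          using waiting_time_bounds(1)[OF counting_path_N s] by force
        then have "prob {\<omega>\<in>space M. wait h s \<omega> \<le> min x y} = 0" by (simp only: measure_empty)
        then show ?thesis using False by (simp only: if_False)
      qed
      finally show ?thesis .
    qed
    have e\<nu>: "emeasure \<nu> {..x} = ennreal (if 0 < x then 1 - exp (- (Lam (s + min x y) - Lam s)) else 0)" for x
    proof -
      have "emeasure \<nu> {..x} = (\<integral>\<^sup>+u. ennreal (?g u) * indicator {0<..<y} u * indicator {..x} u \<partial>lborel)"
        unfolding \<nu>_def by (subst emeasure_density) (use g in auto)
      also have "\<dots> = (\<integral>\<^sup>+u. ennreal (?g u) * indicator {0<..<min x y} u \<partial>lborel)"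
        using AE_lborel_singleton[of x]
        by (intro nn_integral_cong_AE, eventually_elim) (auto simp: indicator_def)
      also have "\<dots> = ennreal (if 0 < x then 1 - exp (- (Lam (s + min x y) - Lam s)) else 0)"
        using nn_integral_wait_density[OF s(1), of "min x y"] y by (cases "0 < x") auto
      finally show ?thesis .
    qed
    have t: "emeasure \<nu> UNIV < \<infinity>"
    proof -
      have "emeasure \<nu> UNIV = (\<integral>\<^sup>+u. ennreal (?g u) * indicator {0<..<y} u \<partial>lborel)"
        unfolding \<nu>_def by (subst emeasure_density) (use g in auto)
      then show ?thesis using nn_integral_wait_density[OF s(1) y(1)] by simp
    qed
    have "\<mu> = \<nu>"
    proof (rule cdf_unique')
      have "emeasure \<mu> UNIV = emeasure D {..y}"
        unfolding \<mu>_def by (subst emeasure_density) auto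
      then have "finite_measure \<mu>" by (intro finite_measureI) (simp add: \<mu>_def)
      then show "finite_borel_measure \<mu>"
        by (intro finite_borel_measure.intro finite_borel_measure_axioms.intro) (simp_all add: \<mu>_def)
      have "finite_measure \<nu>" using t by (intro finite_measureI) (simp add: \<nu>_def)
      then show "finite_borel_measure \<nu>"
        by (intro finite_borel_measure.intro finite_borel_measure_axioms.intro) (simp_all add: \<nu>_def)
      show "cdf \<mu> = cdf \<nu>"
        by (rule ext) (simp only: cdf_def measure_def e\<mu> e\<nu>)
    qed
    have "emeasure D (Z \<inter> {..y}) = emeasure \<mu> Z"
      unfolding \<mu>_def using Z(2)
      by (subst emeasure_density) (auto simp: indicator_inter_arith[symmetric] Int_commute)
    also have "\<dots> = 0"
    proof -
      have "absolutely_continuous lborel \<nu>"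
        unfolding \<nu>_def by (rule absolutely_continuousI_density) (use g in auto)
      then show ?thesis using Z(2) \<open>\<mu> = \<nu>\<close> by (auto simp: absolutely_continuous_def null_sets_def)
    qed
    finally show ?thesis .
  qed
  \<comment> \<open>The levels \<open>h - h / (k + 2)\<close> increase to \<open>h\<close>, so
    countably many null sets cover all \<open>x < h\<close>; the offset 2 makes the first level
    positive.\<close>
  have "AE x in D. \<not> (x \<in> Z \<and> x \<le> h - h / (real k + 2))" for k
  proof (rule AE_I')
    have "0 < h - h / (real k + 2)" "h - h / (real k + 2) < h" using s by (auto simp: field_simps intro: add_pos_nonneg)
    from null[OF this] show "Z \<inter> {..h - h / (real k + 2)} \<in> null_sets D"
      using Z(2) by (intro null_setsI) auto
  qed auto
  then have "AE x in D. \<forall>k. \<not> (x \<in> Z \<and> x \<le> h - h / (real k + 2))"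
    unfolding AE_all_countable by (rule allI)
  then have "AE x in D. x < h \<longrightarrow> P x"
  proof eventually_elim
    case (elim x)
    show ?case
    proof
      assume x: "x < h"
      obtain k :: nat where "h / (h - x) < real k" using reals_Archimedean2 by blast
      then have "h < real k * (h - x)" using x by (simp add: pos_divide_less_eq)
      also have "\<dots> \<le> (real k + 2) * (h - x)" using x by (intro mult_right_mono) auto
      finally have "x \<le> h - h / (real k + 2)" by (simp add: field_simps)
      then show "P x" using elim Z(1) by auto
    qed
  qed
  then show ?thesis unfolding D_def .
qed

text \<open>Fubini: with all other waiting times fixed, the sum is an injective affine function of the waiting
  times \<open>a\<close> and \<open>b\<close>, whose laws have a density below \<open>h\<close>.\<close>

lemma AE_affine_wait_notin_null:
  fixes w :: "nat \<Rightarrow> real \<times> real"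
  assumes h: "0 < h" and ab: "a < m" "b < m" "a \<noteq> b" and B: "B \<in> null_sets lborel"
    and det: "fst (w a) * snd (w b) \<noteq> snd (w a) * fst (w b)"
  shows "AE \<omega> in M. wait h (real a * h) \<omega> < h \<longrightarrow> wait h (real b * h) \<omega> < h \<longrightarrow>
    c + (\<Sum>i<m. wait h (real i * h) \<omega> *\<^sub>R w i) \<notin> B"
proof -
  let ?\<tau> = "\<lambda>i. wait h (real i * h)"
  define D where "D = (\<lambda>i. distr M borel (?\<tau> i))"
  define J where "J = {..<m} - {a, b}"
  have I: "{..<m} = insert a (insert b J)" and J: "finite J" "a \<notin> insert b J" "b \<notin> J"
    using ab by (auto simp: J_def)
  have [measurable]: "?\<tau> i \<in> borel_measurable M" for i using h by simp
  have Dp: "prob_space (D i)" for i unfolding D_def by (intro prob_space_distr) measurable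
  interpret D: product_prob_space D by (intro product_prob_spaceI Dp)
  have [measurable_cong, simp]: "sets (D i) = sets borel" "space (D i) = UNIV" for i by (auto simp: D_def)
  have [measurable]: "B \<in> sets borel" using B by auto
  define G where "G = (\<lambda>x. x a < h \<and> x b < h \<and> c + (\<Sum>i<m. x i *\<^sub>R w i) \<in> B)"
  have Gm [measurable]: "Measurable.pred (Pi\<^sub>M {..<m} D) G"
  proof -
    have [measurable]: "(\<lambda>x. x i) \<in> borel_measurable (Pi\<^sub>M {..<m} D)" if "i < m" for i
      using measurable_component_singleton[of i "{..<m}" D] that by (simp cong: measurable_cong_sets)
    have "(\<lambda>x. c + (\<Sum>i<m. x i *\<^sub>R w i)) \<in> borel_measurable (Pi\<^sub>M {..<m} D)"
      by (intro borel_measurable_add borel_measurable_sum borel_measurable_scaleR) auto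
    note [measurable] = this
    show ?thesis unfolding G_def using ab by measurable
  qed
  have eq: "distr M (\<Pi>\<^sub>M i\<in>{..<m}. borel) (\<lambda>\<omega>. \<lambda>i\<in>{..<m}. ?\<tau> i \<omega>) = Pi\<^sub>M {..<m} D"
    unfolding D_def using ab
    by (intro indep_vars_iff_distr_eq_PiM[THEN iffD1] indep_vars_subset[OF indep_vars_wait[OF h]]) auto
  have inner: "(\<integral>\<^sup>+z. \<integral>\<^sup>+y. indicator (Collect G) ((x(b := z))(a := y)) \<partial>D a \<partial>D b) = 0" for x
  proof -
    define f where "f = (\<lambda>p::real \<times> real. fst p *\<^sub>R w b + snd p *\<^sub>R w a)"
    define r where "r = c + (\<Sum>i\<in>J. x i *\<^sub>R w i)"
    have sum: "c + (\<Sum>i<m. ((x(b := z))(a := y)) i *\<^sub>R w i) = r + f (z, y)" for y z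
    proof -
      have "(\<Sum>i\<in>J. ((x(b := z))(a := y)) i *\<^sub>R w i) = (\<Sum>i\<in>J. x i *\<^sub>R w i)"
        using J by (intro sum.cong) auto
      then show ?thesis unfolding I r_def f_def using J ab by (simp add: algebra_simps)
    qed
    have Gxy: "G ((x(b := z))(a := y)) \<longleftrightarrow> y < h \<and> z < h \<and> r + f (z, y) \<in> B" for y z
      unfolding G_def sum using ab by simp
    have lin: "linear f" by (rule linearI) (auto simp: f_def algebra_simps)
    moreover have "inj f"
    proof (subst linear_injective_0[OF lin], intro allI impI)
      fix p assume "f p = 0"
      then have e: "fst p * fst (w b) + snd p * fst (w a) = 0" "fst p * snd (w b) + snd p * snd (w a) = 0"
        by (auto simp: f_def prod_eq_iff)
      \<comment> \<open>Cramer's rule for the kernel of \<open>f\<close>.\<close>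
      have "fst p * (fst (w a) * snd (w b) - snd (w a) * fst (w b)) = 0"
        "snd p * (fst (w a) * snd (w b) - snd (w a) * fst (w b)) = 0" using e by algebra+
      then show "p = 0" using det by (auto simp: prod_eq_iff)
    qed
    ultimately have "{p. r + f p \<in> B} \<in> null_sets lborel"
      using B by (rule null_sets_affine_vimage)
    then have "AE p in lborel. r + f p \<notin> B" by (auto dest: AE_not_in)
    then have "AE p in (lborel :: real measure) \<Otimes>\<^sub>M lborel. r + f p \<notin> B" unfolding lborel_prod .
    then have "AE z in lborel. AE y in lborel. r + f (z, y) \<notin> B"
      by (rule lborel_pair.AE_pair)
    \<comment> \<open>Lebesgue measure on the plane is first split into its two variables; then each
      variable separately is transferred from Lebesgue measure to the law of a waiting time below
      \<open>h\<close>.\<close>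
    then have "AE z in D b. z < h \<longrightarrow> (AE y in lborel. r + f (z, y) \<notin> B)"
      unfolding D_def by (rule AE_distr_wait[rotated 2]) (use h in auto)
    then have "AE z in D b. (\<integral>\<^sup>+y. indicator (Collect G) ((x(b := z))(a := y)) \<partial>D a) = 0"
    proof eventually_elim
      case (elim z)
      have "AE y in D a. indicator (Collect G) ((x(b := z))(a := y)) = (0 :: ennreal)"
      proof (cases "z < h")
        case True
        then have "AE y in D a. y < h \<longrightarrow> r + f (z, y) \<notin> B"
          using elim h unfolding D_def by (intro AE_distr_wait) auto
        then show ?thesis by eventually_elim (simp add: Gxy)
      next
        case False
        then show ?thesis by (simp add: Gxy)
      qed
      then have "(\<integral>\<^sup>+y. indicator (Collect G) ((x(b := z))(a := y)) \<partial>D a) = (\<integral>\<^sup>+y. 0 \<partial>D a)"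
        by (rule nn_integral_cong_AE)
      then show ?case by simp
    qed
    then have "(\<integral>\<^sup>+z. \<integral>\<^sup>+y. indicator (Collect G) ((x(b := z))(a := y)) \<partial>D a \<partial>D b) = (\<integral>\<^sup>+z. 0 \<partial>D b)"
      by (rule nn_integral_cong_AE)
    then show ?thesis by simp
  qed
  have Im: "indicator (Collect G) \<in> borel_measurable (Pi\<^sub>M (insert a (insert b J)) D)"
    using Gm unfolding I by (intro borel_measurable_indicator') (simp add: pred_def)
  have "(\<integral>\<^sup>+x. indicator (Collect G) x \<partial>Pi\<^sub>M {..<m} D)
      = (\<integral>\<^sup>+x. (\<integral>\<^sup>+y. indicator (Collect G) (x(a := y)) \<partial>D a) \<partial>Pi\<^sub>M (insert b J) D)"
    unfolding I using J Im by (intro D.product_nn_integral_insert) auto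
  also have "\<dots> = (\<integral>\<^sup>+x. (\<integral>\<^sup>+z. (\<integral>\<^sup>+y. indicator (Collect G) ((x(b := z))(a := y)) \<partial>D a) \<partial>D b) \<partial>Pi\<^sub>M J D)"
  proof (rule D.product_nn_integral_insert[OF J(1,3)])
    have "(\<lambda>(x, y). indicator (Collect G) (x(a := y)) :: ennreal) \<in> borel_measurable (Pi\<^sub>M (insert b J) D \<Otimes>\<^sub>M D a)"
      using measurable_compose[OF measurable_add_dim Im] by (simp add: case_prod_beta')
    then show "(\<lambda>x. \<integral>\<^sup>+y. indicator (Collect G) (x(a := y)) \<partial>D a) \<in> borel_measurable (Pi\<^sub>M (insert b J) D)"
      by (rule sigma_finite_measure.borel_measurable_nn_integral[OF prob_space_imp_sigma_finite[OF Dp]])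
  qed
  also have "\<dots> = 0" by (simp add: inner)
  finally have "AE x in Pi\<^sub>M {..<m} D. \<not> G x"
    using Gm by (subst (asm) nn_integral_0_iff_AE) (auto simp: I Im indicator_def split: if_splits)
  then have "AE \<omega> in M. \<not> G (\<lambda>i\<in>{..<m}. ?\<tau> i \<omega>)"
    unfolding eq[symmetric] using Gm
    by (subst (asm) AE_distr_iff) (auto simp: pred_def eq[symmetric])
  then show ?thesis
    by eventually_elim (use ab in \<open>auto simp: G_def\<close>)
qed

text \<open>Almost surely no jump falls on the right end of the cell, which is a fixed time. So the
  final count is reached at some \<open>u < s + h\<close>, and the waiting time is at most
  \<open>u - s\<close>.\<close>

lemma AE_wait_less:
  assumes "0 \<le> s" "0 < h"
  shows "AE \<omega> in M. N s \<omega> < N (s + h) \<omega> \<longrightarrow> wait h s \<omega> < h"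
proof -
  have "AE \<omega> in M. \<exists>u. 0 \<le> u \<and> u < s + h \<and> N u \<omega> = N (s + h) \<omega>"
    by (rule AE_no_jump_at) (use assms in auto)
  then show ?thesis using AE_space
  proof eventually_elim
    case (elim \<omega>)
    show ?case
    proof
      assume less: "N s \<omega> < N (s + h) \<omega>"
      obtain u where u: "0 \<le> u" "u < s + h" "N u \<omega> = N (s + h) \<omega>" using elim by auto
      have "s \<le> u" using N_mono[OF elim(2) u(1), of s] u less by (cases "s \<le> u") auto
      then show "wait h s \<omega> < h"
        using waiting_time_bounds(3)[OF counting_path_N[OF elim(2)] assms, of "u - s"] u less by auto
    qed
  qed
qed

end

text \<open>Discrete intermediate value theorem: upward steps of at most one cannot skip the passage
  from \<open>i\<close> to \<open>i + 1\<close>.\<close>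

lemma unit_steps_hit:
  fixes f :: "nat \<Rightarrow> nat"
  assumes "\<And>l. l < m \<Longrightarrow> f (Suc l) \<le> f l + 1" "f 0 = 0" "i < f m"
  shows "\<exists>a<m. f a = i \<and> f (Suc a) = Suc i"
  using assms
proof (induction m)
  case (Suc m)
  show ?case
  proof (cases "i < f m")
    case True
    then have "\<exists>a<m. f a = i \<and> f (Suc a) = Suc i" using Suc by simp
    then show ?thesis using less_Suc_eq by blast
  next
    case False
    then have "f m = i \<and> f (Suc m) = Suc i" using Suc.prems(1)[of m] Suc.prems(3) by simp
    then show ?thesis by blast
  qed
qed simp

context poisson_counting
begin

text \<open>On a mesh with at most one jump per cell, the jump from \<open>i\<close> to
  \<open>i + 1\<close> and the one from \<open>j\<close> to \<open>j + 1\<close> occur in two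
  different cells, and \<open>det\<close> says that the coefficients of their waiting times are
  linearly independent. Which cells these are depends on the path, so the event is split by the
  counts \<open>p\<close> at the mesh points.\<close>

lemma AE_integral_notin_null:
  fixes v :: "nat \<Rightarrow> real \<times> real"
  assumes t: "0 < t" and ij: "i < n" "j < n" and B: "B \<in> null_sets lborel"
    and det: "fst (v i - v (Suc i)) * snd (v j - v (Suc j)) \<noteq> snd (v i - v (Suc i)) * fst (v j - v (Suc j))"
  shows "AE \<omega> in M. N t \<omega> = n \<longrightarrow> integral {0..t} (\<lambda>s. v (N s \<omega>)) \<notin> B"
proof -
  have main: "AE \<omega> in M. (\<forall>l\<in>{..m}. N (real l * (t / m)) \<omega> = p l) \<longrightarrow> N t \<omega> = n \<longrightarrow>
      integral {0..t} (\<lambda>s. v (N s \<omega>)) \<notin> B"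
    if m: "0 < m" and p: "\<And>l. l < m \<Longrightarrow> p (Suc l) \<le> p l + 1" for m and p :: "nat \<Rightarrow> nat"
  proof (cases "p 0 = 0 \<and> p m = n")
    case False
    have "AE \<omega> in M. \<not> (N t \<omega> = n \<and> (\<forall>l\<in>{..m}. N (real l * (t / m)) \<omega> = p l))"
      using AE_space
    proof eventually_elim
      case (elim \<omega>)
      show ?case
      proof safe
        assume *: "n = N t \<omega>" "\<forall>l\<in>{..m}. N (real l * (t / m)) \<omega> = p l"
        then have "p 0 = 0" "p m = N t \<omega>" using N_0[OF elim] m by force+
        then show False using False * by simp
      qed
    qed
    then show ?thesis by eventually_elim auto
  next
    case True
    define h where "h = t / m"
    have h: "0 < h" "real m * h = t" using m t by (auto simp: h_def)
    obtain a b where a: "a < m" "p a = i" "p (Suc a) = Suc i" and b: "b < m" "p b = j" "p (Suc b) = Suc j"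
      using unit_steps_hit[of m p i] unit_steps_hit[of m p j] p True ij by auto
    have "i \<noteq> j" using det by auto
    then have "a \<noteq> b" using a b by auto
    define c where "c = (\<Sum>l<m. h *\<^sub>R v (p (Suc l)))"
    have "AE \<omega> in M. wait h (real a * h) \<omega> < h \<longrightarrow> wait h (real b * h) \<omega> < h \<longrightarrow>
        c + (\<Sum>l<m. wait h (real l * h) \<omega> *\<^sub>R (v (p l) - v (p (Suc l)))) \<notin> B"
      by (rule AE_affine_wait_notin_null) (use h a b B det \<open>a \<noteq> b\<close> in auto)
    moreover have "AE \<omega> in M. N (real a * h) \<omega> < N (real a * h + h) \<omega> \<longrightarrow> wait h (real a * h) \<omega> < h"
      using h by (intro AE_wait_less) auto
    moreover have "AE \<omega> in M. N (real b * h) \<omega> < N (real b * h + h) \<omega> \<longrightarrow> wait h (real b * h) \<omega> < h"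
      using h by (intro AE_wait_less) auto
    ultimately show ?thesis using AE_space
    proof eventually_elim
      case (elim \<omega>)
      show ?case
      proof (intro impI)
        assume Np: "\<forall>l\<in>{..m}. N (real l * (t / m)) \<omega> = p l"
        have N: "N (real l * h) \<omega> = p l" "N (real l * h + h) \<omega> = p (Suc l)" if "l < m" for l
          using Np[rule_format, of l] Np[rule_format, of "Suc l"] that by (auto simp: h_def[symmetric] algebra_simps)
        note P = counting_path_N[OF elim(4)]
        have "integral {0..t} (\<lambda>s. v (N s \<omega>)) = (\<Sum>l<m. integral {real l * h..real l * h + h} (\<lambda>s. v (N s \<omega>)))"
          using integral_uniform_mesh[of "\<lambda>s. v (N s \<omega>)" m h] h counting_path_integrable_on[OF P, of 0 v t] by simp
        also have "\<dots> = (\<Sum>l<m. wait h (real l * h) \<omega> *\<^sub>R (v (p l) - v (p (Suc l))) + h *\<^sub>R v (p (Suc l)))"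
          using integral_at_most_one_jump[OF P, of "real _ * h" h v] h N p by (intro sum.cong) auto
        also have "\<dots> = c + (\<Sum>l<m. wait h (real l * h) \<omega> *\<^sub>R (v (p l) - v (p (Suc l))))"
          by (simp add: sum.distrib c_def)
        also have "\<dots> \<notin> B" using elim N a b by auto
        finally show "integral {0..t} (\<lambda>s. v (N s \<omega>)) \<notin> B" .
      qed
    qed
  qed
  \<comment> \<open>Counts up to \<open>t\<close> are at most \<open>n\<close>, so for each mesh
    finitely many profiles suffice, and there are countably many meshes.\<close>
  have "AE \<omega> in M. \<forall>p\<in>PiE {..m} (\<lambda>_. {..n}). 0 < m \<longrightarrow> (\<forall>l<m. p (Suc l) \<le> p l + 1) \<longrightarrow>
      (\<forall>l\<in>{..m}. N (real l * (t / m)) \<omega> = p l) \<longrightarrow> N t \<omega> = n \<longrightarrow>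
      integral {0..t} (\<lambda>s. v (N s \<omega>)) \<notin> B" for m
  proof (rule AE_finite_allI)
    fix p :: "nat \<Rightarrow> nat"
    show "AE \<omega> in M. 0 < m \<longrightarrow> (\<forall>l<m. p (Suc l) \<le> p l + 1) \<longrightarrow>
      (\<forall>l\<in>{..m}. N (real l * (t / m)) \<omega> = p l) \<longrightarrow> N t \<omega> = n \<longrightarrow>
      integral {0..t} (\<lambda>s. v (N s \<omega>)) \<notin> B"
      using main[of m p] by (cases "0 < m \<and> (\<forall>l<m. p (Suc l) \<le> p l + 1)") auto
  qed (simp add: finite_PiE)
  then have "AE \<omega> in M. \<forall>m. \<forall>p\<in>PiE {..m} (\<lambda>_. {..n}). 0 < m \<longrightarrow> (\<forall>l<m. p (Suc l) \<le> p l + 1) \<longrightarrow>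
      (\<forall>l\<in>{..m}. N (real l * (t / m)) \<omega> = p l) \<longrightarrow> N t \<omega> = n \<longrightarrow>
      integral {0..t} (\<lambda>s. v (N s \<omega>)) \<notin> B" by (simp add: AE_all_countable)
  then show ?thesis using AE_simple_jumps[OF t] AE_space
  proof eventually_elim
    case (elim \<omega>)
    show ?case
    proof
      assume n: "N t \<omega> = n"
      obtain m :: nat where m: "0 < m" "\<And>l. l < m \<Longrightarrow> N (real (Suc l) * (t / m)) \<omega> \<le> N (real l * (t / m)) \<omega> + 1"
        using elim(2) by blast
      define p where "p = restrict (\<lambda>l. N (real l * (t / m)) \<omega>) {..m}"
      have "N (real l * (t / m)) \<omega> \<le> n" if "l \<le> m" for l
      proof -
        have "real l * (t / m) \<le> real m * (t / m)" using that t m by (intro mult_right_mono) auto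
        then show ?thesis using N_mono[OF elim(3), of "real l * (t / m)" t] n t m by simp
      qed
      then have "p \<in> PiE {..m} (\<lambda>_. {..n})" by (auto simp: p_def)
      moreover have "\<forall>l<m. p (Suc l) \<le> p l + 1" using m by (auto simp: p_def simp del: of_nat_Suc)
      moreover have "\<forall>l\<in>{..m}. N (real l * (t / m)) \<omega> = p l" by (simp add: p_def)
      ultimately show "integral {0..t} (\<lambda>s. v (N s \<omega>)) \<notin> B"
        using elim(1) m(1) n by blast
    qed
  qed
qed

end

section \<open>Halving the rate\<close>

text \<open>For closed nonempty \<open>C\<close> the functions
  \<open>max 0 (1 - real j * infdist x C)\<close> decrease to the indicator of \<open>C\<close>, and
  the closed sets are an intersection-stable generator of the Borel sets.\<close>

lemma measure_eqI_continuous: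
  fixes \<mu> \<nu> :: "'b::metric_space measure"
  assumes fin: "finite_measure \<mu>" "finite_measure \<nu>" and sets: "sets \<mu> = sets borel" "sets \<nu> = sets borel"
    and eq: "\<And>f. continuous_on UNIV f \<Longrightarrow> (\<And>x. 0 \<le> f x \<and> f x \<le> 1) \<Longrightarrow>
        integral\<^sup>L \<mu> f = (integral\<^sup>L \<nu> f :: real)"
  shows "\<mu> = \<nu>"
proof -
  have lim: "(\<lambda>j. LINT x|\<mu>. max 0 (1 - real j * infdist x C)) \<longlonglongrightarrow> measure \<mu> C"
    if C: "closed C" "C \<noteq> {}" and \<mu>: "finite_measure \<mu>" "sets \<mu> = sets borel"
    for C and \<mu> :: "'b measure"
  proof -
    interpret finite_measure \<mu> by fact
    have "(\<lambda>j. LINT x|\<mu>. max 0 (1 - real j * infdist x C)) \<longlonglongrightarrow> (LINT x|\<mu>. indicator C x)"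
    proof (rule integral_dominated_convergence[where w="\<lambda>_. 1"])
      show "AE x in \<mu>. (\<lambda>j. max 0 (1 - real j * infdist x C)) \<longlonglongrightarrow> indicator C x"
      proof (intro AE_I2)
        fix x
        show "(\<lambda>j. max 0 (1 - real j * infdist x C)) \<longlonglongrightarrow> indicator C x"
        proof (cases "x \<in> C")
          case False
          then have p: "infdist x C > 0" using C infdist_pos_not_in_closed by blast
          obtain J :: nat where J: "1 / infdist x C < real J" using reals_Archimedean2 by blast
          have "max 0 (1 - real j * infdist x C) = 0" if "J \<le> j" for j
          proof -
            have "1 < real J * infdist x C" using J p by (simp add: divide_less_eq)
            also have "\<dots> \<le> real j * infdist x C" using that p by (intro mult_right_mono) auto
            finally show ?thesis by simp
          qed
          then have "eventually (\<lambda>j. max 0 (1 - real j * infdist x C) = indicator C x) sequentially"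
            using False by (auto simp: eventually_sequentially)
          then show ?thesis by (rule tendsto_eventually)
        qed (use infdist_zero in simp)
      qed
      show "AE x in \<mu>. norm (max 0 (1 - real j * infdist x C)) \<le> 1" for j
        by (intro AE_I2) (auto simp: infdist_nonneg)
    qed (use C \<mu> in \<open>auto intro!: borel_measurable_continuous_onI continuous_intros
           simp: measurable_cong_sets[OF \<mu>(2) refl]\<close>)
    then show ?thesis using C \<mu> sets_eq_imp_space_eq[OF \<mu>(2)] by simp
  qed
  have "emeasure \<mu> C = emeasure \<nu> C" if C: "closed C" for C
  \<comment> \<open>\<open>infdist\<close> to the empty set is 0 by convention, so the approximation
    would return the whole mass there.\<close>
  proof (cases "C = {}")
    case False
    have "(LINT x|\<mu>. max 0 (1 - real j * infdist x C)) = (LINT x|\<nu>. max 0 (1 - real j * infdist x C))" for j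
      by (rule eq) (auto intro!: continuous_intros simp: infdist_nonneg)
    then have "measure \<mu> C = measure \<nu> C"
      using LIMSEQ_unique[OF lim[OF C False fin(1) sets(1)]] lim[OF C False fin(2) sets(2)] by simp
    then show ?thesis using fin by (simp add: finite_measure.emeasure_eq_measure)
  qed simp
  then show ?thesis
  proof (intro measure_eqI_generator_eq[where E="Collect closed" and \<Omega>=UNIV and A="\<lambda>_. UNIV"])
    show "sets \<mu> = sigma_sets UNIV (Collect closed)" "sets \<nu> = sigma_sets UNIV (Collect closed)"
      using sets by (simp_all add: borel_eq_closed)
    show "emeasure \<mu> UNIV \<noteq> \<infinity>"
      using finite_measure.emeasure_finite[OF fin(1)] by simp
  qed (auto simp: Int_stable_def)
qed

context poisson_counting
begin

text \<open>The integral is a limit of Riemann sums in finitely many \<open>N s\<close>.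
  \<open>F\<close> is general so that it can be the sigma-algebra generated by \<open>N\<close>
  alone, to which the independence from the chain refers.\<close>

lemma integral_N_measurable:
  fixes v :: "nat \<Rightarrow> 'b::euclidean_space"
  assumes t: "0 < t" and v: "bounded (range v)" and sp: "space F = space M"
    and F: "\<And>s. 0 \<le> s \<Longrightarrow> N s \<in> measurable F (count_space UNIV)"
  shows "(\<lambda>\<omega>. integral {0..t} (\<lambda>s. v (N s \<omega>))) \<in> borel_measurable F"
proof (rule borel_measurable_LIMSEQ_metric)
  fix m
  have "(\<lambda>\<omega>. v (N s \<omega>)) \<in> borel_measurable F" if "0 \<le> s" for s
    by (rule measurable_compose[OF F[OF that]]) simp
  then show "(\<lambda>\<omega>. \<Sum>i<Suc m. (t / Suc m) *\<^sub>R v (N (real i * (t / Suc m)) \<omega>)) \<in> borel_measurable F"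
    using t by (intro borel_measurable_sum borel_measurable_scaleR) auto
next
  show "(\<lambda>m. \<Sum>i<Suc m. (t / Suc m) *\<^sub>R v (N (real i * (t / Suc m)) \<omega>))
      \<longlonglongrightarrow> integral {0..t} (\<lambda>s. v (N s \<omega>))" if "\<omega> \<in> space F" for \<omega>
    using Riemann_sum_counting_path_tendsto[OF counting_path_N t v] that sp by simp
qed

text \<open>By independence of the increments, the probability of the cell counts
  \<open>k\<close>.\<close>

definition mesh_prob :: "real \<Rightarrow> nat \<Rightarrow> (nat \<Rightarrow> nat) \<Rightarrow> real" where
  "mesh_prob h m k = (\<Prod>i<m. pmf (poisson_pmf (Lam (real (Suc i) * h) - Lam (real i * h))) (k i))"

text \<open>The cell counts determine the number of events at each mesh point as a partial sum, so
  the expectation is a finite sum over the counts with total \<open>n\<close>.\<close>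

lemma expectation_mesh:
  fixes v :: "nat \<Rightarrow> 'b::real_normed_vector" and f :: "'b \<Rightarrow> real"
  assumes t: "0 < t" and m: "0 < m"
  defines "h \<equiv> t / real m"
  shows "(LINT \<omega>|M. f (\<Sum>i<m. h *\<^sub>R v (N (real i * h) \<omega>)) * indicator {\<omega>. N t \<omega> = n} \<omega>)
    = (\<Sum>k\<in>{k\<in>PiE {..<m} (\<lambda>_. {..n}). (\<Sum>i<m. k i) = n}. mesh_prob h m k * f (\<Sum>i<m. h *\<^sub>R v (\<Sum>j<i. k j)))"
proof -
  have h: "0 < h" "real m * h = t" using t m by (auto simp: h_def)
  let ?K = "{k\<in>PiE {..<m} (\<lambda>_. {..n}). (\<Sum>i<m. k i) = n}"
  let ?R = "\<lambda>k. f (\<Sum>i<m. h *\<^sub>R v (\<Sum>j<i. k j))"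
  let ?\<Delta> = "\<lambda>\<omega> i. N (real (Suc i) * h) \<omega> - N (real i * h) \<omega>"
  define E where "E = (\<lambda>k. {\<omega>\<in>space M. \<forall>i\<in>{..<m}. ?\<Delta> \<omega> i \<in> {k i}})"
  have fin: "finite ?K" by (rule finite_subset[of _ "PiE {..<m} (\<lambda>_. {..n})"]) (auto intro: finite_PiE)
  have [measurable]: "N (real i * h) \<in> measurable M (count_space UNIV)" for i
    using h by (intro N_measurable) auto
  have E: "E k \<in> events" for k unfolding E_def by measurable
  have pE: "prob (E k) = mesh_prob h m k" for k
    unfolding E_def mesh_prob_def using h
    by (subst prob_increments) (auto simp: strict_mono_Suc_iff measure_pmf_single)
  have sum\<Delta>: "(\<Sum>j<i. ?\<Delta> \<omega> j) = N (real i * h) \<omega>" if "\<omega> \<in> space M" for i \<omega>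
  proof (induction i)
    case (Suc i)
    then show ?case using N_mono[OF that, of "real i * h" "real (Suc i) * h"] h
      by (simp add: mult_right_mono)
  qed (simp add: N_0[OF that])
  have pt: "f (\<Sum>i<m. h *\<^sub>R v (N (real i * h) \<omega>)) * indicator {\<omega>. N t \<omega> = n} \<omega>
      = (\<Sum>k\<in>?K. indicator (E k) \<omega> * ?R k)" if w: "\<omega> \<in> space M" for \<omega>
  proof (cases "N t \<omega> = n")
    case True
    define k where "k = restrict (?\<Delta> \<omega>) {..<m}"
    have "?\<Delta> \<omega> i \<le> n" if "i < m" for i
    proof -
      have "real (Suc i) * h \<le> real m * h" using that h by (intro mult_right_mono) auto
      then show ?thesis using N_mono[OF w, of "real (Suc i) * h" t] h True by (simp add: le_diff_conv)
    qed
    then have k: "k \<in> ?K" using sum\<Delta>[OF w, of m] h True by (auto simp: k_def)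
    have "E k' \<inter> {\<omega>} = {}" if "k' \<in> ?K" "k' \<noteq> k" for k'
    proof (rule ccontr)
      assume "\<not> ?thesis"
      then have "\<forall>i<m. k' i = k i" by (auto simp: E_def k_def)
      then have "k' = k" using that(1) k by (intro PiE_ext[of k' "{..<m}" _ k]) auto
      then show False using that by simp
    qed
    then have z: "indicator (E k') \<omega> * ?R k' = 0" if "k' \<in> ?K - {k}" for k'
      using that by (auto simp: indicator_def)
    have "(\<Sum>k\<in>?K. indicator (E k) \<omega> * ?R k) = indicator (E k) \<omega> * ?R k"
    proof -
      have "(\<Sum>k\<in>?K - {k}. indicator (E k) \<omega> * ?R k) = 0"
        by (rule sum.neutral) (rule ballI, rule z)
      then show ?thesis unfolding sum.remove[OF fin k] by simp
    qed
    moreover have "\<omega> \<in> E k" using w by (simp add: E_def k_def)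
    moreover have "(\<Sum>j<i. k j) = N (real i * h) \<omega>" if "i < m" for i
      using sum\<Delta>[OF w, of i] that by (auto simp: k_def intro!: sum.cong)
    ultimately show ?thesis using True by simp
  next
    case False
    have "\<omega> \<notin> E k" if "k \<in> ?K" for k
    proof
      assume "\<omega> \<in> E k"
      then have "(\<Sum>i<m. k i) = (\<Sum>j<m. ?\<Delta> \<omega> j)" by (auto simp: E_def)
      then show False using that sum\<Delta>[OF w, of m] h False by simp
    qed
    then show ?thesis using False by simp
  qed
  have "(LINT \<omega>|M. f (\<Sum>i<m. h *\<^sub>R v (N (real i * h) \<omega>)) * indicator {\<omega>. N t \<omega> = n} \<omega>)
      = (LINT \<omega>|M. (\<Sum>k\<in>?K. indicator (E k) \<omega> * ?R k))"
    by (rule Bochner_Integration.integral_cong[OF refl pt])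
  also have "\<dots> = (\<Sum>k\<in>?K. prob (E k) * ?R k)"
    using E by (subst Bochner_Integration.integral_sum)
      (auto intro!: integrable_mult_left simp: less_top[symmetric] sets.Int_space_eq2)
  finally show ?thesis by (simp add: pE)
qed

end

text \<open>The Poisson mass at \<open>k\<close> with parameter \<open>r\<close> is
  \<open>2 ^ k * exp (- r / 2)\<close> times the one with parameter \<open>r / 2\<close>. In the
  product over the cells the exponents \<open>k i\<close> add up to \<open>n\<close> and the
  parameters telescope.\<close>

lemma mesh_prob_half_rate:
  assumes "poisson_counting M lam N" "poisson_counting M' (\<lambda>s. lam s / 2) N'"
    and "0 < h" "(\<Sum>i<m. k i) = n"
  shows "poisson_counting.mesh_prob lam h m k
    = 2 ^ n * exp (- cumulative_rate lam (real m * h) / 2) * poisson_counting.mesh_prob (\<lambda>s. lam s / 2) h m k"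
proof -
  interpret P: poisson_counting M lam N by fact
  interpret P': poisson_counting M' "\<lambda>s. lam s / 2" N' by fact
  let ?d = "\<lambda>i. P.Lam (real (Suc i) * h) - P.Lam (real i * h)"
  have d: "0 < ?d i" for i using P.Lam_strict_mono[of "real i * h" "real (Suc i) * h"] assms by simp
  have "P.mesh_prob h m k = (\<Prod>i<m. 2 ^ k i * exp (- ?d i / 2) * pmf (poisson_pmf (?d i / 2)) (k i))"
    unfolding P.mesh_prob_def
  proof (intro prod.cong refl)
    fix i
    have half: "exp (- x) = exp (- x / 2) * exp (- (x / 2))" for x :: real by (simp add: mult_exp_exp)
    show "pmf (poisson_pmf (?d i)) (k i) = 2 ^ k i * exp (- ?d i / 2) * pmf (poisson_pmf (?d i / 2)) (k i)"
      using d[of i] by (subst pmf_poisson, simp, subst half) (simp add: power_divide)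
  qed
  also have "\<dots> = 2 ^ (\<Sum>i<m. k i) * exp (\<Sum>i<m. - ?d i / 2) * P'.mesh_prob h m k"
    by (simp add: prod.distrib power_sum exp_sum P'.mesh_prob_def cumulative_rate_half diff_divide_distrib)
  also have "(\<Sum>i<m. - ?d i / 2) = - P.Lam (real m * h) / 2"
  proof -
    have "(\<Sum>i<m. - ?d i / 2) = (\<Sum>i<m. - P.Lam (real (Suc i) * h) / 2 - (- P.Lam (real i * h) / 2))"
      by (intro sum.cong) (simp_all add: diff_divide_distrib)
    then show ?thesis
      unfolding sum_lessThan_telescope[of "\<lambda>i. - P.Lam (real i * h) / 2"] by (simp add: cumulative_rate_0)
  qed
  finally show ?thesis using assms by simp
qed

text \<open>The factor in \<open>mesh_prob_half_rate\<close> depends on \<open>n\<close> and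
  \<open>t\<close> only, neither on the mesh nor on the cell counts. It therefore survives the limit
  of the Riemann sums inside continuous functions, and these determine the laws.\<close>

lemma law_half_rate:
  fixes v :: "nat \<Rightarrow> 'b::euclidean_space"
  assumes P: "poisson_counting M lam N" "poisson_counting M' (\<lambda>s. lam s / 2) N'"
    and t: "0 < t" and v: "bounded (range v)" and B: "B \<in> sets borel"
  shows "measure M {\<omega>\<in>space M. integral {0..t} (\<lambda>s. v (N s \<omega>)) \<in> B \<and> N t \<omega> = n}
    = 2 ^ n * exp (- cumulative_rate lam t / 2)
      * measure M' {\<omega>\<in>space M'. integral {0..t} (\<lambda>s. v (N' s \<omega>)) \<in> B \<and> N' t \<omega> = n}"
proof -
  interpret P: poisson_counting M lam N by fact
  interpret P': poisson_counting M' "\<lambda>s. lam s / 2" N' by fact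
  define C where "C = 2 ^ n * exp (- cumulative_rate lam t / 2)"
  have C: "C > 0" by (simp add: C_def)
  let ?I = "\<lambda>\<omega>. integral {0..t} (\<lambda>s. v (N s \<omega>))" and ?I' = "\<lambda>\<omega>. integral {0..t} (\<lambda>s. v (N' s \<omega>))"
  have N [measurable]: "N t \<in> measurable M (count_space UNIV)" "N' t \<in> measurable M' (count_space UNIV)"
    using t by auto
  have I [measurable]: "?I \<in> borel_measurable M" "?I' \<in> borel_measurable M'"
    using t v by (auto intro: P.integral_N_measurable P'.integral_N_measurable)
  have J: "(\<lambda>\<omega>. indicator {n} (N t \<omega>) :: real) \<in> borel_measurable M"
      "(\<lambda>\<omega>. indicator {n} (N' t \<omega>) :: real) \<in> borel_measurable M'"
    by (rule measurable_compose[OF N(1)] measurable_compose[OF N(2)], simp)+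
  note J' = J J[THEN measurable_compose, OF measurable_ennreal]
    borel_measurable_times[OF borel_measurable_const J(2), of C]
    borel_measurable_times[OF borel_measurable_const J(2), THEN measurable_compose, OF measurable_ennreal, of C]
  have lim: "(\<lambda>m. LINT \<omega>|M. f (\<Sum>i<Suc m. (t / Suc m) *\<^sub>R v (N (real i * (t / Suc m)) \<omega>)) * indicator {\<omega>. N t \<omega> = n} \<omega>)
      \<longlonglongrightarrow> (LINT \<omega>|M. f (integral {0..t} (\<lambda>s. v (N s \<omega>))) * indicator {\<omega>. N t \<omega> = n} \<omega>)"
    if "poisson_counting M lam N" and f: "continuous_on UNIV f" "\<And>x. 0 \<le> f x \<and> f x \<le> (1::real)"
    for M :: "'z measure" and lam N f
  proof -
    interpret poisson_counting M lam N by fact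
    have [measurable]: "f \<in> borel_measurable borel" using f by (intro borel_measurable_continuous_onI)
    have [measurable]: "N t \<in> measurable M (count_space UNIV)" using t by auto
    have [measurable]: "(\<lambda>\<omega>. integral {0..t} (\<lambda>s. v (N s \<omega>))) \<in> borel_measurable M"
      using t v by (auto intro: integral_N_measurable)
    have ind [measurable]: "(indicator {\<omega>. N t \<omega> = n} :: _ \<Rightarrow> real) \<in> borel_measurable M" for n
    proof -
      have "(\<lambda>\<omega>. indicator {n} (N t \<omega>) :: real) \<in> borel_measurable M"
        by (rule measurable_compose[OF N_measurable]) (use t in auto)
      also have "(\<lambda>\<omega>. indicator {n} (N t \<omega>) :: real) = indicator {\<omega>. N t \<omega> = n}"
        by (auto simp: indicator_def)
      finally show ?thesis .
    qed
    have R: "(\<lambda>\<omega>. \<Sum>i<Suc m. (t / Suc m) *\<^sub>R v (N (real i * (t / Suc m)) \<omega>)) \<in> borel_measurable M" for m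
    proof (intro borel_measurable_sum borel_measurable_scaleR)
      show "(\<lambda>\<omega>. v (N (real i * (t / Suc m)) \<omega>)) \<in> borel_measurable M" for i
        by (rule measurable_compose[OF N_measurable]) (use t in auto)
    qed auto
    show ?thesis
    proof (rule integral_dominated_convergence[where w="\<lambda>_. 1"])
      show "AE \<omega> in M. (\<lambda>m. f (\<Sum>i<Suc m. (t / Suc m) *\<^sub>R v (N (real i * (t / Suc m)) \<omega>)) * indicator {\<omega>. N t \<omega> = n} \<omega>)
          \<longlonglongrightarrow> f (integral {0..t} (\<lambda>s. v (N s \<omega>))) * indicator {\<omega>. N t \<omega> = n} \<omega>"
      proof (intro AE_I2 tendsto_mult tendsto_const)
        fix \<omega> assume "\<omega> \<in> space M"
        then show "(\<lambda>m. f (\<Sum>i<Suc m. (t / Suc m) *\<^sub>R v (N (real i * (t / Suc m)) \<omega>)))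
            \<longlonglongrightarrow> f (integral {0..t} (\<lambda>s. v (N s \<omega>)))"
          using continuous_on_tendsto_compose[OF f(1) Riemann_sum_counting_path_tendsto[OF counting_path_N t v]]
          by simp
      qed
      show "AE \<omega> in M. norm (f (\<Sum>i<Suc m. (t / Suc m) *\<^sub>R v (N (real i * (t / Suc m)) \<omega>)) * indicator {\<omega>. N t \<omega> = n} \<omega>) \<le> 1" for m
        using f(2) by (intro AE_I2) (auto simp: indicator_def)
      show "(\<lambda>\<omega>. f (\<Sum>i<Suc m. (t / Suc m) *\<^sub>R v (N (real i * (t / Suc m)) \<omega>)) * indicator {\<omega>. N t \<omega> = n} \<omega>) \<in> borel_measurable M" for m
        using R[of m] by (intro borel_measurable_times measurable_compose[OF R[of m]] ind) auto
    qed auto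
  qed
  \<comment> \<open>The laws of the two integrals on the event of exactly \<open>n\<close> jumps,
    the second one scaled by \<open>C\<close>.\<close>
  define \<mu> where "\<mu> = distr (density M (\<lambda>\<omega>. ennreal (indicator {n} (N t \<omega>)))) borel ?I"
  define \<nu> where "\<nu> = distr (density M' (\<lambda>\<omega>. ennreal (C * indicator {n} (N' t \<omega>)))) borel ?I'"
  have em: "emeasure \<mu> A = ennreal (measure M {\<omega>\<in>space M. ?I \<omega> \<in> A \<and> N t \<omega> = n})" if [measurable]: "A \<in> sets borel" for A
  proof -
    have "emeasure \<mu> A = (\<integral>\<^sup>+\<omega>. ennreal (indicator {n} (N t \<omega>)) * indicator (?I -` A \<inter> space M) \<omega> \<partial>M)"
      unfolding \<mu>_def using J' measurable_sets[OF I(1) that] measurable_sets[OF I(2) that]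
      by (subst emeasure_distr) (simp_all add: emeasure_density)
    also have "\<dots> = (\<integral>\<^sup>+\<omega>. indicator {\<omega>\<in>space M. ?I \<omega> \<in> A \<and> N t \<omega> = n} \<omega> \<partial>M)"
      by (intro nn_integral_cong) (auto simp: indicator_def)
    finally show ?thesis by (simp add: P.emeasure_eq_measure)
  qed
  have en: "emeasure \<nu> A = ennreal (C * measure M' {\<omega>\<in>space M'. ?I' \<omega> \<in> A \<and> N' t \<omega> = n})" if [measurable]: "A \<in> sets borel" for A
  proof -
    have "emeasure \<nu> A = (\<integral>\<^sup>+\<omega>. ennreal (C * indicator {n} (N' t \<omega>)) * indicator (?I' -` A \<inter> space M') \<omega> \<partial>M')"
      unfolding \<nu>_def using J' measurable_sets[OF I(1) that] measurable_sets[OF I(2) that]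
      by (subst emeasure_distr) (simp_all add: emeasure_density)
    also have "\<dots> = (\<integral>\<^sup>+\<omega>. ennreal C * indicator {\<omega>\<in>space M'. ?I' \<omega> \<in> A \<and> N' t \<omega> = n} \<omega> \<partial>M')"
      by (intro nn_integral_cong) (auto simp: indicator_def)
    finally show ?thesis using C by (simp add: nn_integral_cmult P'.emeasure_eq_measure ennreal_mult)
  qed
  have "\<mu> = \<nu>"
  proof (rule measure_eqI_continuous)
    show "finite_measure \<mu>" using em[of UNIV] by (intro finite_measureI) (simp add: \<mu>_def)
    show "finite_measure \<nu>" using en[of UNIV] by (intro finite_measureI) (simp add: \<nu>_def)
    fix f :: "'b \<Rightarrow> real" assume f: "continuous_on UNIV f" "\<And>x. 0 \<le> f x \<and> f x \<le> 1"
    have [measurable]: "f \<in> borel_measurable borel" using f by (intro borel_measurable_continuous_onI)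
    have "(LINT \<omega>|M. f (\<Sum>i<Suc m. (t / Suc m) *\<^sub>R v (N (real i * (t / Suc m)) \<omega>)) * indicator {\<omega>. N t \<omega> = n} \<omega>)
       = C * (LINT \<omega>|M'. f (\<Sum>i<Suc m. (t / Suc m) *\<^sub>R v (N' (real i * (t / Suc m)) \<omega>)) * indicator {\<omega>. N' t \<omega> = n} \<omega>)" for m
      using t by (subst P.expectation_mesh P'.expectation_mesh; simp only: sum_distrib_left)+
         (intro sum.cong refl, use mesh_prob_half_rate[OF P, where h="t / Suc m" and m="Suc m" and n=n] in \<open>simp add: C_def del: of_nat_Suc\<close>)
    from LIMSEQ_unique[OF lim[OF P(1) f, unfolded this] tendsto_mult_left[OF lim[OF P(2) f]]]
    have eq: "(LINT \<omega>|M. f (?I \<omega>) * indicator {\<omega>. N t \<omega> = n} \<omega>)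
        = C * (LINT \<omega>|M'. f (?I' \<omega>) * indicator {\<omega>. N' t \<omega> = n} \<omega>)" by simp
    have "integral\<^sup>L \<mu> f = (LINT \<omega>|M. indicator {n} (N t \<omega>) *\<^sub>R f (?I \<omega>))"
      unfolding \<mu>_def by (subst integral_distr) (use J' I in \<open>auto simp: integral_density\<close>)
    also have "\<dots> = (LINT \<omega>|M. f (?I \<omega>) * indicator {\<omega>. N t \<omega> = n} \<omega>)"
      by (intro Bochner_Integration.integral_cong) (auto simp: indicator_def)
    also note eq
    also have "C * (LINT \<omega>|M'. f (?I' \<omega>) * indicator {\<omega>. N' t \<omega> = n} \<omega>)
        = (LINT \<omega>|M'. (C * indicator {n} (N' t \<omega>)) *\<^sub>R f (?I' \<omega>))"
      by (subst integral_mult_right_zero[symmetric])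
         (intro Bochner_Integration.integral_cong, auto simp: indicator_def)
    also have "\<dots> = integral\<^sup>L \<nu> f"
      unfolding \<nu>_def using C by (subst integral_distr) (use J' I in \<open>auto simp: integral_density\<close>)
    finally show "integral\<^sup>L \<mu> f = integral\<^sup>L \<nu> f" .
  qed (auto simp: \<mu>_def \<nu>_def)
  then show ?thesis using em[OF B] en[OF B] C by (simp add: C_def)
qed

section \<open>Summation over the number of events and the directions used\<close>

lemma bounded_range_PiE:
  fixes g :: "'v \<Rightarrow> 'b::real_normed_vector"
  assumes v: "v \<in> PiE A (\<lambda>_. S)" and S: "finite S"
  shows "bounded (range (\<lambda>k. g (v k)))"
proof -
  \<comment> \<open>Off \<open>A\<close> an extensional function has the single value
    \<open>undefined\<close>, so the range stays finite.\<close>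
  have "v k \<in> insert undefined S" for k
    using PiE_mem[OF v, of k] PiE_arb[OF v, of k] by (cases "k \<in> A") auto
  then have "range (\<lambda>k. g (v k)) \<subseteq> g ` insert undefined S" by blast
  moreover have "finite (g ` insert undefined S)" using S by simp
  ultimately show ?thesis by (blast intro: finite_imp_bounded finite_subset)
qed

lemma uniform_chain_prob:
  assumes "uniform_chain M S K V"
  shows "measure M {\<omega>\<in>space M. \<forall>i\<le>n. V i \<omega> = v i}
    = pmf (pmf_of_set S) (v 0) * (\<Prod>i<n. pmf (pmf_of_set (K (v i))) (v (Suc i)))"
proof (induction n)
  case 0
  then show ?case using assms by (simp add: uniform_chain_def)
next
  case (Suc n)
  have "measure M {\<omega>\<in>space M. \<forall>i\<le>Suc n. V i \<omega> = v i}
      = measure M {\<omega>\<in>space M. \<forall>i\<le>n. V i \<omega> = v i} * pmf (pmf_of_set (K (v n))) (v (Suc n))"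
    using assms unfolding uniform_chain_def by blast
  then show ?case using Suc by simp
qed

context poisson_counting
begin

text \<open>Up to time \<open>t\<close> only the directions with index at most \<open>N t\<close>
  matter. Once \<open>n = N t\<close> and the values \<open>v 0, ..., v n\<close> are fixed, the
  chain enters only through \<open>A n v\<close> and the Poisson process only through
  \<open>C n v\<close>, which are independent. With \<open>S\<close> the face directions the
  condition on \<open>V\<close> selects the paths on the face; with the full state space it always
  holds.\<close>

lemma direction_sums:
  fixes g :: "'v::euclidean_space \<Rightarrow> 'b::euclidean_space"
  assumes V: "\<And>n. V n \<in> borel_measurable M"
    and ind: "indep_set (sets (vimage_algebra (space M) (\<lambda>\<omega>. \<lambda>n\<in>UNIV. V n \<omega>) (\<Pi>\<^sub>M n\<in>UNIV. borel)))
       (sets (vimage_algebra (space M) (\<lambda>\<omega>. \<lambda>t\<in>{0..}. N t \<omega>) (\<Pi>\<^sub>M t\<in>{0..}. count_space UNIV)))"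
    and S: "finite S" and t: "0 < t" and B: "B \<in> sets borel"
  shows "{\<omega>\<in>space M. (\<forall>i\<le>N t \<omega>. V i \<omega> \<in> S) \<and> integral {0..t} (\<lambda>s. g (V (N s \<omega>) \<omega>)) \<in> B} \<in> events"
    and "(\<lambda>n. \<Sum>v\<in>PiE {..n} (\<lambda>_. S). prob {\<omega>\<in>space M. \<forall>i\<le>n. V i \<omega> = v i}
        * prob {\<omega>\<in>space M. integral {0..t} (\<lambda>s. g (v (N s \<omega>))) \<in> B \<and> N t \<omega> = n})
    sums prob {\<omega>\<in>space M. (\<forall>i\<le>N t \<omega>. V i \<omega> \<in> S) \<and> integral {0..t} (\<lambda>s. g (V (N s \<omega>) \<omega>)) \<in> B}"
proof -
  let ?FV = "vimage_algebra (space M) (\<lambda>\<omega>. \<lambda>n\<in>UNIV. V n \<omega>) (\<Pi>\<^sub>M n\<in>UNIV. borel)"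
  let ?FN = "vimage_algebra (space M) (\<lambda>\<omega>. \<lambda>t\<in>{0..}. N t \<omega>) (\<Pi>\<^sub>M t\<in>{0..}. count_space UNIV)"
  have VF: "V n \<in> borel_measurable ?FV" for n
  proof -
    have "(\<lambda>\<omega>. (\<lambda>n\<in>UNIV. V n \<omega>) n) \<in> borel_measurable ?FV"
      by (rule measurable_compose[OF measurable_vimage_algebra1 measurable_component_singleton])
         (auto simp: space_PiM)
    then show ?thesis by simp
  qed
  have NF: "N s \<in> measurable ?FN (count_space UNIV)" if "0 \<le> s" for s
  proof -
    have "(\<lambda>\<omega>. (\<lambda>t\<in>{0..}. N t \<omega>) s) \<in> measurable ?FN (count_space UNIV)"
      by (rule measurable_compose[OF measurable_vimage_algebra1 measurable_component_singleton])
         (use that in \<open>auto simp: space_PiM PiE_iff extensional_def\<close>)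
    then show ?thesis using that by simp
  qed
  define A where "A = (\<lambda>n v. {\<omega>\<in>space M. \<forall>i\<le>n. V i \<omega> = v i})"
  define C where "C = (\<lambda>n v. {\<omega>\<in>space M. integral {0..t} (\<lambda>s. g (v (N s \<omega>))) \<in> B \<and> N t \<omega> = n})"
  have AF: "A n v \<in> sets ?FV" for n v
  proof -
    have "{\<omega>\<in>space ?FV. \<forall>i\<in>{..n}. V i \<omega> = v i} \<in> sets ?FV"
    proof (rule sets.sets_Collect_finite_All)
      show "{\<omega>\<in>space ?FV. V i \<omega> = v i} \<in> sets ?FV" for i
        using measurable_sets[OF VF, of "{v i}" i] by (simp add: vimage_def Int_def conj_commute)
    qed simp
    also have "{\<omega>\<in>space ?FV. \<forall>i\<in>{..n}. V i \<omega> = v i} = A n v" by (auto simp: A_def)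
    finally show ?thesis .
  qed
  have CF: "C n v \<in> sets ?FN" if v: "v \<in> PiE {..n} (\<lambda>_. S)" for n v
  proof -
    have [measurable]: "(\<lambda>\<omega>. integral {0..t} (\<lambda>s. g (v (N s \<omega>)))) \<in> borel_measurable ?FN"
      by (rule integral_N_measurable[OF t bounded_range_PiE[OF v S] _ NF]) auto
    have [measurable]: "N t \<in> measurable ?FN (count_space UNIV)" using NF t by auto
    have "{\<omega>\<in>space ?FN. integral {0..t} (\<lambda>s. g (v (N s \<omega>))) \<in> B \<and> N t \<omega> = n} \<in> sets ?FN"
      using B by measurable
    also have "{\<omega>\<in>space ?FN. integral {0..t} (\<lambda>s. g (v (N s \<omega>))) \<in> B \<and> N t \<omega> = n} = C n v"
      by (auto simp: C_def)
    finally show ?thesis .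
  qed
  have sub: "sets ?FV \<subseteq> events" "sets ?FN \<subseteq> events"
    using ind unfolding indep_set_def indep_sets_def by (auto split: bool.splits)
  have AC: "prob (A n v \<inter> C n v) = prob (A n v) * prob (C n v)" "A n v \<inter> C n v \<in> events"
    if "v \<in> PiE {..n} (\<lambda>_. S)" for n v
    using indep_setD[OF ind AF CF[OF that]] sets.Int[OF subsetD[OF sub(1) AF] subsetD[OF sub(2) CF[OF that]]] .
  have disj: "disjoint_family_on (\<lambda>v. A n v \<inter> C n v) (PiE {..n} (\<lambda>_. S))" for n
    unfolding disjoint_family_on_def
  proof (intro ballI impI)
    fix v w assume vw: "v \<in> PiE {..n} (\<lambda>_. S)" "w \<in> PiE {..n} (\<lambda>_. S)" "v \<noteq> w"
    have "v = w" if "\<omega> \<in> A n v" "\<omega> \<in> A n w" for \<omega>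
      using that by (intro PiE_ext[OF vw(1,2)]) (auto simp: A_def)
    then show "A n v \<inter> C n v \<inter> (A n w \<inter> C n w) = {}" using vw by blast
  qed
  let ?T = "\<lambda>n. \<Union>v\<in>PiE {..n} (\<lambda>_. S). A n v \<inter> C n v"
  have pT: "prob (?T n) = (\<Sum>v\<in>PiE {..n} (\<lambda>_. S). prob (A n v) * prob (C n v))" for n
    using AC disj S by (subst finite_measure_finite_Union) (auto intro!: finite_PiE)
  have T: "?T n = {\<omega>\<in>space M. (\<forall>i\<le>N t \<omega>. V i \<omega> \<in> S) \<and> integral {0..t} (\<lambda>s. g (V (N s \<omega>) \<omega>)) \<in> B \<and> N t \<omega> = n}" (is "_ = ?R n") for n
  proof -
    have int: "integral {0..t} (\<lambda>s. g (v (N s \<omega>))) = integral {0..t} (\<lambda>s. g (V (N s \<omega>) \<omega>))"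
      if "\<omega> \<in> A n v" "N t \<omega> = n" for \<omega> v
    proof (rule Henstock_Kurzweil_Integration.integral_cong)
      fix s assume "s \<in> {0..t}"
      then have "N s \<omega> \<le> n" using N_mono[of \<omega> s t] that by (auto simp: A_def)
      then show "g (v (N s \<omega>)) = g (V (N s \<omega>) \<omega>)" using that by (simp add: A_def)
    qed
    show ?thesis
    proof (intro equalityI subsetI)
      fix \<omega> assume "\<omega> \<in> ?T n"
      then obtain v where v: "v \<in> PiE {..n} (\<lambda>_. S)" "\<omega> \<in> A n v" "\<omega> \<in> C n v" by auto
      then have "integral {0..t} (\<lambda>s. g (v (N s \<omega>))) = integral {0..t} (\<lambda>s. g (V (N s \<omega>) \<omega>))"
        by (intro int) (auto simp: C_def)
      then show "\<omega> \<in> ?R n" using v by (auto simp: A_def C_def PiE_iff)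
    next
      fix \<omega> assume w: "\<omega> \<in> ?R n"
      define v where "v = restrict (\<lambda>i. V i \<omega>) {..n}"
      have v: "v \<in> PiE {..n} (\<lambda>_. S)" "\<omega> \<in> A n v" using w by (auto simp: v_def A_def)
      then have "\<omega> \<in> C n v" using w int[of \<omega> v] by (auto simp: C_def)
      then show "\<omega> \<in> ?T n" using v by auto
    qed
  qed
  have UT: "(\<Union>n. ?T n) = {\<omega>\<in>space M. (\<forall>i\<le>N t \<omega>. V i \<omega> \<in> S) \<and> integral {0..t} (\<lambda>s. g (V (N s \<omega>) \<omega>)) \<in> B}"
    unfolding T by auto
  have Tm: "?T n \<in> events" for n
    using AC(2) S by (intro sets.finite_UN) (auto intro!: finite_PiE)
  have "(\<Union>n. ?T n) \<in> events" using Tm by (intro sets.countable_UN) auto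
  then show "{\<omega>\<in>space M. (\<forall>i\<le>N t \<omega>. V i \<omega> \<in> S) \<and> integral {0..t} (\<lambda>s. g (V (N s \<omega>) \<omega>)) \<in> B} \<in> events"
    unfolding UT .
  have "(\<lambda>n. prob (?T n)) sums prob (\<Union>n. ?T n)"
    using Tm by (intro finite_measure_UNION) (auto simp: disjoint_family_on_def C_def)
  then show "(\<lambda>n. \<Sum>v\<in>PiE {..n} (\<lambda>_. S). prob {\<omega>\<in>space M. \<forall>i\<le>n. V i \<omega> = v i}
        * prob {\<omega>\<in>space M. integral {0..t} (\<lambda>s. g (v (N s \<omega>))) \<in> B \<and> N t \<omega> = n})
    sums prob {\<omega>\<in>space M. (\<forall>i\<le>N t \<omega>. V i \<omega> \<in> S) \<and> integral {0..t} (\<lambda>s. g (V (N s \<omega>) \<omega>)) \<in> B}"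
    unfolding pT UT by (simp add: A_def C_def)
qed

end

section \<open>Affine geometry of the face\<close>

definition face_directions :: "(real \<times> real \<times> real) set" where
  "face_directions = {(1, 0, 0), (0, 1, 0), (0, 0, 1)}"

definition face_velocity :: "real \<Rightarrow> real \<times> real \<times> real \<Rightarrow> real \<times> real" where
  "face_velocity c d = (c * fst d, c * fst (snd d))"

text \<open>\<open>face_map c t\<close> is the change of variables of the theorem; \<open>face_map c 1\<close> sends the projected velocities
  \<open>face_velocity c d\<^sub>i\<close> to \<open>v\<^sub>i\<close>.\<close>

definition face_map :: "real \<Rightarrow> real \<Rightarrow> real \<times> real \<Rightarrow> real \<times> real" where
  "face_map c t p = ((3 * fst p - c * t) / 2, sqrt 3 * snd p + sqrt 3 * (fst p - c * t) / 2)"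

definition face_map_inv :: "real \<Rightarrow> real \<Rightarrow> real \<times> real \<Rightarrow> real \<times> real" where
  "face_map_inv c t q = ((2 * fst q + c * t) / 3, snd q / sqrt 3 - ((2 * fst q + c * t) / 3 - c * t) / 2)"

lemma face_map_inverse [simp]:
  "face_map_inv c t (face_map c t p) = p" "face_map c t (face_map_inv c t q) = q"
proof -
  have *: "face_map c t p = ((3 * fst p - c * t) / 2, sqrt 3 * (snd p + (fst p - c * t) / 2))" for p
    by (simp add: face_map_def distrib_left)
  have "(3 * ((2 * u + c * t) / 3) - c * t) / 2 = u" "(2 * ((3 * u - c * t) / 2) + c * t) / 3 = u" for u
    by (simp_all add: field_simps)
  then show "face_map_inv c t (face_map c t p) = p" "face_map c t (face_map_inv c t q) = q"
    by (simp_all add: * face_map_inv_def prod_eq_iff)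
qed

lemma face_map_affine:
  "face_map c s p = (3 / 2 * fst p, sqrt 3 * snd p + sqrt 3 / 2 * fst p) + s *\<^sub>R (- c / 2, - sqrt 3 * c / 2)"
  by (auto simp: face_map_def field_simps)

lemma continuous_face_map: "continuous_on UNIV (face_map c t)" "continuous_on UNIV (face_map_inv c t)"
  unfolding face_map_def face_map_inv_def by (auto intro!: continuous_intros)

lemma face_map_measurable [measurable]:
  "face_map c t \<in> borel_measurable borel" "face_map_inv c t \<in> borel_measurable borel"
  using continuous_face_map by (auto intro: borel_measurable_continuous_onI)

lemma planar_velocities_eq: "planar_velocities c = (\<lambda>d. face_map c 1 (face_velocity c d)) ` face_directions"
  by (simp add: planar_velocities_def face_directions_def face_map_def face_velocity_def mult.commute)

lemma inj_on_planar_velocity: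
  assumes "c \<noteq> 0"
  shows "inj_on (\<lambda>d. face_map c 1 (face_velocity c d)) face_directions"
proof (rule inj_onI)
  fix d e assume de: "d \<in> face_directions" "e \<in> face_directions"
    and "face_map c 1 (face_velocity c d) = face_map c 1 (face_velocity c e)"
  then have "face_velocity c d = face_velocity c e" by (metis face_map_inverse(1))
  then show "d = e" using de assms by (auto simp: face_velocity_def face_directions_def)
qed

text \<open>The translation in \<open>face_map c 1\<close> is constant along the path, so
  integration multiplies it by \<open>t\<close>; this is the translation in
  \<open>face_map c t\<close>.\<close>

lemma integral_face_map:
  assumes "f integrable_on {0..t}" "0 < t"
  shows "integral {0..t} (\<lambda>s. face_map c 1 (f s)) = face_map c t (integral {0..t} f)"
proof -
  let ?L = "\<lambda>p::real\<times>real. (3 / 2 * fst p, sqrt 3 * snd p + sqrt 3 / 2 * fst p)"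
  have bl: "bounded_linear ?L"
    by (intro bounded_linear_Pair bounded_linear_add bounded_linear_const_mult bounded_linear_fst bounded_linear_snd)
  have "(\<lambda>s. ?L (f s)) integrable_on {0..t}"
    using integrable_linear[OF assms(1) bl] by (simp add: o_def)
  moreover have "integral {0..t} (\<lambda>s. ?L (f s)) = ?L (integral {0..t} f)"
    using integral_linear[OF assms(1) bl] by (simp add: o_def)
  ultimately show ?thesis
    unfolding face_map_affine using assms(2)
    by (subst Henstock_Kurzweil_Integration.integral_add) (auto simp: integrable_on_const)
qed

lemma open_face_region: "open (face_region c t)"
proof -
  have "face_region c t = {p. 0 < fst p} \<inter> {p. 0 < snd p} \<inter> {p. fst p + snd p < c * t}"
    by (auto simp: face_region_def)
  then show ?thesis by (auto intro!: open_Int open_Collect_less continuous_intros)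
qed

text \<open>With respect to the vertices, the image of \<open>(x, y)\<close> has the barycentric
  coordinates \<open>x / (c * t)\<close>, \<open>y / (c * t)\<close> and the remainder to 1. The
  image of the region is open, being a preimage under the continuous inverse, so it lies in the
  interior.\<close>

lemma face_map_region: "face_map c t ` face_region c t \<subseteq> planar_region c t" if "c > 0" "t > 0"
  unfolding planar_region_def
proof (rule interior_maximal)
  have im: "face_map c t ` S = face_map_inv c t -` S" for S
    by (auto simp: image_iff) (metis face_map_inverse(2))
  show "open (face_map c t ` face_region c t)"
    unfolding im by (rule open_vimage[OF open_face_region continuous_face_map(2)])
  show "face_map c t ` face_region c t \<subseteq> convex hull ((\<lambda>v. t *\<^sub>R v) ` planar_velocities c)"
  proof
    fix q assume "q \<in> face_map c t ` face_region c t"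
    then obtain x y where q: "q = face_map c t (x, y)" and xy: "0 < x" "0 < y" "x + y < c * t"
      by (auto simp: face_region_def)
    let ?S = "(\<lambda>v. t *\<^sub>R v) ` planar_velocities c"
    have q': "q = (x / (c * t)) *\<^sub>R (t *\<^sub>R (c, 0)) + (y / (c * t)) *\<^sub>R (t *\<^sub>R (-c/2, sqrt 3 * c/2))
        + (1 - x / (c * t) - y / (c * t)) *\<^sub>R (t *\<^sub>R (-c/2, - sqrt 3 * c/2))"
      using that by (simp add: q face_map_def field_simps)
    have S: "?S = {t *\<^sub>R (c, 0), t *\<^sub>R (-c/2, sqrt 3 * c/2), t *\<^sub>R (-c/2, - sqrt 3 * c/2)}"
      by (simp add: planar_velocities_def)
    show "q \<in> convex hull ?S"
      unfolding S convex_hull_3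
    proof (intro CollectI exI conjI)
      show "q = (x / (c * t)) *\<^sub>R (t *\<^sub>R (c, 0)) + (y / (c * t)) *\<^sub>R (t *\<^sub>R (-c/2, sqrt 3 * c/2))
        + (1 - x / (c * t) - y / (c * t)) *\<^sub>R (t *\<^sub>R (-c/2, - sqrt 3 * c/2))" by (rule q')
      have "(x + y) / (c * t) \<le> 1" using that xy by simp
      then show "0 \<le> 1 - x / (c * t) - y / (c * t)" by (simp add: add_divide_distrib)
    qed (use that xy in auto)
  qed
qed

section \<open>Change of variables in Lebesgue measure\<close>

lemma face_map_vimage_null:
  assumes "E \<in> null_sets lborel"
  shows "face_map c t -` E \<in> null_sets lborel"
proof -
  let ?L = "\<lambda>p::real\<times>real. (3 / 2 * fst p, sqrt 3 * snd p + sqrt 3 / 2 * fst p)"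
  have lin: "linear ?L" by (rule linearI) (auto simp: algebra_simps)
  moreover have "inj ?L" by (rule injI) (auto simp: prod_eq_iff)
  ultimately have "{p. t *\<^sub>R (- c / 2, - sqrt 3 * c / 2) + ?L p \<in> E} \<in> null_sets lborel"
    using assms by (rule null_sets_affine_vimage)
  also have "{p. t *\<^sub>R (- c / 2, - sqrt 3 * c / 2) + ?L p \<in> E} = face_map c t -` E"
    unfolding vimage_def face_map_affine by (simp only: add.commute)
  finally show ?thesis .
qed

text \<open>The linear part is triangular, so one-dimensional substitutions suffice: a factor
  \<open>3 / 2\<close> in the first variable, and \<open>sqrt 3\<close> in the second with the first
  one fixed.\<close>

lemma nn_integral_face_map:
  assumes [measurable]: "f \<in> borel_measurable borel"
  shows "(\<integral>\<^sup>+q. f q \<partial>lborel) = ennreal (3 * sqrt 3 / 2) * (\<integral>\<^sup>+p. f (face_map c t p) \<partial>lborel)"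
proof -
  have m: "(\<lambda>p. f (face_map c t p)) \<in> borel_measurable borel" by measurable
  have "(\<integral>\<^sup>+q. f q \<partial>lborel) = (\<integral>\<^sup>+u. \<integral>\<^sup>+v. f (u, v) \<partial>lborel \<partial>lborel)"
    unfolding lborel_prod[symmetric]
    by (rule lborel.nn_integral_fst[symmetric]) (simp add: borel_prod measurable_cong_sets[OF sets_pair_measure_cong[OF sets_lborel sets_lborel] refl])
  also have "\<dots> = ennreal (3 / 2) * (\<integral>\<^sup>+x. \<integral>\<^sup>+v. f (- c * t / 2 + 3 / 2 * x, v) \<partial>lborel \<partial>lborel)"
    using nn_integral_real_affine[of "\<lambda>u. \<integral>\<^sup>+v. f (u, v) \<partial>lborel" "3 / 2" "- c * t / 2"]
    by (simp add: nn_integral_cmult)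
  also have "\<dots> = ennreal (3 / 2) * (\<integral>\<^sup>+x. ennreal (sqrt 3) *
      (\<integral>\<^sup>+y. f (- c * t / 2 + 3 / 2 * x, sqrt 3 * (x - c * t) / 2 + sqrt 3 * y) \<partial>lborel) \<partial>lborel)"
    by (intro arg_cong2[where f="(*)"] nn_integral_cong refl)
       (subst nn_integral_real_affine[where c="sqrt 3"], auto simp: nn_integral_cmult)
  also have "\<dots> = ennreal (3 / 2) * (ennreal (sqrt 3) * (\<integral>\<^sup>+x. \<integral>\<^sup>+y. f (face_map c t (x, y)) \<partial>lborel \<partial>lborel))"
    by (subst nn_integral_cmult) (auto simp: face_map_def field_simps)
  also have "(\<integral>\<^sup>+x. \<integral>\<^sup>+y. f (face_map c t (x, y)) \<partial>lborel \<partial>lborel) = (\<integral>\<^sup>+p. f (face_map c t p) \<partial>lborel)"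
    unfolding lborel_prod[symmetric]
    by (rule lborel.nn_integral_fst) (use m in \<open>simp add: borel_prod measurable_cong_sets[OF sets_pair_measure_cong[OF sets_lborel sets_lborel] refl]\<close>)
  finally show ?thesis by (simp add: mult.assoc[symmetric] ennreal_mult[symmetric])
qed

text \<open>In this form the change of variables applies to integrands of varying sign as well;
  \<open>p\<close> and \<open>q\<close> are arbitrary versions of densities.\<close>

lemma lborel_face_map:
  "lborel = density (distr lborel borel (face_map_inv c t)) (\<lambda>_. ennreal (2 / (3 * sqrt 3)))"
proof (rule measure_eqI)
  fix X :: "(real \<times> real) set" assume "X \<in> sets lborel"
  then have [measurable]: "X \<in> sets borel" by simp
  have "emeasure (distr lborel borel (face_map_inv c t)) X
      = (\<integral>\<^sup>+q. indicator X (face_map_inv c t q) \<partial>lborel)"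
    using nn_integral_distr[of "face_map_inv c t" lborel borel "indicator X"] by simp
  also have "\<dots> = ennreal (3 * sqrt 3 / 2) * emeasure lborel X"
    by (subst nn_integral_face_map[of _ c t]) auto
  finally show "emeasure lborel X = emeasure (density (distr lborel borel (face_map_inv c t)) (\<lambda>_. ennreal (2 / (3 * sqrt 3)))) X"
    by (subst emeasure_density) (auto simp: nn_integral_cmult mult.assoc[symmetric] ennreal_mult[symmetric])
qed simp

lemma integral_lborel_face_map:
  fixes g :: "real \<times> real \<Rightarrow> real"
  assumes g: "integrable lborel g"
  shows "integrable lborel (\<lambda>p. g (face_map c t p))"
    and "(LINT q|lborel. g q) = 3 * sqrt 3 / 2 * (LINT p|lborel. g (face_map c t p))"
proof -
  have [measurable]: "g \<in> borel_measurable borel" using g by auto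
  have m: "(\<lambda>p. g (face_map c t p)) \<in> borel_measurable borel" by measurable
  have 1: "integrable lborel (\<lambda>p. g (face_map c t p)) \<longleftrightarrow> integrable lborel (\<lambda>p. (2 / (3 * sqrt 3)) *\<^sub>R g p)"
    by (subst (1) lborel_face_map[of c t]) (use m in \<open>simp add: integrable_density integrable_distr_eq\<close>)
  show "integrable lborel (\<lambda>p. g (face_map c t p))" unfolding 1 using g by simp
  have "(LINT p|lborel. g (face_map c t p)) = (LINT p|lborel. (2 / (3 * sqrt 3)) *\<^sub>R g p)"
    by (subst (1) lborel_face_map[of c t]) (use m in \<open>simp add: integral_density integral_distr\<close>)
  then show "(LINT q|lborel. g q) = 3 * sqrt 3 / 2 * (LINT p|lborel. g (face_map c t p))" by simp
qed

text \<open>By continuity, different values at \<open>z\<close> would mean different values in a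
  whole neighbourhood, and nonempty open sets are not null.\<close>

lemma AE_eq_imp_eq_at:
  fixes f g :: "'a::euclidean_space \<Rightarrow> 'b::metric_space"
  assumes ae: "AE x in lborel. x \<in> U \<longrightarrow> f x = g x" and U: "open U" "z \<in> U"
    and cont: "isCont f z" "isCont g z"
  shows "f z = g z"
proof (rule ccontr)
  assume "f z \<noteq> g z"
  then have "0 < dist (f z) (g z)" by simp
  moreover have "isCont (\<lambda>x. dist (f x) (g x)) z" using cont by (intro continuous_intros)
  ultimately have "eventually (\<lambda>x. 0 < dist (f x) (g x)) (at z)"
    unfolding isCont_def by (intro order_tendstoD(1))
  then have "eventually (\<lambda>x. f x \<noteq> g x) (nhds z)"
    using \<open>f z \<noteq> g z\<close> by (simp add: eventually_nhds_conv_at)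
  then have "eventually (\<lambda>x. x \<in> U \<and> f x \<noteq> g x) (nhds z)"
    using eventually_nhds_in_open[OF U] by eventually_elim auto
  then obtain S where S: "open S" "z \<in> S" "\<And>x. x \<in> S \<Longrightarrow> x \<in> U \<and> f x \<noteq> g x"
    by (auto simp: eventually_nhds)
  have "AE x in lborel. x \<notin> S" using ae by eventually_elim (use S in auto)
  then have "S \<in> null_sets lborel" using S by (simp add: AE_iff_null_sets)
  then have "negligible S" by (simp add: negligible_iff_null_sets null_sets_completionI)
  then show False using S open_not_negligible by blast
qed

section \<open>The law on the face\<close>

definition coordinate_sum :: "real \<times> real \<times> real \<Rightarrow> real" where
  "coordinate_sum d = fst d + fst (snd d) + snd (snd d)"

lemma bounded_linear_coordinate_sum: "bounded_linear coordinate_sum"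
  unfolding coordinate_sum_def
  by (intro bounded_linear_add bounded_linear_fst_comp bounded_linear_snd_comp bounded_linear_fst
      bounded_linear_snd bounded_linear_compose[OF bounded_linear_fst bounded_linear_snd]
      bounded_linear_compose[OF bounded_linear_snd bounded_linear_snd])

lemma bounded_linear_face_velocity: "bounded_linear (face_velocity c)"
  unfolding face_velocity_def
  by (intro bounded_linear_Pair bounded_linear_const_mult bounded_linear_fst
      bounded_linear_compose[OF bounded_linear_fst bounded_linear_snd])

lemma coordinate_sum_axis:
  assumes "d \<in> axis_directions"
  shows "d \<in> face_directions \<Longrightarrow> coordinate_sum d = 1" "d \<notin> face_directions \<Longrightarrow> coordinate_sum d = -1"
  using assms unfolding axis_directions_def
  by (elim insertE emptyE; simp add: face_directions_def coordinate_sum_def)+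

context poisson_counting
begin

text \<open>An index that a jump skips, or that is reached only at time \<open>t\<close>, would
  belong to a direction that leaves no trace in the position. Both have probability 0.\<close>

lemma AE_all_values_attained:
  assumes t: "0 < t"
  shows "AE \<omega> in M. \<forall>k\<le>N t \<omega>. \<exists>u. 0 \<le> u \<and> u < t \<and> N u \<omega> = k"
  using AE_simple_jumps[OF t] AE_no_jump_at[OF t] AE_space
proof eventually_elim
  case (elim \<omega>)
  show ?case
  proof (intro allI impI)
    fix k assume k: "k \<le> N t \<omega>"
    obtain m :: nat where m: "0 < m" "\<And>i. i < m \<Longrightarrow> N (real (Suc i) * (t / m)) \<omega> \<le> N (real i * (t / m)) \<omega> + 1"
      using elim(1) by blast
    show "\<exists>u. 0 \<le> u \<and> u < t \<and> N u \<omega> = k"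
    proof (cases "k = N t \<omega>")
      case False
      then have "\<exists>a<m. N (real a * (t / m)) \<omega> = k \<and> N (real (Suc a) * (t / m)) \<omega> = Suc k"
        using m k N_0[OF elim(3)] by (intro unit_steps_hit) auto
      then obtain a where a: "a < m" "N (real a * (t / m)) \<omega> = k" by blast
      have "real a * (t / m) < real m * (t / m)" using a m t by (intro mult_strict_right_mono) auto
      then show ?thesis using a t m by (intro exI[of _ "real a * (t / m)"]) auto
    qed (use elim(2) in blast)
  qed
qed

text \<open>The coordinate sum is 1 for face directions and -1 for the others. By right-continuity a
  direction attained before \<open>t\<close> is kept for a positive time, and each unit of time in a
  direction of the second kind lowers the integral by 2.\<close>

lemma integral_coordinate_sum_eq_iff:
  assumes t: "0 < t" and \<omega>: "\<omega> \<in> space M" and v: "\<And>k. v k \<in> axis_directions"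
    and hit: "\<forall>k\<le>N t \<omega>. \<exists>u. 0 \<le> u \<and> u < t \<and> N u \<omega> = k"
  shows "integral {0..t} (\<lambda>s. coordinate_sum (v (N s \<omega>))) = t \<longleftrightarrow> (\<forall>k\<le>N t \<omega>. v k \<in> face_directions)"
proof
  let ?I = "integral {0..t} (\<lambda>s. coordinate_sum (v (N s \<omega>)))"
  note P = counting_path_N[OF \<omega>]
  assume eq: "?I = t"
  show "\<forall>k\<le>N t \<omega>. v k \<in> face_directions"
  proof (rule ccontr)
    assume "\<not> ?thesis"
    then obtain k where k: "k \<le> N t \<omega>" "v k \<notin> face_directions" by auto
    obtain u where u: "0 \<le> u" "u < t" "N u \<omega> = k" using hit k by blast
    obtain e where e: "e > 0" "\<And>s. u \<le> s \<Longrightarrow> s \<le> u + e \<Longrightarrow> N s \<omega> = N u \<omega>"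
      using counting_path_right_constant[OF P u(1)] by metis
    define b where "b = min t (u + e)"
    have b: "u < b" "b \<le> t" "b \<le> u + e" using u e(1) by (auto simp: b_def)
    let ?f = "\<lambda>s. 1 - coordinate_sum (v (N s \<omega>))"
    have int: "?f integrable_on {a..c}" if "0 \<le> a" for a c
      using counting_path_integrable_on[OF P that, of "\<lambda>k. 1 - coordinate_sum (v k)"] .
    have nn: "0 \<le> ?f s" for s
      using coordinate_sum_axis[OF v[of "N s \<omega>"]] by (cases "v (N s \<omega>) \<in> face_directions") auto
    have "2 * (b - u) = integral {u..b} (\<lambda>s. 2)" using b by simp
    also have "\<dots> = integral {u..b} ?f"
    proof (rule Henstock_Kurzweil_Integration.integral_cong)
      fix s assume "s \<in> {u..b}"
      then have "N s \<omega> = k" using e(2)[of s] b u by simp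
      then show "2 = ?f s" using coordinate_sum_axis(2)[OF v k(2)] by simp
    qed
    also have "\<dots> \<le> integral {0..t} ?f"
      by (rule integral_subset_le) (use b u nn int in auto)
    also have "\<dots> = t - ?I"
      using t counting_path_integrable_on[OF P, of 0 "\<lambda>k. coordinate_sum (v k)" t]
      by (subst Henstock_Kurzweil_Integration.integral_diff) auto
    finally show False using eq b by simp
  qed
next
  assume all: "\<forall>k\<le>N t \<omega>. v k \<in> face_directions"
  have "integral {0..t} (\<lambda>s. coordinate_sum (v (N s \<omega>))) = integral {0..t} (\<lambda>s. 1)"
  proof (rule Henstock_Kurzweil_Integration.integral_cong)
    fix s assume "s \<in> {0..t}"
    then have "N s \<omega> \<le> N t \<omega>" using N_mono[OF \<omega>, of s t] by auto
    then show "coordinate_sum (v (N s \<omega>)) = 1" using all coordinate_sum_axis(1)[OF v] by simp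
  qed
  then show "integral {0..t} (\<lambda>s. coordinate_sum (v (N s \<omega>))) = t" using t by simp
qed

end

locale motion = poisson_counting M lam N for M :: "'a measure" and lam N +
  fixes S :: "'v::euclidean_space set" and K and V :: "nat \<Rightarrow> 'a \<Rightarrow> 'v"
  assumes chain: "uniform_chain M S K V" and finite_S: "finite S"
    and indep: "indep_set (sets (vimage_algebra (space M) (\<lambda>\<omega>. \<lambda>n\<in>UNIV. V n \<omega>) (\<Pi>\<^sub>M n\<in>UNIV. borel)))
       (sets (vimage_algebra (space M) (\<lambda>\<omega>. \<lambda>t\<in>{0..}. N t \<omega>) (\<Pi>\<^sub>M t\<in>{0..}. count_space UNIV)))"
begin

lemma V_in: "\<omega> \<in> space M \<Longrightarrow> V n \<omega> \<in> S"
  using chain by (simp add: uniform_chain_def)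

lemma V_measurable: "V n \<in> borel_measurable M"
  using chain by (simp add: uniform_chain_def)

text \<open>This is \<open>direction_sums\<close> for the whole state space, where its condition on
  the directions always holds.\<close>

lemma path_integral_measurable:
  fixes g :: "'v \<Rightarrow> 'b::euclidean_space"
  assumes "0 < t"
  shows "(\<lambda>\<omega>. integral {0..t} (\<lambda>s. g (V (N s \<omega>) \<omega>))) \<in> borel_measurable M"
proof (rule measurableI)
  fix B :: "'b set" assume B: "B \<in> sets borel"
  have "{\<omega>\<in>space M. (\<forall>i\<le>N t \<omega>. V i \<omega> \<in> S) \<and> integral {0..t} (\<lambda>s. g (V (N s \<omega>) \<omega>)) \<in> B} \<in> events"
    by (rule direction_sums(1)[OF V_measurable indep finite_S assms B])
  also have "{\<omega>\<in>space M. (\<forall>i\<le>N t \<omega>. V i \<omega> \<in> S) \<and> integral {0..t} (\<lambda>s. g (V (N s \<omega>) \<omega>)) \<in> B}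
      = (\<lambda>\<omega>. integral {0..t} (\<lambda>s. g (V (N s \<omega>) \<omega>))) -` B \<inter> space M"
    using V_in by auto
  finally show "(\<lambda>\<omega>. integral {0..t} (\<lambda>s. g (V (N s \<omega>) \<omega>))) -` B \<inter> space M \<in> events" .
qed simp

lemma set_lebesgue_integral_path:
  assumes "\<omega> \<in> space M" "0 < t"
  shows "(LINT s:{0..t}|lborel. V (N s \<omega>) \<omega>) = integral {0..t} (\<lambda>s. V (N s \<omega>) \<omega>)"
  by (rule set_borel_integral_eq_integral(2)[OF set_integrable_counting_path[OF counting_path_N[OF assms(1)]]]) simp

lemma integral_linear_path:
  assumes "\<omega> \<in> space M" "0 < t" "bounded_linear h"
  shows "integral {0..t} (\<lambda>s. h (V (N s \<omega>) \<omega>)) = h (integral {0..t} (\<lambda>s. V (N s \<omega>) \<omega>))"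
  using integral_linear[OF counting_path_integrable_on[OF counting_path_N[OF assms(1)], of 0 "\<lambda>k. V k \<omega>" t] assms(3)]
  by (simp add: o_def)

end

lemma direction_process_motion:
  assumes "direction_process M lam S K D" "prob_space M" "finite S"
    and "\<And>s. 0 < s \<Longrightarrow> 0 < lam s" "\<And>s. 0 < s \<Longrightarrow> set_integrable lborel {0<..s} lam" "continuous_on {0<..} lam"
  obtains N V where "motion M lam N S K V" "\<And>t \<omega>. 0 \<le> t \<Longrightarrow> \<omega> \<in> space M \<Longrightarrow> D t \<omega> = V (N t \<omega>) \<omega>"
proof -
  interpret prob_space M by fact
  show thesis
    using assms that unfolding direction_process_def
    by (auto simp: motion_def motion_axioms_def poisson_counting_def poisson_counting_axioms_def)
qed

locale face_motion = motion M lam N axis_directions K V for M :: "'a measure" and lam N K V +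
  fixes c t :: real and W :: "real \<Rightarrow> 'a \<Rightarrow> real \<times> real \<times> real"
  assumes c: "0 < c" and t: "0 < t"
    and W: "\<And>\<omega>. \<omega> \<in> space M \<Longrightarrow> W t \<omega> = c *\<^sub>R integral {0..t} (\<lambda>s. V (N s \<omega>) \<omega>)"
begin

definition face_event :: "(real \<times> real) set \<Rightarrow> 'a set" where
  "face_event B = {\<omega>\<in>space M. case W t \<omega> of (x, y, z) \<Rightarrow> (x, y) \<in> B \<and> x + y + z = c * t}"

lemma face_event_eq:
  "face_event B = {\<omega>\<in>space M. (fst (W t \<omega>), fst (snd (W t \<omega>))) \<in> B \<and> coordinate_sum (W t \<omega>) = c * t}"
  by (simp add: face_event_def coordinate_sum_def case_prod_beta')

lemma W_measurable: "W t \<in> borel_measurable M"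
proof -
  have "(\<lambda>\<omega>. c *\<^sub>R integral {0..t} (\<lambda>s. id (V (N s \<omega>) \<omega>))) \<in> borel_measurable M"
    by (intro borel_measurable_scaleR borel_measurable_const path_integral_measurable t)
  then show ?thesis by (subst measurable_cong[OF W]) auto
qed

lemma face_event_measurable [measurable]:
  assumes "B \<in> sets borel"
  shows "face_event B \<in> events"
proof -
  have 1: "(\<lambda>p. (fst p, fst (snd p))) \<in> borel_measurable (borel :: (real \<times> real \<times> real) measure)"
    by (intro borel_measurable_continuous_onI continuous_intros)
  have 2: "coordinate_sum \<in> borel_measurable borel"
    by (intro borel_measurable_continuous_onI linear_continuous_on bounded_linear_coordinate_sum)
  have "(\<lambda>p. (fst p, fst (snd p))) -` B \<inter> coordinate_sum -` {c * t} \<in> sets borel"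
    by (rule sets.Int[OF measurable_sets_borel[OF 1 assms] measurable_sets_borel[OF 2]]) simp
  from measurable_sets[OF W_measurable this] show ?thesis
    by (rule back_subst[where P="\<lambda>A. A \<in> events"])
       (auto simp: face_event_eq)
qed

text \<open>Linear maps commute with the path integral: the coordinate sum decides which directions
  occurred, and the projection \<open>face_velocity\<close> yields the first two
  coordinates.\<close>

lemma prob_face_event:
  assumes B: "B \<in> sets borel"
  shows "prob (face_event B) = prob {\<omega>\<in>space M. (\<forall>i\<le>N t \<omega>. V i \<omega> \<in> face_directions)
     \<and> integral {0..t} (\<lambda>s. face_velocity c (V (N s \<omega>) \<omega>)) \<in> B}" (is "_ = prob ?R")
proof (rule finite_measure_eq_AE)
  show "AE \<omega> in M. \<omega> \<in> face_event B \<longleftrightarrow> \<omega> \<in> ?R"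
    using AE_all_values_attained[OF t] AE_space
  proof eventually_elim
    case (elim \<omega>)
    let ?I = "integral {0..t} (\<lambda>s. V (N s \<omega>) \<omega>)"
    have "\<omega> \<in> face_event B \<longleftrightarrow> face_velocity c ?I \<in> B \<and> c * coordinate_sum ?I = c * t"
      using elim(2) by (auto simp: face_event_eq W face_velocity_def coordinate_sum_def algebra_simps)
    also have "c * coordinate_sum ?I = c * t \<longleftrightarrow> integral {0..t} (\<lambda>s. coordinate_sum (V (N s \<omega>) \<omega>)) = t"
      using c integral_linear_path[OF elim(2) t bounded_linear_coordinate_sum] by simp
    also have "\<dots> \<longleftrightarrow> (\<forall>i\<le>N t \<omega>. V i \<omega> \<in> face_directions)"
      using integral_coordinate_sum_eq_iff[OF t elim(2) _ elim(1), of "\<lambda>k. V k \<omega>"] V_in[OF elim(2)] by simp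
    also have "face_velocity c ?I = integral {0..t} (\<lambda>s. face_velocity c (V (N s \<omega>) \<omega>))"
      using integral_linear_path[OF elim(2) t bounded_linear_face_velocity] by simp
    finally show ?case using elim(2) by auto
  qed
  show "?R \<in> events"
    by (rule direction_sums(1)[OF V_measurable indep _ t B]) (simp add: face_directions_def)
qed (use B in measurable)

lemma face_sums:
  assumes B: "B \<in> sets borel"
  shows "(\<lambda>n. \<Sum>v\<in>PiE {..n} (\<lambda>_. face_directions). prob {\<omega>\<in>space M. \<forall>i\<le>n. V i \<omega> = v i}
        * prob {\<omega>\<in>space M. integral {0..t} (\<lambda>s. face_velocity c (v (N s \<omega>))) \<in> B \<and> N t \<omega> = n})
    sums prob (face_event B)"
  unfolding prob_face_event[OF B]
  by (rule direction_sums(2)[OF V_measurable indep _ t B]) (simp add: face_directions_def)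

text \<open>For each sequence of directions there are two cases. If two differences of successive
  projected velocities are linearly independent, \<open>AE_integral_notin_null\<close> applies.
  Otherwise all velocities used lie on one line, so one of the three directions is missing; then one
  of the three coordinates of the position vanishes, which the open face excludes.\<close>

lemma face_event_null:
  assumes B: "B \<in> null_sets lborel" "B \<subseteq> face_region c t"
  shows "prob (face_event B) = 0"
proof -
  have Bm: "B \<in> sets borel" using B by auto
  have "prob {\<omega>\<in>space M. integral {0..t} (\<lambda>s. face_velocity c (v (N s \<omega>))) \<in> B \<and> N t \<omega> = n} = 0"
    if v: "v \<in> PiE {..n} (\<lambda>_. face_directions)" for n v
  proof -
    define w where "w = (\<lambda>k. face_velocity c (v k))"
    have "AE \<omega> in M. N t \<omega> = n \<longrightarrow> integral {0..t} (\<lambda>s. w (N s \<omega>)) \<notin> B"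
    proof (cases "\<exists>i<n. \<exists>j<n. fst (w i - w (Suc i)) * snd (w j - w (Suc j)) \<noteq> snd (w i - w (Suc i)) * fst (w j - w (Suc j))")
      case True
      then show ?thesis using AE_integral_notin_null[OF t _ _ B(1), of _ n _ w] by blast
    next
      case False
      then have par: "fst (w i - w (Suc i)) * snd (w j - w (Suc j)) = snd (w i - w (Suc i)) * fst (w j - w (Suc j))"
        if "i < n" "j < n" for i j using that by blast
      have miss: "\<exists>d\<in>face_directions. \<forall>k\<le>n. v k \<noteq> d"
      proof (rule ccontr)
        assume "\<not> ?thesis"
        then have ex: "\<exists>k\<le>n. v k = d" if "d \<in> face_directions" for d using that by blast
        obtain k0 where k0: "k0 \<le> n" "v k0 = (1, 0, 0)" using ex[of "(1, 0, 0)"] by (auto simp: face_directions_def)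
        obtain k1 where k1: "k1 \<le> n" "v k1 = (0, 1, 0)" using ex[of "(0, 1, 0)"] by (auto simp: face_directions_def)
        obtain k2 where k2: "k2 \<le> n" "v k2 = (0, 0, 1)" using ex[of "(0, 0, 1)"] by (auto simp: face_directions_def)
        \<comment> \<open>The determinant is bilinear and differences from \<open>w 0\<close> are
          sums of successive ones, so two inductions extend parallelism to them. Chaining parallel
          vectors instead would fail at a zero difference.\<close>
        have cross: "fst (w 0 - w a) * snd (w 0 - w b) = snd (w 0 - w a) * fst (w 0 - w b)" if "a \<le> n" "b \<le> n" for a b
        proof -
          have 1: "fst (w i - w (Suc i)) * snd (w 0 - w b) = snd (w i - w (Suc i)) * fst (w 0 - w b)" if "i < n" "b \<le> n" for i b
            using that(2)
          proof (induction b)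
            case (Suc b)
            have "fst (w i - w (Suc i)) * snd (w 0 - w b) = snd (w i - w (Suc i)) * fst (w 0 - w b)"
              using Suc by simp
            moreover have "fst (w i - w (Suc i)) * snd (w b - w (Suc b)) = snd (w i - w (Suc i)) * fst (w b - w (Suc b))"
              using par[OF that(1), of b] Suc by simp
            ultimately show ?case unfolding fst_diff snd_diff by algebra
          qed simp
          show ?thesis using that(1)
          proof (induction a)
            case (Suc a)
            have "fst (w 0 - w a) * snd (w 0 - w b) = snd (w 0 - w a) * fst (w 0 - w b)"
              using Suc by simp
            moreover have "fst (w a - w (Suc a)) * snd (w 0 - w b) = snd (w a - w (Suc a)) * fst (w 0 - w b)"
              using 1[of a b] that(2) Suc by simp
            ultimately show ?case unfolding fst_diff snd_diff by algebra
          qed simp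
        qed
        obtain x y where w0: "w 0 = (x, y)" by force
        have w: "w k0 = (c, 0)" "w k1 = (0, c)" "w k2 = (0, 0)"
          using k0 k1 k2 by (auto simp: w_def face_velocity_def)
        \<comment> \<open>Any two of the points \<open>(c, 0)\<close>, \<open>(0, c)\<close> and
          \<open>(0, 0)\<close> would be collinear with \<open>w 0\<close>, which forces
          \<open>c = 0\<close>.\<close>
        have "(x - c) * (y - c) = y * x" "(x - c) * y = y * x" "x * y = (y - c) * x"
          using cross[OF k0(1) k1(1)] cross[OF k0(1) k2(1)] cross[OF k1(1) k2(1)] unfolding w w0 by simp_all
        then have "c * c = 0" by algebra
        then show False using c by simp
      qed
      show ?thesis using AE_space
      proof (eventually_elim, intro impI notI)
        fix \<omega> assume \<omega>: "\<omega> \<in> space M" and n: "N t \<omega> = n" and I: "integral {0..t} (\<lambda>s. w (N s \<omega>)) \<in> B"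
        note P = counting_path_N[OF \<omega>]
        have v': "v (N s \<omega>) \<in> face_directions" "N s \<omega> \<le> n" if "s \<in> {0..t}" for s
          using N_mono[OF \<omega>, of s t] that n v by (auto intro: PiE_mem)
        have int: "(\<lambda>s. f (v (N s \<omega>))) integrable_on {0..t}" for f :: "real \<times> real \<times> real \<Rightarrow> real"
          using counting_path_integrable_on[OF P, of 0 "\<lambda>k. f (v k)" t] by simp
        have wi: "(\<lambda>s. w (N s \<omega>)) integrable_on {0..t}" using counting_path_integrable_on[OF P, of 0 w t] by simp
        define X where "X = integral {0..t} (\<lambda>s. c * fst (v (N s \<omega>)))"
        define Y where "Y = integral {0..t} (\<lambda>s. c * fst (snd (v (N s \<omega>))))"
        define Z where "Z = integral {0..t} (\<lambda>s. c * snd (snd (v (N s \<omega>))))"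
        have "integral {0..t} (\<lambda>s. w (N s \<omega>)) = (X, Y)"
          using integral_linear[OF wi bounded_linear_fst] integral_linear[OF wi bounded_linear_snd]
          by (simp add: X_def Y_def w_def o_def face_velocity_def prod_eq_iff)
        then have XY: "0 < X" "0 < Y" "X + Y < c * t" using I B(2) by (auto simp: face_region_def)
        have "X + Y + Z = integral {0..t} (\<lambda>s. c * fst (v (N s \<omega>)) + c * fst (snd (v (N s \<omega>))) + c * snd (snd (v (N s \<omega>))))"
          unfolding X_def Y_def Z_def
          using int[of "\<lambda>d. c * fst d"] int[of "\<lambda>d. c * fst (snd d)"] int[of "\<lambda>d. c * snd (snd d)"]
          by (simp add: Henstock_Kurzweil_Integration.integral_add integrable_add)
        also have "\<dots> = integral {0..t} (\<lambda>s. c)"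
          by (rule Henstock_Kurzweil_Integration.integral_cong) (use v'(1) in \<open>fastforce simp: face_directions_def\<close>)
        finally have Z: "X + Y + Z = c * t" using t by simp
        have zero: "integral {0..t} (\<lambda>s. c * f (v (N s \<omega>))) = 0"
          if "d0 \<notin> v ` {..n}" "\<And>d. d \<in> face_directions \<Longrightarrow> d \<noteq> d0 \<Longrightarrow> f d = 0" for d0 and f :: "real \<times> real \<times> real \<Rightarrow> real"
        proof -
          have "f (v (N s \<omega>)) = 0" if s: "s \<in> {0..t}" for s
            using v'[OF s] \<open>d0 \<notin> v ` {..n}\<close> by (intro \<open>\<And>d. d \<in> face_directions \<Longrightarrow> d \<noteq> d0 \<Longrightarrow> f d = 0\<close>) auto
          then have "integral {0..t} (\<lambda>s. c * f (v (N s \<omega>))) = integral {0..t} (\<lambda>s. 0)"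
            by (intro Henstock_Kurzweil_Integration.integral_cong) simp
          then show ?thesis by simp
        qed
        obtain d where "d \<in> face_directions" and d: "d \<notin> v ` {..n}" using miss by blast
        then have "d = (1, 0, 0) \<or> d = (0, 1, 0) \<or> d = (0, 0, 1)" by (simp add: face_directions_def)
        with d consider "(1, 0, 0) \<notin> v ` {..n}" | "(0, 1, 0) \<notin> v ` {..n}" | "(0, 0, 1) \<notin> v ` {..n}"
          by metis
        then have "X = 0 \<or> Y = 0 \<or> Z = 0"
        proof cases
          case 1
          then have "X = 0" unfolding X_def by (rule zero) (auto simp: face_directions_def)
          then show ?thesis by simp
        next
          case 2
          then have "Y = 0" unfolding Y_def by (rule zero) (auto simp: face_directions_def)
          then show ?thesis by simp
        next
          case 3
          then have "Z = 0" unfolding Z_def by (rule zero) (auto simp: face_directions_def)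
          then show ?thesis by simp
        qed
        then show False using XY Z by auto
      qed
    qed
    then have "AE \<omega> in M. \<not> (integral {0..t} (\<lambda>s. w (N s \<omega>)) \<in> B \<and> N t \<omega> = n)"
      by eventually_elim auto
    then obtain Z where Z: "{\<omega>\<in>space M. integral {0..t} (\<lambda>s. w (N s \<omega>)) \<in> B \<and> N t \<omega> = n} \<subseteq> Z" "Z \<in> null_sets M"
      by (elim AE_E) (auto simp: null_sets_def)
    then have "prob {\<omega>\<in>space M. integral {0..t} (\<lambda>s. w (N s \<omega>)) \<in> B \<and> N t \<omega> = n} \<le> prob Z"
      by (intro finite_measure_mono) auto
    also have "prob Z = 0" using Z(2) by (simp add: measure_eq_0_null_sets)
    finally show ?thesis using measure_nonneg[of M] by (simp add: w_def order_antisym)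
  qed
  then have "(\<lambda>n. 0 :: real) sums prob (face_event B)"
    using face_sums[OF Bm] by (simp cong: sum.cong)
  then show ?thesis by (simp add: sums_iff)
qed

text \<open>Radon-Nikodym for the law of the first two coordinates restricted to the face event;
  \<open>face_event_null\<close> provides absolute continuity.\<close>

lemma ex_face_density: "\<exists>p. is_face_density M c W t p"
proof -
  let ?F = "face_region c t"
  have F [measurable]: "?F \<in> sets borel" by (rule borel_open[OF open_face_region])
  define X where "X = (\<lambda>\<omega>. (fst (W t \<omega>), fst (snd (W t \<omega>))))"
  have X [measurable]: "X \<in> borel_measurable M"
    unfolding X_def
    by (rule measurable_compose[OF W_measurable])
       (intro borel_measurable_continuous_onI continuous_intros)
  define \<mu> where "\<mu> = distr (density M (indicator (face_event ?F))) borel X"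
  have sets\<mu> [simp]: "sets \<mu> = sets borel" "space \<mu> = UNIV" by (auto simp: \<mu>_def)
  have em: "emeasure \<mu> B = ennreal (prob (face_event (B \<inter> ?F)))" if [measurable]: "B \<in> sets borel" for B
  proof -
    have "emeasure \<mu> B = emeasure (density M (indicator (face_event ?F))) (X -` B \<inter> space M)"
      unfolding \<mu>_def by (subst emeasure_distr) auto
    also have "\<dots> = (\<integral>\<^sup>+\<omega>. indicator (face_event ?F) \<omega> * indicator (X -` B \<inter> space M) \<omega> \<partial>M)"
      by (subst emeasure_density) auto
    also have "\<dots> = (\<integral>\<^sup>+\<omega>. indicator (face_event (B \<inter> ?F)) \<omega> \<partial>M)"
      by (intro nn_integral_cong) (auto simp: indicator_def face_event_eq X_def)
    finally show ?thesis by (simp add: emeasure_eq_measure)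
  qed
  have "absolutely_continuous lborel \<mu>"
    unfolding absolutely_continuous_def
  proof
    fix B :: "(real \<times> real) set" assume B: "B \<in> null_sets lborel"
    then have "B \<inter> ?F \<in> null_sets lborel" by (intro null_set_Int2) auto
    then have "prob (face_event (B \<inter> ?F)) = 0" by (rule face_event_null) auto
    then show "B \<in> null_sets \<mu>" using B em[of B] by (intro null_setsI) auto
  qed
  then obtain f where f [measurable]: "f \<in> borel_measurable lborel" and d: "density lborel f = \<mu>"
    using sigma_finite_measure.Radon_Nikodym[OF sigma_finite_lborel, of \<mu>] by auto
  have nf: "(\<integral>\<^sup>+x. f x * indicator B x \<partial>lborel) = ennreal (prob (face_event (B \<inter> ?F)))" if "B \<in> sets borel" for B
    using em[OF that] that unfolding d[symmetric] by (subst (asm) emeasure_density) auto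
  have "(\<integral>\<^sup>+x. f x \<partial>lborel) < \<infinity>" using nf[of UNIV] by simp
  then have fin: "AE x in lborel. f x < \<infinity>"
    using nn_integral_PInf_AE[OF f] by (auto simp: less_top)
  define p where "p = (\<lambda>x. enn2real (f x))"
  have p [measurable]: "p \<in> borel_measurable lborel" unfolding p_def by measurable
  have pf: "AE x in lborel. ennreal (p x) = f x"
    using fin by eventually_elim (simp add: p_def)
  have nn: "(\<integral>\<^sup>+x. ennreal (indicator B x *\<^sub>R p x) \<partial>lborel) = ennreal (prob (face_event (B \<inter> ?F)))"
    if B: "B \<in> sets borel" for B
  proof -
    have "(\<integral>\<^sup>+x. ennreal (indicator B x *\<^sub>R p x) \<partial>lborel) = (\<integral>\<^sup>+x. f x * indicator B x \<partial>lborel)"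
      by (rule nn_integral_cong_AE) (use pf in \<open>eventually_elim, auto simp: indicator_def\<close>)
    then show ?thesis using nf[OF B] by simp
  qed
  have p0: "0 \<le> p x" for x by (simp add: p_def)
  have int: "set_integrable lborel ?F p"
    unfolding set_integrable_def
    by (rule integrableI_nonneg) (use nn[OF F] p0 in auto)
  have "is_face_density M c W t (\<lambda>x y. p (x, y))"
    unfolding is_face_density_def
  proof (intro conjI ballI impI)
    show "set_integrable lborel ?F (\<lambda>(x, y). p (x, y))" using int by (simp add: case_prod_eta)
    fix B :: "(real \<times> real) set" assume B: "B \<in> sets borel" "B \<subseteq> ?F"
    have "(LINT (x, y):B|lborel. p (x, y)) = (LINT x|lborel. indicator B x *\<^sub>R p x)"
      by (simp add: set_lebesgue_integral_def case_prod_beta')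
    also have "\<dots> = enn2real (\<integral>\<^sup>+x. ennreal (indicator B x *\<^sub>R p x) \<partial>lborel)"
      by (rule integral_eq_nn_integral) (use B p0 in auto)
    also have "\<dots> = prob (face_event B)" using nn[OF B(1)] B(2) by (simp add: Int_absorb2)
    finally show "prob {\<omega>\<in>space M. case W t \<omega> of (x, y, z) \<Rightarrow> (x, y) \<in> B \<and> x + y + z = c * t}
        = (LINT (x, y):B|lborel. p (x, y))" by (simp add: face_event_def)
  qed
  then show ?thesis by blast
qed

end

section \<open>Comparison of the two laws\<close>

text \<open>Both probabilities are series over the number of events and the direction sequences,
  which \<open>face_map\<close> matches bijectively. The quotient of matching terms is the same for
  all \<open>n\<close>, so the series are compared term by term.\<close>

lemma face_law_eq:
  assumes FM: "face_motion M lam N K V c t W"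
    and PM: "motion M' (\<lambda>s. lam s / 2) N' (planar_velocities c) K' V'"
    and W': "\<And>\<omega>. \<omega> \<in> space M' \<Longrightarrow> W' t \<omega> = integral {0..t} (\<lambda>s. V' (N' s \<omega>) \<omega>)"
    and init: "\<And>d. d \<in> face_directions \<Longrightarrow> pmf (pmf_of_set axis_directions) d
        = pmf (pmf_of_set (planar_velocities c)) (face_map c 1 (face_velocity c d)) / 2"
    and step: "\<And>d e. d \<in> face_directions \<Longrightarrow> e \<in> face_directions \<Longrightarrow> pmf (pmf_of_set (K d)) e
        = pmf (pmf_of_set (K' (face_map c 1 (face_velocity c d)))) (face_map c 1 (face_velocity c e)) / 2"
    and B: "B \<in> sets borel"
  shows "measure M (face_motion.face_event M c t W B)
    = exp (- cumulative_rate lam t / 2) / 2 * measure M' {\<omega>\<in>space M'. W' t \<omega> \<in> face_map c t ` B}"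
proof -
  interpret F: face_motion M lam N K V c t W by fact
  interpret P: motion M' "\<lambda>s. lam s / 2" N' "planar_velocities c" K' V' by fact
  let ?F = "face_directions" and ?\<phi> = "\<lambda>d. face_map c 1 (face_velocity c d)"
  define \<kappa> where "\<kappa> = exp (- cumulative_rate lam t / 2) / 2"
  have finF: "finite ?F" by (simp add: face_directions_def)
  have im: "face_map c t ` B = face_map_inv c t -` B"
    by (auto simp: image_iff) (metis face_map_inverse(2))
  have B': "face_map c t ` B \<in> sets borel" unfolding im by (rule measurable_sets_borel[OF face_map_measurable(2) B])
  \<comment> \<open>Translates a sequence of face directions into planar velocities; the restriction
    keeps it extensional, as the index set of the planar series demands.\<close>
  define r where "r = (\<lambda>n v. restrict (\<lambda>i. ?\<phi> (v i)) {..n::nat})"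
  define f where "f = (\<lambda>n v. P.prob {\<omega>\<in>space M'. \<forall>i\<le>n. V' i \<omega> = v i}
      * P.prob {\<omega>\<in>space M'. integral {0..t} (\<lambda>s. v (N' s \<omega>)) \<in> face_map c t ` B \<and> N' t \<omega> = n})"
  have summand: "F.prob {\<omega>\<in>space M. \<forall>i\<le>n. V i \<omega> = v i}
      * F.prob {\<omega>\<in>space M. integral {0..t} (\<lambda>s. face_velocity c (v (N s \<omega>))) \<in> B \<and> N t \<omega> = n} = \<kappa> * f n (r n v)"
    if v: "v \<in> PiE {..n} (\<lambda>_. ?F)" for n v
  proof -
    have vF: "v i \<in> ?F" if "i \<le> n" for i using v that by auto
    have "F.prob {\<omega>\<in>space M. \<forall>i\<le>n. V i \<omega> = v i}
        = pmf (pmf_of_set (planar_velocities c)) (?\<phi> (v 0)) / 2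
          * (\<Prod>i<n. pmf (pmf_of_set (K' (?\<phi> (v i)))) (?\<phi> (v (Suc i))) / 2)"
      unfolding uniform_chain_prob[OF F.chain] by (intro arg_cong2[where f="(*)"] init prod.cong refl step vF) auto
    also have "\<dots> = P.prob {\<omega>\<in>space M'. \<forall>i\<le>n. V' i \<omega> = r n v i} / 2 ^ Suc n"
      unfolding uniform_chain_prob[OF P.chain] by (simp add: r_def prod_dividef)
    finally have 1: "F.prob {\<omega>\<in>space M. \<forall>i\<le>n. V i \<omega> = v i}
        = P.prob {\<omega>\<in>space M'. \<forall>i\<le>n. V' i \<omega> = r n v i} / 2 ^ Suc n" .
    have "integral {0..t} (\<lambda>s. r n v (N' s \<omega>)) \<in> face_map c t ` B
        \<longleftrightarrow> integral {0..t} (\<lambda>s. face_velocity c (v (N' s \<omega>))) \<in> B"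
      if \<omega>: "\<omega> \<in> space M'" and n: "N' t \<omega> = n" for \<omega>
    proof -
      have "integral {0..t} (\<lambda>s. r n v (N' s \<omega>)) = integral {0..t} (\<lambda>s. ?\<phi> (v (N' s \<omega>)))"
        by (rule Henstock_Kurzweil_Integration.integral_cong)
           (use P.N_mono[OF \<omega>, of _ t] n in \<open>auto simp: r_def\<close>)
      also have "\<dots> = face_map c t (integral {0..t} (\<lambda>s. face_velocity c (v (N' s \<omega>))))"
        using counting_path_integrable_on[OF P.counting_path_N[OF \<omega>], of 0 "\<lambda>k. face_velocity c (v k)"] F.t
        by (intro integral_face_map) auto
      finally show ?thesis unfolding im by simp
    qed
    then have "{\<omega>\<in>space M'. integral {0..t} (\<lambda>s. r n v (N' s \<omega>)) \<in> face_map c t ` B \<and> N' t \<omega> = n}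
        = {\<omega>\<in>space M'. integral {0..t} (\<lambda>s. face_velocity c (v (N' s \<omega>))) \<in> B \<and> N' t \<omega> = n}" by blast
    then have 2: "F.prob {\<omega>\<in>space M. integral {0..t} (\<lambda>s. face_velocity c (v (N s \<omega>))) \<in> B \<and> N t \<omega> = n}
      = 2 ^ n * exp (- cumulative_rate lam t / 2)
        * P.prob {\<omega>\<in>space M'. integral {0..t} (\<lambda>s. r n v (N' s \<omega>)) \<in> face_map c t ` B \<and> N' t \<omega> = n}"
      using law_half_rate[OF F.poisson_counting_axioms P.poisson_counting_axioms F.t
          bounded_range_PiE[OF v finF, of "face_velocity c"] B, of n] by simp
    show ?thesis unfolding 1 2 f_def \<kappa>_def by simp
  qed
  \<comment> \<open>\<open>?\<phi>\<close> is a bijection from the face directions to the planar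
    velocities, hence \<open>r n\<close> is one between the sequences.\<close>
  have "(\<Sum>v\<in>PiE {..n} (\<lambda>_. ?F). f n (r n v)) = (\<Sum>v\<in>PiE {..n} (\<lambda>_. planar_velocities c). f n v)" for n
  proof (rule sum.reindex_bij_witness[where i="\<lambda>v. restrict (\<lambda>i. inv_into ?F ?\<phi> (v i)) {..n}" and j="r n"])
    have inj: "inj_on ?\<phi> ?F" by (rule inj_on_planar_velocity) (use F.c in simp)
    fix v assume v: "v \<in> PiE {..n} (\<lambda>_. ?F)"
    have vF: "v i \<in> ?F" if "i \<le> n" for i using PiE_mem[OF v] that by simp
    have iv: "inv_into ?F ?\<phi> (?\<phi> (v i)) = v i" if "i \<le> n" for i
      by (rule inv_into_f_f[OF inj vF[OF that]])
    show "restrict (\<lambda>i. inv_into ?F ?\<phi> (r n v i)) {..n} = v"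
      by (rule PiE_ext[OF _ v]) (auto simp: r_def iv vF)
    show "r n v \<in> PiE {..n} (\<lambda>_. planar_velocities c)"
      using v by (auto simp: r_def planar_velocities_eq)
  next
    fix v assume v: "v \<in> PiE {..n} (\<lambda>_. planar_velocities c)"
    have "v i \<in> ?\<phi> ` ?F" if "i \<le> n" for i
      using PiE_mem[OF v, of i] that by (simp add: planar_velocities_eq)
    note mem = inv_into_into[OF this] f_inv_into_f[OF this]
    show "restrict (\<lambda>i. inv_into ?F ?\<phi> (v i)) {..n} \<in> PiE {..n} (\<lambda>_. ?F)" using mem(1) by auto
    show "r n (restrict (\<lambda>i. inv_into ?F ?\<phi> (v i)) {..n}) = v"
      by (rule PiE_ext[OF _ v]) (use mem v in \<open>auto simp: r_def\<close>)
  qed simp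
  then have S: "(\<lambda>n. \<kappa> * (\<Sum>v\<in>PiE {..n} (\<lambda>_. planar_velocities c). f n v)) sums F.prob (F.face_event B)"
    using F.face_sums[OF B] summand by (simp add: sum_distrib_left[symmetric] cong: sum.cong)
  have S': "(\<lambda>n. \<Sum>v\<in>PiE {..n} (\<lambda>_. planar_velocities c). f n v)
      sums P.prob {\<omega>\<in>space M'. (\<forall>i\<le>N' t \<omega>. V' i \<omega> \<in> planar_velocities c)
        \<and> integral {0..t} (\<lambda>s. id (V' (N' s \<omega>) \<omega>)) \<in> face_map c t ` B}"
    unfolding f_def
    using P.direction_sums(2)[OF P.V_measurable P.indep P.finite_S F.t B', of id] by simp
  have eq: "{\<omega>\<in>space M'. (\<forall>i\<le>N' t \<omega>. V' i \<omega> \<in> planar_velocities c)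
        \<and> integral {0..t} (\<lambda>s. id (V' (N' s \<omega>) \<omega>)) \<in> face_map c t ` B}
      = {\<omega>\<in>space M'. W' t \<omega> \<in> face_map c t ` B}"
    using P.V_in W' by auto
  show ?thesis
    using sums_unique2[OF S sums_mult[OF S'[unfolded eq], of \<kappa>]] by (simp add: \<kappa>_def)
qed

text \<open>The singular set \<open>E\<close> pulls back to a set that is null and so has no mass
  under the face law. The factor \<open>\<kappa>\<close> between the laws is positive, so the planar
  law has no mass on \<open>E\<close> inside the image of the face either. There \<open>q\<close>
  integrates to the full law, and densities are unique almost everywhere.\<close>

lemma density_identity:
  assumes FM: "face_motion M lam N K V c t W"
    and PM: "motion M' (\<lambda>s. lam s / 2) N' (planar_velocities c) K' V'"
    and W': "\<And>\<omega>. \<omega> \<in> space M' \<Longrightarrow> W' t \<omega> = integral {0..t} (\<lambda>s. V' (N' s \<omega>) \<omega>)"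
    and init: "\<And>d. d \<in> face_directions \<Longrightarrow> pmf (pmf_of_set axis_directions) d
        = pmf (pmf_of_set (planar_velocities c)) (face_map c 1 (face_velocity c d)) / 2"
    and step: "\<And>d e. d \<in> face_directions \<Longrightarrow> e \<in> face_directions \<Longrightarrow> pmf (pmf_of_set (K d)) e
        = pmf (pmf_of_set (K' (face_map c 1 (face_velocity c d)))) (face_map c 1 (face_velocity c e)) / 2"
    and p: "is_face_density M c W t p" and q: "is_planar_density M' c W' t q"
  shows "AE z in lborel. z \<in> face_region c t \<longrightarrow>
    case_prod p z = 3 * sqrt 3 / 4 * exp (- cumulative_rate lam t / 2) * case_prod q (face_map c t z)"
proof -
  interpret F: face_motion M lam N K V c t W by fact
  interpret P: motion M' "\<lambda>s. lam s / 2" N' "planar_velocities c" K' V' by fact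
  let ?A = "face_map c t" and ?R = "face_region c t"
  note Q' = q[unfolded is_planar_density_def]
  obtain E where E: "E \<in> null_sets lborel" and Q: "\<And>B. B \<in> sets borel \<Longrightarrow> B \<subseteq> planar_region c t \<Longrightarrow>
      P.prob {\<omega> \<in> space M'. W' t \<omega> \<in> B} = (LINT z:B|lborel. case_prod q z) + P.prob {\<omega> \<in> space M'. W' t \<omega> \<in> B \<inter> E}"
    using Q' by (auto simp: case_prod_unfold)
  have qi: "set_integrable lborel (planar_region c t) (case_prod q)"
    and pi: "set_integrable lborel ?R (case_prod p)"
    using p q by (simp_all add: is_planar_density_def is_face_density_def)
  have Pd: "F.prob (F.face_event B) = (LINT z:B|lborel. case_prod p z)" if "B \<in> sets borel" "B \<subseteq> ?R" for B
    using p that by (simp add: is_face_density_def F.face_event_def case_prod_unfold)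
  have R: "?R \<in> sets borel" by (rule borel_open[OF open_face_region])
  define \<kappa> where "\<kappa> = exp (- cumulative_rate lam t / 2) / 2"
  define C where "C = 3 * sqrt 3 / 4 * exp (- cumulative_rate lam t / 2)"
  have \<kappa>: "\<kappa> > 0" "C = \<kappa> * (3 * sqrt 3 / 2)" by (simp_all add: \<kappa>_def C_def)
  have law: "F.prob (F.face_event B) = \<kappa> * P.prob {\<omega>\<in>space M'. W' t \<omega> \<in> ?A ` B}" if "B \<in> sets borel" for B
    unfolding \<kappa>_def
    by (rule face_law_eq[OF FM PM]) (rule W' init step that; assumption?)+
  have im: "?A ` B = face_map_inv c t -` B" for B
    by (auto simp: image_iff) (metis face_map_inverse(2))
  have imB: "?A ` B \<in> sets borel" if "B \<in> sets borel" for B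
    unfolding im by (rule measurable_sets_borel[OF face_map_measurable(2) that])
  have qint: "set_integrable lborel (?A ` B) (case_prod q)" if "B \<in> sets borel" "B \<subseteq> ?R" for B
    by (rule set_integrable_subset[OF qi])
       (use imB[OF that(1)] face_map_region[OF F.c F.t] that in auto)
  have qA: "integrable lborel (\<lambda>z. indicator B z *\<^sub>R case_prod q (?A z))"
    "(LINT z:?A ` B|lborel. case_prod q z) = 3 * sqrt 3 / 2 * (LINT z:B|lborel. case_prod q (?A z))"
    if "B \<in> sets borel" "B \<subseteq> ?R" for B
  proof -
    have e: "indicator (?A ` B) (?A z) *\<^sub>R case_prod q (?A z) = indicator B z *\<^sub>R case_prod q (?A z)" for z
      unfolding im by (simp add: indicator_def)
    note I = integral_lborel_face_map[OF qint[OF that, unfolded set_integrable_def], of c t, unfolded e]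
    show "integrable lborel (\<lambda>z. indicator B z *\<^sub>R case_prod q (?A z))" by (rule I(1))
    show "(LINT z:?A ` B|lborel. case_prod q z) = 3 * sqrt 3 / 2 * (LINT z:B|lborel. case_prod q (?A z))"
      unfolding set_lebesgue_integral_def by (rule I(2))
  qed
  have eq: "(LINT z:B|lborel. case_prod p z) = C * (LINT z:B|lborel. case_prod q (?A z))"
    if B: "B \<in> sets borel" "B \<subseteq> ?R" for B
  proof -
    have [measurable]: "E \<in> sets borel" using E by auto
    have N: "B \<inter> ?A -` E \<in> null_sets lborel"
      using face_map_vimage_null[OF E, of c t] B by (intro null_set_Int1) auto
    have "?A ` B \<inter> E = ?A ` (B \<inter> ?A -` E)" by auto
    then have "\<kappa> * P.prob {\<omega> \<in> space M'. W' t \<omega> \<in> ?A ` B \<inter> E} = F.prob (F.face_event (B \<inter> ?A -` E))"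
      using law[of "B \<inter> ?A -` E"] N by auto
    also have "\<dots> = 0" using B by (intro F.face_event_null[OF N]) auto
    finally have z: "P.prob {\<omega> \<in> space M'. W' t \<omega> \<in> ?A ` B \<inter> E} = 0" using \<kappa> by simp
    have "(LINT z:B|lborel. case_prod p z) = \<kappa> * P.prob {\<omega>\<in>space M'. W' t \<omega> \<in> ?A ` B}"
      using Pd[OF B] law[OF B(1)] by simp
    also have "P.prob {\<omega>\<in>space M'. W' t \<omega> \<in> ?A ` B} = (LINT z:?A ` B|lborel. case_prod q z)"
      using Q[OF imB[OF B(1)]] face_map_region[OF F.c F.t] B(2) z by auto
    finally show ?thesis using qA(2)[OF B] by (simp add: \<kappa>)
  qed
  have "AE z in lborel. indicator ?R z *\<^sub>R case_prod p z = C * (indicator ?R z *\<^sub>R case_prod q (?A z))"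
  proof (rule density_unique_real)
    show "integrable lborel (\<lambda>z. indicator ?R z *\<^sub>R case_prod p z)" using pi by (simp add: set_integrable_def)
    show "integrable lborel (\<lambda>z. C * (indicator ?R z *\<^sub>R case_prod q (?A z)))"
      using qA(1)[OF R] by (intro integrable_mult_right) auto
    fix X :: "(real \<times> real) set" assume "X \<in> sets lborel"
    then have "X \<inter> ?R \<in> sets borel" "X \<inter> ?R \<subseteq> ?R" using R by auto
    from eq[OF this] show "(LINT z:X|lborel. indicator ?R z *\<^sub>R case_prod p z)
        = (LINT z:X|lborel. C * (indicator ?R z *\<^sub>R case_prod q (?A z)))"
      by (simp add: set_lebesgue_integral_def indicator_inter_arith mult.assoc mult.left_commute[of _ C])
  qed
  then show ?thesis by eventually_elim (auto simp: C_def)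
qed

section \<open>Transition probabilities of the two chains\<close>

lemma card_axis_directions: "card axis_directions = 6" "finite axis_directions"
  by (simp_all add: axis_directions_def)

lemma card_face_directions: "card face_directions = 3" "finite face_directions"
  by (simp_all add: face_directions_def)

lemma face_subset_axis: "face_directions \<subseteq> axis_directions"
  by (auto simp: face_directions_def axis_directions_def)

text \<open>Among the axis directions only \<open>d\<close> and \<open>- d\<close> are not
  orthogonal to \<open>d\<close>, and \<open>- d\<close> is not a face direction.\<close>

lemma orthogonal_directions:
  assumes "d \<in> face_directions"
  shows "card {e \<in> axis_directions. e \<bullet> d = 0} = 4"
    and "e \<in> face_directions \<Longrightarrow> e \<bullet> d = 0 \<longleftrightarrow> e \<noteq> d"
proof -
  have perp: "e \<bullet> d = 0 \<longleftrightarrow> e \<noteq> d \<and> e \<noteq> - d" if "e \<in> axis_directions" for e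
    using assms that unfolding face_directions_def axis_directions_def
    by (elim insertE emptyE; simp add: inner_prod_def)
  have d: "d \<in> axis_directions" "- d \<in> axis_directions" "d \<noteq> - d" "- d \<notin> face_directions"
    using assms unfolding face_directions_def axis_directions_def
    by (elim insertE emptyE; simp)+
  have "{e \<in> axis_directions. e \<bullet> d = 0} = axis_directions - {d, - d}"
    using perp by blast
  then show "card {e \<in> axis_directions. e \<bullet> d = 0} = 4"
    using d by (simp add: card_Diff_subset card_axis_directions)
  show "e \<in> face_directions \<Longrightarrow> e \<bullet> d = 0 \<longleftrightarrow> e \<noteq> d"
    using perp d(4) face_subset_axis by blast
qed

lemma planar_velocity_facts:
  assumes "0 < c"
  shows "card (planar_velocities c) = 3" "finite (planar_velocities c)"
    and "d \<in> face_directions \<Longrightarrow> face_map c 1 (face_velocity c d) \<in> planar_velocities c"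
    and "d \<in> face_directions \<Longrightarrow> e \<in> face_directions \<Longrightarrow>
      face_map c 1 (face_velocity c d) = face_map c 1 (face_velocity c e) \<longleftrightarrow> d = e"
proof -
  have inj: "inj_on (\<lambda>d. face_map c 1 (face_velocity c d)) face_directions"
    by (rule inj_on_planar_velocity) (use assms in simp)
  show "card (planar_velocities c) = 3" "finite (planar_velocities c)"
    unfolding planar_velocities_eq using card_image[OF inj] by (simp_all add: card_face_directions)
  show "d \<in> face_directions \<Longrightarrow> face_map c 1 (face_velocity c d) \<in> planar_velocities c"
    by (simp add: planar_velocities_eq)
  show "d \<in> face_directions \<Longrightarrow> e \<in> face_directions \<Longrightarrow>
      face_map c 1 (face_velocity c d) = face_map c 1 (face_velocity c e) \<longleftrightarrow> d = e"
    using inj_on_eq_iff[OF inj] by simp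
qed

text \<open>The weights are 1/6 and 1/3. In the uniform motions every step is again uniform on the
  full set, so this serves for the steps there as well.\<close>

lemma initial_weight:
  assumes "0 < c" "d \<in> face_directions"
  shows "pmf (pmf_of_set axis_directions) d
    = pmf (pmf_of_set (planar_velocities c)) (face_map c 1 (face_velocity c d)) / 2"
  using assms planar_velocity_facts[OF assms(1)] card_axis_directions face_subset_axis
  by (subst (1 2) pmf_of_set) (auto simp: indicator_def)

text \<open>Both sides vanish for \<open>e = d\<close>; otherwise 1/4 stands against 1/2.\<close>

lemma standard_weight:
  assumes "0 < c" "d \<in> face_directions" "e \<in> face_directions"
  shows "pmf (pmf_of_set {e \<in> axis_directions. e \<bullet> d = 0}) e
    = pmf (pmf_of_set (planar_velocities c - {face_map c 1 (face_velocity c d)})) (face_map c 1 (face_velocity c e)) / 2"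
proof -
  note P = planar_velocity_facts[OF assms(1)] and O = orthogonal_directions[OF assms(2)]
  have card2: "card (planar_velocities c - {face_map c 1 (face_velocity c d)}) = 2"
    using P assms by (simp add: card_Diff_singleton)
  have "pmf (pmf_of_set {e \<in> axis_directions. e \<bullet> d = 0}) e = (if e = d then 0 else 1 / 4)"
  proof -
    have ne: "{e \<in> axis_directions. e \<bullet> d = 0} \<noteq> {}"
    proof
      assume "{e \<in> axis_directions. e \<bullet> d = 0} = {}"
      then show False using O(1) by (simp only: card.empty)
    qed
    have "finite {e \<in> axis_directions. e \<bullet> d = 0}" using card_axis_directions(2) by simp
    from pmf_of_set[OF ne this, of e] show ?thesis
      using O(1) O(2)[OF assms(3)] assms(3) face_subset_axis by (auto simp: indicator_def)
  qed
  moreover have "pmf (pmf_of_set (planar_velocities c - {face_map c 1 (face_velocity c d)})) (face_map c 1 (face_velocity c e))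
      = (if e = d then 0 else 1 / 2)"
  proof -
    have "planar_velocities c - {face_map c 1 (face_velocity c d)} \<noteq> {}"
      using card2 by (intro notI) (simp only: card.empty)
    moreover have "finite (planar_velocities c - {face_map c 1 (face_velocity c d)})" using P(2) by simp
    ultimately show ?thesis
      using P(3)[OF assms(3)] P(4)[OF assms(2,3)] card2
      by (auto simp: indicator_def pmf_of_set)
  qed
  ultimately show ?thesis by simp
qed

section \<open>From the definitions of the motions to the theorem\<close>

lemma orthogonal_motion_face_motion:
  assumes "orthogonal_motion M c lam K W" "prob_space M" "0 < c" "0 < t"
    and "\<And>s. 0 < s \<Longrightarrow> 0 < lam s" "\<And>s. 0 < s \<Longrightarrow> set_integrable lborel {0<..s} lam" "continuous_on {0<..} lam"
  obtains N V where "face_motion M lam N K V c t W"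
proof -
  obtain D where D: "direction_process M lam axis_directions K D"
    and W: "\<And>t \<omega>. 0 \<le> t \<Longrightarrow> \<omega> \<in> space M \<Longrightarrow> W t \<omega> = c *\<^sub>R (LINT s:{0..t}|lborel. D s \<omega>)"
    using assms(1) by (auto simp: orthogonal_motion_def)
  obtain N V where m: "motion M lam N axis_directions K V"
    and DV: "\<And>t \<omega>. 0 \<le> t \<Longrightarrow> \<omega> \<in> space M \<Longrightarrow> D t \<omega> = V (N t \<omega>) \<omega>"
    using direction_process_motion[OF D assms(2) card_axis_directions(2) assms(5-7)] by metis
  interpret motion M lam N axis_directions K V by fact
  have "W t \<omega> = c *\<^sub>R integral {0..t} (\<lambda>s. V (N s \<omega>) \<omega>)" if "\<omega> \<in> space M" for \<omega>
  proof -
    have "(LINT s:{0..t}|lborel. D s \<omega>) = (LINT s:{0..t}|lborel. V (N s \<omega>) \<omega>)"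
      by (rule set_lebesgue_integral_cong) (use DV that in auto)
    then show ?thesis using W that assms(4) set_lebesgue_integral_path[OF that assms(4)] by simp
  qed
  then have "face_motion M lam N K V c t W"
    using assms by unfold_locales auto
  then show thesis by (rule that)
qed

lemma planar_motion_motion:
  assumes "planar_motion M c lam K W" "prob_space M" "0 < c" "0 < t"
    and "\<And>s. 0 < s \<Longrightarrow> 0 < lam s" "\<And>s. 0 < s \<Longrightarrow> set_integrable lborel {0<..s} lam" "continuous_on {0<..} lam"
  obtains N V where "motion M lam N (planar_velocities c) K V"
    and "\<forall>\<omega>\<in>space M. W t \<omega> = integral {0..t} (\<lambda>s. V (N s \<omega>) \<omega>)"
proof -
  obtain D where D: "direction_process M lam (planar_velocities c) K D"
    and W: "\<And>t \<omega>. 0 \<le> t \<Longrightarrow> \<omega> \<in> space M \<Longrightarrow> W t \<omega> = (LINT s:{0..t}|lborel. D s \<omega>)"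
    using assms(1) by (auto simp: planar_motion_def)
  obtain N V where m: "motion M lam N (planar_velocities c) K V"
    and DV: "\<And>t \<omega>. 0 \<le> t \<Longrightarrow> \<omega> \<in> space M \<Longrightarrow> D t \<omega> = V (N t \<omega>) \<omega>"
    using direction_process_motion[OF D assms(2) planar_velocity_facts(2)[OF assms(3)] assms(5-7)] by metis
  interpret motion M lam N "planar_velocities c" K V by fact
  have "W t \<omega> = integral {0..t} (\<lambda>s. V (N s \<omega>) \<omega>)" if "\<omega> \<in> space M" for \<omega>
  proof -
    have "(LINT s:{0..t}|lborel. D s \<omega>) = (LINT s:{0..t}|lborel. V (N s \<omega>) \<omega>)"
      by (rule set_lebesgue_integral_cong) (use DV that in auto)
    then show ?thesis using W that assms(4) set_lebesgue_integral_path[OF that assms(4)] by simp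
  qed
  with m show thesis by (intro that) auto
qed

text \<open>Densities are determined only up to null sets, whence the identity almost everywhere;
  continuity of the chosen versions at corresponding points makes it exact there.\<close>

theorem theorem3p2:
  fixes M :: "'a measure" and W :: "real \<Rightarrow> 'a \<Rightarrow> real \<times> real \<times> real"
    and M' :: "'b measure" and W' :: "real \<Rightarrow> 'b \<Rightarrow> real \<times> real"
    and c t :: real and lam :: "real \<Rightarrow> real"
  assumes "c > 0" and "t > 0"
    and "\<forall>s>0. lam s > 0" and "C2_on_pos lam"
    and "\<forall>s>0. set_integrable lborel {0<..s} lam"
    and "prob_space M" and "prob_space M'"
    and "orthogonal_standard_motion M c lam W \<or> orthogonal_uniform_motion M c lam W"
  shows "(\<exists>p. is_face_density M c W t p) \<and>
    (\<forall>p q.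
       is_face_density M c W t p \<longrightarrow>
       is_planar_density M' c W' t q \<longrightarrow>
       (orthogonal_standard_motion M c lam W \<and>
          planar_symmetrically_deviating_motion M' c (\<lambda>s. lam s / 2) W') \<or>
       (orthogonal_uniform_motion M c lam W \<and>
          planar_uniform_motion M' c (\<lambda>s. lam s / 2) W') \<longrightarrow>
       (AE (x, y) in lborel. (x, y) \<in> face_region c t \<longrightarrow>
          p x y = 3 * sqrt 3 / 4 * exp (- cumulative_rate lam t / 2)
            * q ((3 * x - c * t) / 2) (sqrt 3 * y + sqrt 3 * (x - c * t) / 2)) \<and>
       (\<forall>x y. (x, y) \<in> face_region c t \<longrightarrow>
          isCont (\<lambda>(x, y). p x y) (x, y) \<longrightarrow>
          isCont (\<lambda>(u, v). q u v)
            ((3 * x - c * t) / 2, sqrt 3 * y + sqrt 3 * (x - c * t) / 2) \<longrightarrow>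
          p x y = 3 * sqrt 3 / 4 * exp (- cumulative_rate lam t / 2)
            * q ((3 * x - c * t) / 2) (sqrt 3 * y + sqrt 3 * (x - c * t) / 2)))"
proof -
  note [simp] = \<open>c > 0\<close> \<open>t > 0\<close>
  have pos: "\<And>s. 0 < s \<Longrightarrow> 0 < lam s" and int: "\<And>s. 0 < s \<Longrightarrow> set_integrable lborel {0<..s} lam"
    using assms by auto
  have cont: "continuous_on {0<..} lam"
  proof (intro continuous_at_imp_continuous_on ballI)
    fix s :: real assume "s \<in> {0<..}"
    then show "isCont lam s" using assms(4) unfolding C2_on_pos_def by (blast intro: DERIV_isCont greaterThan_iff[THEN iffD1])
  qed
  have pos': "\<And>s. 0 < s \<Longrightarrow> 0 < lam s / 2" and int': "\<And>s. 0 < s \<Longrightarrow> set_integrable lborel {0<..s} (\<lambda>s. lam s / 2)"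
    and cont': "continuous_on {0<..} (\<lambda>s. lam s / 2)"
    using pos int cont by (auto intro!: continuous_intros)
  note obt = orthogonal_motion_face_motion[OF _ \<open>prob_space M\<close> \<open>c > 0\<close> \<open>t > 0\<close> pos int cont, of _ W]
  note obt' = planar_motion_motion[OF _ \<open>prob_space M'\<close> \<open>c > 0\<close> \<open>t > 0\<close> pos' int' cont', of _ W']
  show ?thesis
  proof (intro conjI allI impI)
    obtain K where "orthogonal_motion M c lam K W"
      using assms(8) by (auto simp: orthogonal_standard_motion_def orthogonal_uniform_motion_def)
    then obtain N V where "face_motion M lam N K V c t W" by (rule obt)
    then show "\<exists>p. is_face_density M c W t p" by (rule face_motion.ex_face_density)
  next
    fix p q
    assume p: "is_face_density M c W t p" and q: "is_planar_density M' c W' t q"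
      and motions: "(orthogonal_standard_motion M c lam W \<and>
          planar_symmetrically_deviating_motion M' c (\<lambda>s. lam s / 2) W') \<or>
       (orthogonal_uniform_motion M c lam W \<and>
          planar_uniform_motion M' c (\<lambda>s. lam s / 2) W')"
    let ?C = "3 * sqrt 3 / 4 * exp (- cumulative_rate lam t / 2)"
    have ae: "AE z in lborel. z \<in> face_region c t \<longrightarrow> case_prod p z = ?C * case_prod q (face_map c t z)"
      using motions
    proof
      assume "orthogonal_standard_motion M c lam W \<and> planar_symmetrically_deviating_motion M' c (\<lambda>s. lam s / 2) W'"
      then have 1: "orthogonal_motion M c lam (\<lambda>d. {e \<in> axis_directions. e \<bullet> d = 0}) W"
        and 2: "planar_motion M' c (\<lambda>s. lam s / 2) (\<lambda>d. planar_velocities c - {d}) W'"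
        by (auto simp: orthogonal_standard_motion_def planar_symmetrically_deviating_motion_def)
      obtain N V where F: "face_motion M lam N (\<lambda>d. {e \<in> axis_directions. e \<bullet> d = 0}) V c t W"
        by (rule obt[OF 1])
      obtain N' V' where P: "motion M' (\<lambda>s. lam s / 2) N' (planar_velocities c) (\<lambda>d. planar_velocities c - {d}) V'"
        and W': "\<forall>\<omega>\<in>space M'. W' t \<omega> = integral {0..t} (\<lambda>s. V' (N' s \<omega>) \<omega>)"
        by (rule obt'[OF 2])
      show ?thesis
        by (rule density_identity[OF F P])
           (rule W'[rule_format] initial_weight[OF \<open>c > 0\<close>] standard_weight[OF \<open>c > 0\<close>] p q; assumption?)+
    next
      assume "orthogonal_uniform_motion M c lam W \<and> planar_uniform_motion M' c (\<lambda>s. lam s / 2) W'"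
      then have 1: "orthogonal_motion M c lam (\<lambda>d. axis_directions) W"
        and 2: "planar_motion M' c (\<lambda>s. lam s / 2) (\<lambda>d. planar_velocities c) W'"
        by (auto simp: orthogonal_uniform_motion_def planar_uniform_motion_def)
      obtain N V where F: "face_motion M lam N (\<lambda>d. axis_directions) V c t W"
        by (rule obt[OF 1])
      obtain N' V' where P: "motion M' (\<lambda>s. lam s / 2) N' (planar_velocities c) (\<lambda>d. planar_velocities c) V'"
        and W': "\<forall>\<omega>\<in>space M'. W' t \<omega> = integral {0..t} (\<lambda>s. V' (N' s \<omega>) \<omega>)"
        by (rule obt'[OF 2])
      show ?thesis
        by (rule density_identity[OF F P]) (rule W'[rule_format] initial_weight[OF \<open>c > 0\<close>] p q; assumption?)+
    qed
    then show "AE (x, y) in lborel. (x, y) \<in> face_region c t \<longrightarrow>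
          p x y = ?C * q ((3 * x - c * t) / 2) (sqrt 3 * y + sqrt 3 * (x - c * t) / 2)"
      by (simp add: face_map_def case_prod_unfold)
    fix x y
    assume xy: "(x, y) \<in> face_region c t" and cp: "isCont (\<lambda>(x, y). p x y) (x, y)"
      and cq: "isCont (\<lambda>(u, v). q u v) ((3 * x - c * t) / 2, sqrt 3 * y + sqrt 3 * (x - c * t) / 2)"
    have "isCont (face_map c t) (x, y)"
      using continuous_face_map(1) by (simp add: continuous_on_eq_continuous_at)
    then have "isCont (\<lambda>z. case_prod q (face_map c t z)) (x, y)"
      by (rule isCont_o2) (use cq in \<open>simp add: face_map_def\<close>)
    then have "isCont (\<lambda>z. ?C * case_prod q (face_map c t z)) (x, y)" by (intro continuous_intros)
    from AE_eq_imp_eq_at[OF ae open_face_region xy cp this]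
    show "p x y = ?C * q ((3 * x - c * t) / 2) (sqrt 3 * y + sqrt 3 * (x - c * t) / 2)"
      by (simp add: face_map_def)
  qed
qed

end
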